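(* Suppose that $\{S^{\tau(n)}_n:\mathcal{P}_n\to\mathcal{P}_n\}_{n=1}^\infty$ is a sequence of discrete maps that periodically approximates the flow $S^t:X\to X$ (in the sense defined in the context). Given any $\alpha>0$ and any interval $D\subset\mathbb{R}$, for every $g\in L^2(X,\mathcal{M},\mu)$, $$\lim_{n\to\infty}\left\|\mathcal{S}_{D_\alpha}g-\mathcal{S}^{\tau(n)}_{n,D_\alpha}g_n\right\|=0,$$ where $g_n=\mathcal{W}_ng$ and $$\mathcal{S}_{D_\alpha}g=\int_{\mathbb{R}}\chi_{D_\alpha}(\omega)\,\mathrm{d}\mathcal{S}_\omega g,\qquad \mathcal{S}^{\tau(n)}_{n,D_\alpha}g_n=\sum_{k=1}^{q(n)}\chi_{D_\alpha}(\omega_{n,k})\,\mathcal{S}^{\tau(n)}_{n,\omega_{n,k}}g_n .$$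
   Context: Setting. $X\subseteq\mathbb{R}^N$ is compact, with metric $d$ induced by a norm on $\mathbb{R}^N$. $S^t:X\to X$, $t\in\mathbb{R}$, is a flow: $S^t\circ S^s=S^{t+s}$ and $S^0=\mathrm{id}$. It is Lipschitz continuous: for every $T>0$ the map $(t,x)\mapsto S^t(x)$ is Lipschitz on $[-T,T]\times X$. $\mathcal{M}$ is the Borel sigma-algebra of $X$, and $\mu$ is a finite nonzero Borel measure on $X$, absolutely continuous with respect to Lebesgue measure, with $\operatorname{supp}\mu=X$, and invariant: $\mu(S^t(B))=\mu(B)$ for all $B\in\mathcal{M}$ and $t\in\mathbb{R}$. On $L^2(X,\mathcal{M},\mu)$ (complex-valued functions), $\langle g,h\rangle=\int_X g^*h\,\mathrm{d}\mu$, with norm $\|\cdot\|$. The Koopman unitary group is $\mathcal{U}^tg=g\circ S^t$. By the spectral theorem there is a unique projection-valued measure $\mathcal{S}$ on the Borel sets of $\mathbb{R}$ with $\mathcal{U}^tg=\int_{\mathbb{R}}e^{i\omega t}\,\mathrm{d}\mathcal{S}_\omega g$ for all $t\in\mathbb{R}$. Time steps. $\{\tau(n)\}_{n\ge1}$ is a monotonically decreasing sequence of positive reals converging to $0$, and $\xi_n(s)=\operatorname{sign}(s)\lceil |s|/\tau(n)\rceil\tau(n)$ for $s\in\mathbb{R}$. Partitions. $\mathcal{P}_n=\{p_{n,1},\dots,p_{n,q(n)}\}$, $n\ge1$, are measurable partitions of $X$ (the elements cover $X$ and distinct elements overlap only in $\mu$-null sets) such that: (i) each $p_{n,j}$ is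 compact and connected, and $\mu(p_{n,j})=\mu(X)/q(n)$, where $q:\mathbb{N}\to\mathbb{N}$ is strictly increasing; (ii) $\operatorname{diam}(p_{n,j})\le l(n)$, where $l$ is positive, monotone, and tends to $0$; (iii) for $n>m$, each $p_{m,j}$ is a union of elements of $\mathcal{P}_n$. Discrete maps. $S_n^{\tau(n)}:\mathcal{P}_n\to\mathcal{P}_n$ is a bijection of the finite set $\mathcal{P}_n$. For $k\in\mathbb{Z}$, $S_n^{k\tau(n)}$ is its $k$-th iterate, acting elementwise on unions of elements of $\mathcal{P}_n$ (viewed as subsets of $X$). For $A\subseteq X$, $A_n:=\bigcup\{p\in\mathcal{P}_n:p\cap A\ne\emptyset\}$. The sequence $\{S_n^{\tau(n)}\}$ periodically approximates $S^t$ if $$\lim_{n\to\infty}\int_{-t}^{t}d_H\left(S^s(A),S_n^{\xi_n(s)}(A_n)\right)\mathrm{d}s=0$$ for every $t\in\mathbb{R}$ and every nonempty compact $A\subseteq X$, where $d_H$ is the Hausdorff distance. Discrete Koopman operators and spectra. $L^2_n(X,\mathcal{M},\mu)$ is the span of the indicator functions $\chi_{p_{n,j}}$, $j=1,\dots,q(n)$. The averaging operator is $\mathcal{W}_ng=g_n=\sum_{j=1}^{q(n)}g_{n,j}\chi_{p_{n,j}}$ with $g_{n,j}=\frac{q(n)}{\mu(X)}\int_X g\,\chi_{p_{n,j}}\,\mathrm{d}\mu$. For $k\in\mathbb{Z}$, $\mathcal{U}_n^{k\tau(n)}g_n=\sum_{j}g_{n,j}\,\chi_{S_n^{-k\tau(n)}(p_{n,j})}$,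 a unitary (permutation) operator on $L^2_n(X,\mathcal{M},\mu)$. Let $v_{n,1},\dots,v_{n,q(n)}$ be an orthonormal basis of $L_n^2(X,\mathcal{M},\mu)$ of eigenfunctions, $\mathcal{U}_n^{\tau(n)}v_{n,k}=e^{i\theta_{n,k}}v_{n,k}$ with $\theta_{n,k}\in[-\pi,\pi)$, and put $\omega_{n,k}=\theta_{n,k}/\tau(n)$. $\mathcal{S}^{\tau(n)}_{n,\omega_{n,k}}g_n=v_{n,k}\langle v_{n,k},g_n\rangle$ is the rank-one projector attached to index $k$. Smoothed indicator. For $\alpha>0$ let $\varphi_\alpha(x,y)=\frac{K}{\alpha}\exp\left(\frac{-1}{1-(|x-y|/\alpha)^2}\right)$ if $|x-y|<\alpha$ and $\varphi_\alpha(x,y)=0$ otherwise, where $K=\left(\int_{-1}^1\exp\left(\frac{-1}{1-x^2}\right)\mathrm{d}x\right)^{-1}$. For an interval $D\subset\mathbb{R}$ with indicator function $\chi_D$, $\chi_{D_\alpha}(\omega)=\int_{\mathbb{R}}\varphi_\alpha(\omega,\xi)\chi_D(\xi)\,\mathrm{d}\xi$. *)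

theory Defs
  imports "HOL-Analysis.Analysis"
begin

section \<open>Metric notions for an arbitrary norm\<close>

text \<open>All norms on a finite-dimensional space induce the Euclidean topology, so the library notions
  \<^const>\<open>compact\<close>, \<^const>\<open>connected\<close>, \<^const>\<open>open\<close> and \<^const>\<open>borel\<close> serve for every norm. Quantities
  that depend on the metric itself use the given norm \<open>nrm\<close>.\<close>

definition is_norm :: "('a::real_vector \<Rightarrow> real) \<Rightarrow> bool" where
  "is_norm nrm \<longleftrightarrow>
     (\<forall>x. nrm x = 0 \<longleftrightarrow> x = 0) \<and>
     (\<forall>c x. nrm (c *\<^sub>R x) = \<bar>c\<bar> * nrm x) \<and>
     (\<forall>x y. nrm (x + y) \<le> nrm x + nrm y)"

text \<open>Only meaningful for nonempty bounded \<open>A\<close> and \<open>B\<close>.\<close>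

definition hausdorff_dist :: "('a::real_vector \<Rightarrow> real) \<Rightarrow> 'a set \<Rightarrow> 'a set \<Rightarrow> real" where
  "hausdorff_dist nrm A B =
     max (SUP x\<in>A. INF y\<in>B. nrm (x - y)) (SUP y\<in>B. INF x\<in>A. nrm (x - y))"

section \<open>The flow and its invariant measure\<close>

definition is_flow :: "'a set \<Rightarrow> (real \<Rightarrow> 'a \<Rightarrow> 'a) \<Rightarrow> bool" where
  "is_flow X S \<longleftrightarrow>
     (\<forall>t. S t ` X \<subseteq> X) \<and>
     (\<forall>t s. \<forall>x\<in>X. S t (S s x) = S (t + s) x) \<and>
     (\<forall>x\<in>X. S 0 x = x)"

definition lipschitz_flow ::
    "('a::real_vector \<Rightarrow> real) \<Rightarrow> 'a set \<Rightarrow> (real \<Rightarrow> 'a \<Rightarrow> 'a) \<Rightarrow> bool" where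
  "lipschitz_flow nrm X S \<longleftrightarrow> is_flow X S \<and>
     (\<forall>T>0. \<exists>L. \<forall>s\<in>{-T..T}. \<forall>t\<in>{-T..T}. \<forall>x\<in>X. \<forall>y\<in>X.
        nrm (S s x - S t y) \<le> L * (\<bar>s - t\<bar> + nrm (x - y)))"

text \<open>Topological support of a Borel measure on the subspace \<open>X\<close>.\<close>

definition measure_support :: "'a::topological_space set \<Rightarrow> 'a measure \<Rightarrow> 'a set" where
  "measure_support X M = {x \<in> X. \<forall>U. open U \<and> x \<in> U \<longrightarrow> emeasure M (U \<inter> X) > 0}"

definition admissible_measure ::
    "'a::euclidean_space set \<Rightarrow> (real \<Rightarrow> 'a \<Rightarrow> 'a) \<Rightarrow> 'a measure \<Rightarrow> bool" where
  "admissible_measure X S M \<longleftrightarrow>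
     sets M = sets (restrict_space borel X) \<and>
     finite_measure M \<and> emeasure M X \<noteq> 0 \<and>
     absolutely_continuous (restrict_space lborel X) M \<and>
     measure_support X M = X \<and>
     (\<forall>B\<in>sets M. \<forall>t. emeasure M (S t ` B) = emeasure M B)"

section \<open>The complex Hilbert space of square-integrable functions\<close>

text \<open>Elements are represented by functions; equality in the Hilbert space is equality almost
  everywhere, and operators act on representatives.\<close>

definition L2 :: "'a measure \<Rightarrow> ('a \<Rightarrow> complex) set" where
  "L2 M = {g \<in> borel_measurable M. integrable M (\<lambda>x. (cmod (g x))\<^sup>2)}"

definition L2_inner :: "'a measure \<Rightarrow> ('a \<Rightarrow> complex) \<Rightarrow> ('a \<Rightarrow> complex) \<Rightarrow> complex" where
  "L2_inner M g h = (LINT x|M. cnj (g x) * h x)"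

definition L2_norm :: "'a measure \<Rightarrow> ('a \<Rightarrow> complex) \<Rightarrow> real" where
  "L2_norm M g = sqrt (LINT x|M. (cmod (g x))\<^sup>2)"

section \<open>Projection-valued measures and spectral integrals\<close>

definition projection_valued_measure ::
    "'a measure \<Rightarrow> (real set \<Rightarrow> ('a \<Rightarrow> complex) \<Rightarrow> ('a \<Rightarrow> complex)) \<Rightarrow> bool" where
  "projection_valued_measure M E \<longleftrightarrow>
     \<comment> \<open>each \<open>E B\<close> is a well-defined linear operator on the Hilbert space\<close>
     (\<forall>B\<in>sets borel. \<forall>g\<in>L2 M. E B g \<in> L2 M) \<and>
     (\<forall>B\<in>sets borel. \<forall>g\<in>L2 M. \<forall>h\<in>L2 M.
        (AE x in M. g x = h x) \<longrightarrow> (AE x in M. E B g x = E B h x)) \<and>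
     (\<forall>B\<in>sets borel. \<forall>g\<in>L2 M. \<forall>h\<in>L2 M. \<forall>a b.
        AE x in M. E B (\<lambda>y. a * g y + b * h y) x = a * E B g x + b * E B h x) \<and>
     \<comment> \<open>each \<open>E B\<close> is an orthogonal projection (idempotence is the case \<open>B = C\<close> below)\<close>
     (\<forall>B\<in>sets borel. \<forall>g\<in>L2 M. \<forall>h\<in>L2 M. L2_inner M (E B g) h = L2_inner M g (E B h)) \<and>
     (\<forall>B\<in>sets borel. \<forall>C\<in>sets borel. \<forall>g\<in>L2 M.
        AE x in M. E B (E C g) x = E (B \<inter> C) g x) \<and>
     (\<forall>g\<in>L2 M. AE x in M. E {} g x = 0) \<and>
     (\<forall>g\<in>L2 M. AE x in M. E UNIV g x = g x) \<and>
     \<comment> \<open>countable additivity in the strong operator topology\<close>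
     (\<forall>B :: nat \<Rightarrow> real set. range B \<subseteq> sets borel \<longrightarrow> disjoint_family B \<longrightarrow>
        (\<forall>g\<in>L2 M. (\<lambda>n. L2_norm M (\<lambda>x. E (\<Union>i. B i) g x - (\<Sum>i<n. E (B i) g x))) \<longlonglongrightarrow> 0))"

text \<open>The integral of a bounded Borel function \<open>f\<close> against \<open>E\<close>, applied to \<open>g\<close>: the norm limit of
  the integrals of simple functions that converge to \<open>f\<close> uniformly. It is determined up to equality
  almost everywhere.\<close>

definition has_spectral_integral ::
    "'a measure \<Rightarrow> (real set \<Rightarrow> ('a \<Rightarrow> complex) \<Rightarrow> ('a \<Rightarrow> complex)) \<Rightarrow> (real \<Rightarrow> complex) \<Rightarrow>
     ('a \<Rightarrow> complex) \<Rightarrow> ('a \<Rightarrow> complex) \<Rightarrow> bool" where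
  "has_spectral_integral M E f g h \<longleftrightarrow> h \<in> L2 M \<and>
     (\<exists>s :: nat \<Rightarrow> real \<Rightarrow> complex.
        (\<forall>n. simple_function borel (s n)) \<and>
        uniform_limit UNIV s f sequentially \<and>
        (\<lambda>n. L2_norm M (\<lambda>x. (\<Sum>c\<in>range (s n). c * E (s n -` {c}) g x) - h x)) \<longlonglongrightarrow> 0)"

definition spectral_integral ::
    "'a measure \<Rightarrow> (real set \<Rightarrow> ('a \<Rightarrow> complex) \<Rightarrow> ('a \<Rightarrow> complex)) \<Rightarrow> (real \<Rightarrow> complex) \<Rightarrow>
     ('a \<Rightarrow> complex) \<Rightarrow> ('a \<Rightarrow> complex)" where
  "spectral_integral M E f g = (SOME h. has_spectral_integral M E f g h)"

definition koopman :: "(real \<Rightarrow> 'a \<Rightarrow> 'a) \<Rightarrow> real \<Rightarrow> ('a \<Rightarrow> complex) \<Rightarrow> ('a \<Rightarrow> complex)" where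
  "koopman S t g = g \<circ> S t"

definition koopman_spectral_measure ::
    "(real \<Rightarrow> 'a \<Rightarrow> 'a) \<Rightarrow> 'a measure \<Rightarrow> (real set \<Rightarrow> ('a \<Rightarrow> complex) \<Rightarrow> ('a \<Rightarrow> complex)) \<Rightarrow> bool" where
  "koopman_spectral_measure S M E \<longleftrightarrow> projection_valued_measure M E \<and>
     (\<forall>t. \<forall>g\<in>L2 M. has_spectral_integral M E (\<lambda>\<omega>. exp (\<i> * of_real (\<omega> * t))) g (koopman S t g))"

section \<open>Time steps, partitions and discrete maps\<close>

text \<open>Sequences indexed by \<open>n \<ge> 1\<close> are functions on \<^typ>\<open>nat\<close> whose value at 0 is unconstrained.\<close>

definition time_steps :: "(nat \<Rightarrow> real) \<Rightarrow> bool" where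
  "time_steps \<tau> \<longleftrightarrow>
     (\<forall>n\<ge>1. \<tau> n > 0) \<and> (\<forall>m n. 1 \<le> m \<and> m \<le> n \<longrightarrow> \<tau> n \<le> \<tau> m) \<and> \<tau> \<longlonglongrightarrow> 0"

definition \<xi> :: "(nat \<Rightarrow> real) \<Rightarrow> nat \<Rightarrow> real \<Rightarrow> real" where
  "\<xi> \<tau> n s = sgn s * of_int \<lceil>\<bar>s\<bar> / \<tau> n\<rceil> * \<tau> n"

text \<open>The integer \<open>k\<close> with \<open>\<xi> \<tau> n s = k * \<tau> n\<close>.\<close>

definition \<xi>_steps :: "(nat \<Rightarrow> real) \<Rightarrow> nat \<Rightarrow> real \<Rightarrow> int" where
  "\<xi>_steps \<tau> n s = (if s < 0 then - \<lceil>\<bar>s\<bar> / \<tau> n\<rceil> else \<lceil>\<bar>s\<bar> / \<tau> n\<rceil>)"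

lemma \<xi>_eq_steps: "\<xi> \<tau> n s = of_int (\<xi>_steps \<tau> n s) * \<tau> n"
  by (simp add: \<xi>_def \<xi>_steps_def sgn_if)

text \<open>Since cells have positive measure and overlap only in null sets, the cells are pairwise
  distinct as sets, so a partition is given as a set of \<open>q n\<close> cells.\<close>

definition partition_sequence ::
    "('a::euclidean_space \<Rightarrow> real) \<Rightarrow> 'a set \<Rightarrow> 'a measure \<Rightarrow> (nat \<Rightarrow> nat) \<Rightarrow> (nat \<Rightarrow> real) \<Rightarrow>
     (nat \<Rightarrow> 'a set set) \<Rightarrow> bool" where
  "partition_sequence nrm X M q l P \<longleftrightarrow>
     (\<forall>n\<ge>1. finite (P n) \<and> card (P n) = q n \<and> P n \<subseteq> sets M \<and> \<Union>(P n) = X) \<and>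
     (\<forall>n\<ge>1. \<forall>p\<in>P n. \<forall>p'\<in>P n. p \<noteq> p' \<longrightarrow> emeasure M (p \<inter> p') = 0) \<and>
     (\<forall>n\<ge>1. \<forall>p\<in>P n. compact p \<and> connected p \<and> measure M p = measure M X / real (q n)) \<and>
     (\<forall>m n. 1 \<le> m \<and> m < n \<longrightarrow> q m < q n) \<and>
     (\<forall>n\<ge>1. \<forall>p\<in>P n. \<forall>x\<in>p. \<forall>y\<in>p. nrm (x - y) \<le> l n) \<and>
     (\<forall>n\<ge>1. l n > 0) \<and> (\<forall>m n. 1 \<le> m \<and> m \<le> n \<longrightarrow> l n \<le> l m) \<and> l \<longlonglongrightarrow> 0 \<and>
     (\<forall>m n. 1 \<le> m \<and> m < n \<longrightarrow> (\<forall>p\<in>P m. \<exists>Q\<subseteq>P n. p = \<Union>Q))"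

text \<open>Integer iterates of a bijection \<open>T\<close> of the set \<open>C\<close>.\<close>

definition int_iterate :: "'b set \<Rightarrow> ('b \<Rightarrow> 'b) \<Rightarrow> int \<Rightarrow> 'b \<Rightarrow> 'b" where
  "int_iterate C T k = (if k \<ge> 0 then T ^^ nat k else inv_into C T ^^ nat (- k))"

text \<open>The \<open>k\<close>-th iterate of a cell map acting on a union \<open>B\<close> of cells. A cell contained in a union
  of cells is one of these cells, because distinct cells overlap only in null sets; hence the cells
  that make up \<open>B\<close> are exactly those contained in \<open>B\<close>.\<close>

definition cell_image :: "'a set set \<Rightarrow> ('a set \<Rightarrow> 'a set) \<Rightarrow> int \<Rightarrow> 'a set \<Rightarrow> 'a set" where
  "cell_image C T k B = \<Union>(int_iterate C T k ` {p \<in> C. p \<subseteq> B})"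

definition cell_cover :: "'a set set \<Rightarrow> 'a set \<Rightarrow> 'a set" where
  "cell_cover C A = \<Union>{p \<in> C. p \<inter> A \<noteq> {}}"

definition periodically_approximates ::
    "('a::euclidean_space \<Rightarrow> real) \<Rightarrow> 'a set \<Rightarrow> (real \<Rightarrow> 'a \<Rightarrow> 'a) \<Rightarrow> (nat \<Rightarrow> real) \<Rightarrow>
     (nat \<Rightarrow> 'a set set) \<Rightarrow> (nat \<Rightarrow> 'a set \<Rightarrow> 'a set) \<Rightarrow> bool" where
  "periodically_approximates nrm X S \<tau> P T \<longleftrightarrow>
     (\<forall>t::real. \<forall>A. A \<subseteq> X \<and> compact A \<and> A \<noteq> {} \<longrightarrow>
        (\<lambda>n. LBINT s=ereal (- t)..ereal t.
               hausdorff_dist nrm (S s ` A) (cell_image (P n) (T n) (\<xi>_steps \<tau> n s) (cell_cover (P n) A)))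
        \<longlonglongrightarrow> 0)"

section \<open>Discrete Koopman operators and their spectra\<close>

definition cell_space :: "'a measure \<Rightarrow> 'a set set \<Rightarrow> ('a \<Rightarrow> complex) set" where
  "cell_space M C =
     {g \<in> L2 M. \<exists>c. AE x in M. g x = (\<Sum>p\<in>C. c p * indicator p x)}"

definition cell_average :: "'a measure \<Rightarrow> 'a set set \<Rightarrow> ('a \<Rightarrow> complex) \<Rightarrow> 'a set \<Rightarrow> complex" where
  "cell_average M C g p =
     of_real (real (card C) / measure M (space M)) * (LINT x|M. g x * indicator p x)"

definition averaging :: "'a measure \<Rightarrow> 'a set set \<Rightarrow> ('a \<Rightarrow> complex) \<Rightarrow> ('a \<Rightarrow> complex)" where
  "averaging M C g = (\<lambda>x. \<Sum>p\<in>C. cell_average M C g p * indicator p x)"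

text \<open>On \<^const>\<open>cell_space\<close> the coefficients of a function are its cell averages.\<close>

definition discrete_koopman ::
    "'a measure \<Rightarrow> 'a set set \<Rightarrow> ('a set \<Rightarrow> 'a set) \<Rightarrow> int \<Rightarrow> ('a \<Rightarrow> complex) \<Rightarrow> ('a \<Rightarrow> complex)" where
  "discrete_koopman M C T k g =
     (\<lambda>x. \<Sum>p\<in>C. cell_average M C g p * indicator (int_iterate C T (- k) p) x)"

definition orthonormal_basis ::
    "'a measure \<Rightarrow> ('a \<Rightarrow> complex) set \<Rightarrow> nat \<Rightarrow> (nat \<Rightarrow> 'a \<Rightarrow> complex) \<Rightarrow> bool" where
  "orthonormal_basis M V d v \<longleftrightarrow>
     (\<forall>k\<in>{1..d}. v k \<in> V) \<and>
     (\<forall>j\<in>{1..d}. \<forall>k\<in>{1..d}. L2_inner M (v j) (v k) = (if j = k then 1 else 0)) \<and>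
     (\<forall>g\<in>V. \<exists>c. AE x in M. g x = (\<Sum>k\<in>{1..d}. c k * v k x))"

definition discrete_eigenbasis ::
    "'a measure \<Rightarrow> 'a set set \<Rightarrow> ('a set \<Rightarrow> 'a set) \<Rightarrow> nat \<Rightarrow> (nat \<Rightarrow> 'a \<Rightarrow> complex) \<Rightarrow> (nat \<Rightarrow> real) \<Rightarrow> bool" where
  "discrete_eigenbasis M C T d v \<theta> \<longleftrightarrow>
     orthonormal_basis M (cell_space M C) d v \<and>
     (\<forall>k\<in>{1..d}. \<theta> k \<in> {-pi..<pi} \<and>
        (AE x in M. discrete_koopman M C T 1 (v k) x = exp (\<i> * of_real (\<theta> k)) * v k x))"

section \<open>Smoothed spectral projections\<close>

definition mollifier :: "real \<Rightarrow> real \<Rightarrow> real \<Rightarrow> real" where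
  "mollifier \<alpha> x y =
     (if \<bar>x - y\<bar> < \<alpha>
      then inverse (LBINT u=-1..1. exp (- 1 / (1 - u\<^sup>2))) / \<alpha> * exp (- 1 / (1 - (\<bar>x - y\<bar> / \<alpha>)\<^sup>2))
      else 0)"

definition smoothed_indicator :: "real \<Rightarrow> real set \<Rightarrow> real \<Rightarrow> real" where
  "smoothed_indicator \<alpha> D \<omega> = (LINT y|lborel. mollifier \<alpha> \<omega> y * indicator D y)"

definition smoothed_projection ::
    "'a measure \<Rightarrow> (real set \<Rightarrow> ('a \<Rightarrow> complex) \<Rightarrow> ('a \<Rightarrow> complex)) \<Rightarrow> real \<Rightarrow> real set \<Rightarrow>
     ('a \<Rightarrow> complex) \<Rightarrow> ('a \<Rightarrow> complex)" where
  "smoothed_projection M E \<alpha> D g =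
     spectral_integral M E (\<lambda>\<omega>. of_real (smoothed_indicator \<alpha> D \<omega>)) g"

definition rank_one_projector ::
    "'a measure \<Rightarrow> ('a \<Rightarrow> complex) \<Rightarrow> ('a \<Rightarrow> complex) \<Rightarrow> ('a \<Rightarrow> complex)" where
  "rank_one_projector M v g = (\<lambda>x. v x * L2_inner M v g)"

definition discrete_smoothed_projection ::
    "'a measure \<Rightarrow> nat \<Rightarrow> (nat \<Rightarrow> 'a \<Rightarrow> complex) \<Rightarrow> (nat \<Rightarrow> real) \<Rightarrow> real \<Rightarrow> real set \<Rightarrow>
     ('a \<Rightarrow> complex) \<Rightarrow> ('a \<Rightarrow> complex)" where
  "discrete_smoothed_projection M d v \<omega> \<alpha> D g =
     (\<lambda>x. \<Sum>k=1..d. of_real (smoothed_indicator \<alpha> D (\<omega> k)) * rank_one_projector M (v k) g x)"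

end

theory Submission
  imports Defs
begin

text \<open>For a compact set \<open>A\<close> the Hausdorff hypothesis, invariance of \<open>\<mu>\<close> and equality of the cell measures
  force the symmetric difference of \<open>S\<^sup>s(A)\<close> and its discrete image to be small for most \<open>s\<close>. By density,
  the discrete evolution of every \<open>g\<close> follows its Koopman evolution in time average. A discretised Laplace
  transform in time gives convergence of the resolvent \<open>1 / (1 - i\<omega>)\<close> of the generators. Convergence of functions
  of the generators passes to sums, products, adjoints and uniform limits, so by Stone-Weierstrass it holds for
  all continuous functions of compact support. A cutoff in frequency then reaches all bounded continuous
  functions, such as the smoothed indicator of a possibly unbounded interval.\<close>

section \<open>Square-integrable functions\<close>

text \<open>The hypothesis controls Hausdorff distances only after integration over time, so it
  gives no direct convergence at a prescribed time; time has to be integrated against a weight. The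
  weight exp(-s) on s > 0 turns the Koopman group into the resolvent of its generator at 1.
  Composition with the flow pulls sets back, so positive times for functions are negative times for
  sets, whence the pieces to the left of 0. Two limitations shape the rest. A step
  \<open>\<tau> n\<close> resolves only frequencies up to pi / \<open>\<tau> n\<close>: the discrete
  frequencies obey this bound by construction, those of the flow do not, and their share is made
  small by a frequency window fixed before \<open>n\<close>. Moreover the discrete operators see
  only cell functions: the constant symbol 1 yields averaging rather than the identity. Constants
  are therefore kept out of the algebra, and Stone-Weierstrass is applied to functions that vanish
  at the point representing infinite frequency.\<close>

abbreviation (input) L2_dist :: "'a measure \<Rightarrow> ('a \<Rightarrow> complex) \<Rightarrow> ('a \<Rightarrow> complex) \<Rightarrow> real" where
  "L2_dist M f g \<equiv> L2_norm M (\<lambda>x. f x - g x)"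

section \<open>Linear structure and seminorm\<close>

lemma L2_measurable [measurable_dest]: "f \<in> L2 M \<Longrightarrow> f \<in> borel_measurable M"
  by (simp add: L2_def)

lemma L2_integrable: "f \<in> L2 M \<Longrightarrow> integrable M (\<lambda>x. (cmod (f x))\<^sup>2)"
  by (simp add: L2_def)

lemma cmod_add_square_le: "(cmod (a + b))\<^sup>2 \<le> 2 * (cmod a)\<^sup>2 + 2 * (cmod b)\<^sup>2"
proof -
  have "(cmod (a + b))\<^sup>2 \<le> (cmod a + cmod b)\<^sup>2"
    by (intro power_mono norm_triangle_ineq) auto
  also have "\<dots> \<le> 2 * (cmod a)\<^sup>2 + 2 * (cmod b)\<^sup>2"
    using sum_squares_bound[of "cmod a" "cmod b"] by (simp add: power2_sum)
  finally show ?thesis .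
qed

lemma L2_add: assumes "f \<in> L2 M" "g \<in> L2 M" shows "(\<lambda>x. f x + g x) \<in> L2 M"
proof -
  note [measurable] = L2_measurable[OF assms(1)] L2_measurable[OF assms(2)]
  have "integrable M (\<lambda>x. 2 * (cmod (f x))\<^sup>2 + 2 * (cmod (g x))\<^sup>2)"
    using assms by (intro Bochner_Integration.integrable_add integrable_mult_right L2_integrable)
  then have "integrable M (\<lambda>x. (cmod (f x + g x))\<^sup>2)"
    by (rule Bochner_Integration.integrable_bound)
       (use cmod_add_square_le in \<open>auto intro!: AE_I2 simp: abs_of_nonneg\<close>)
  then show ?thesis by (simp add: L2_def)
qed

lemma L2_scale: assumes "f \<in> L2 M" shows "(\<lambda>x. c * f x) \<in> L2 M"
  using assms by (auto simp: L2_def norm_mult power_mult_distrib)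

lemma L2_zero [simp]: "(\<lambda>x. 0) \<in> L2 M"
  by (simp add: L2_def)

lemma L2_diff: assumes "f \<in> L2 M" "g \<in> L2 M" shows "(\<lambda>x. f x - g x) \<in> L2 M"
  using L2_add[OF assms(1) L2_scale[OF assms(2), of "-1"]] by simp

lemma L2_sum: assumes "\<And>i. i \<in> I \<Longrightarrow> f i \<in> L2 M" shows "(\<lambda>x. \<Sum>i\<in>I. f i x) \<in> L2 M"
  using assms by (induction I rule: infinite_finite_induct) (auto intro: L2_add)

text \<open>The flow is controlled on \<open>X\<close> only, so functions composed with it can be
  compared on the space of the measure but not as HOL functions.\<close>

lemma L2_cong_space: "(\<And>x. x \<in> space M \<Longrightarrow> f x = g x) \<Longrightarrow> f \<in> L2 M \<longleftrightarrow> g \<in> L2 M"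
  unfolding L2_def by (simp cong: measurable_cong Bochner_Integration.integrable_cong)

lemma L2_norm_cong_space: "(\<And>x. x \<in> space M \<Longrightarrow> f x = g x) \<Longrightarrow> L2_norm M f = L2_norm M g"
  unfolding L2_norm_def by (simp cong: Bochner_Integration.integral_cong)

lemma L2_norm_nonneg [simp]: "L2_norm M f \<ge> 0"
  by (simp add: L2_norm_def)

lemma L2_norm_square: "(L2_norm M f)\<^sup>2 = (LINT x|M. (cmod (f x))\<^sup>2)"
  by (simp add: L2_norm_def)

lemma L2_norm_zero [simp]: "L2_norm M (\<lambda>x. 0) = 0"
  by (simp add: L2_norm_def)

lemma L2_norm_scale: "L2_norm M (\<lambda>x. c * f x) = cmod c * L2_norm M f"
  by (simp add: L2_norm_def norm_mult power_mult_distrib real_sqrt_mult)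

lemma L2_norm_diff_commute: "L2_dist M f g = L2_dist M g f"
  by (simp add: L2_norm_def norm_minus_commute)

lemma L2_norm_eq_0_iff:
  assumes "f \<in> L2 M" shows "L2_norm M f = 0 \<longleftrightarrow> (AE x in M. f x = 0)"
  unfolding L2_norm_def real_sqrt_eq_0_iff
  by (subst integral_nonneg_eq_0_iff_AE[OF L2_integrable[OF assms]]) auto

lemma L2_norm_cong_AE:
  assumes "f \<in> L2 M" "g \<in> L2 M" "AE x in M. f x = g x"
  shows "L2_norm M f = L2_norm M g"
proof -
  note [measurable] = L2_measurable[OF assms(1)] L2_measurable[OF assms(2)]
  have "(LINT x|M. (cmod (f x))\<^sup>2) = (LINT x|M. (cmod (g x))\<^sup>2)"
    by (rule integral_cong_AE) (use assms(3) in auto)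
  then show ?thesis by (simp add: L2_norm_def)
qed

text \<open>For \<open>a, b > 0\<close> convexity of the square gives
  \<open>|u + v|\<^sup>2 \<le> (a + b) (|u|\<^sup>2 / a + |v|\<^sup>2 / b)\<close>; integrate with \<open>a > \<parallel>f\<parallel>\<close>, \<open>b > \<parallel>g\<parallel>\<close>.\<close>

lemma L2_norm_triangle:
  assumes "f \<in> L2 M" "g \<in> L2 M"
  shows "L2_norm M (\<lambda>x. f x + g x) \<le> L2_norm M f + L2_norm M g"
proof (rule field_le_epsilon)
  fix e :: real assume e: "e > 0"
  define a where "a = L2_norm M f + e / 2"
  define b where "b = L2_norm M g + e / 2"
  have ab: "a > 0" "b > 0" "L2_norm M f \<le> a" "L2_norm M g \<le> b"
    using e by (auto simp: a_def b_def add_nonneg_pos)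
  have pw: "(cmod (u + v))\<^sup>2 \<le> (a + b) * ((cmod u)\<^sup>2 / a + (cmod v)\<^sup>2 / b)" for u v
  proof -
    have "(cmod (u + v))\<^sup>2 \<le> (cmod u + cmod v)\<^sup>2"
      by (intro power_mono norm_triangle_ineq) auto
    also have "\<dots> \<le> (a + b) * ((cmod u)\<^sup>2 / a + (cmod v)\<^sup>2 / b)"
    proof -
      have "(a + b) * ((cmod u)\<^sup>2 / a + (cmod v)\<^sup>2 / b) - (cmod u + cmod v)\<^sup>2
        = (b * cmod u - a * cmod v)\<^sup>2 / (a * b)"
        using ab(1,2) by (simp add: field_simps power2_eq_square)
      also have "\<dots> \<ge> 0" using ab by simp
      finally show ?thesis by simp
    qed
    finally show ?thesis .
  qed
  have "(LINT x|M. (cmod (f x + g x))\<^sup>2)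
      \<le> (LINT x|M. (a + b) * ((cmod (f x))\<^sup>2 / a + (cmod (g x))\<^sup>2 / b))"
    by (intro integral_mono L2_integrable L2_add assms integrable_mult_right
        Bochner_Integration.integrable_add integrable_divide pw)
  also have "\<dots> = (a + b) * ((L2_norm M f)\<^sup>2 / a + (L2_norm M g)\<^sup>2 / b)"
    using assms by (simp add: L2_norm_square L2_integrable)
  also have "\<dots> \<le> (a + b) * (a\<^sup>2 / a + b\<^sup>2 / b)"
    using ab by (intro mult_left_mono add_mono divide_right_mono power_mono) auto
  also have "\<dots> = (a + b)\<^sup>2" using ab by (simp add: power2_eq_square)
  finally have "L2_norm M (\<lambda>x. f x + g x) \<le> sqrt ((a + b)\<^sup>2)"
    unfolding L2_norm_def by (rule real_sqrt_le_mono)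
  then show "L2_norm M (\<lambda>x. f x + g x) \<le> L2_norm M f + L2_norm M g + e"
    using ab by (simp add: a_def b_def)
qed

lemma L2_norm_triangle_diff:
  assumes "f \<in> L2 M" "g \<in> L2 M" "h \<in> L2 M"
  shows "L2_dist M f h \<le> L2_dist M f g + L2_dist M g h"
  using L2_norm_triangle[OF L2_diff[OF assms(1,2)] L2_diff[OF assms(2,3)]] by simp

lemma L2_norm_diff_le:
  assumes "f \<in> L2 M" "g \<in> L2 M"
  shows "L2_dist M f g \<le> L2_norm M f + L2_norm M g"
  using L2_norm_triangle_diff[OF assms(1) L2_zero assms(2)]
    L2_norm_diff_commute[of M "\<lambda>x. 0" g] by simp

lemma L2_norm_sum_le:
  assumes "\<And>i. i \<in> I \<Longrightarrow> f i \<in> L2 M"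
  shows "L2_norm M (\<lambda>x. \<Sum>i\<in>I. f i x) \<le> (\<Sum>i\<in>I. L2_norm M (f i))"
  using assms
proof (induction I rule: infinite_finite_induct)
  case (insert i I)
  have "L2_norm M (\<lambda>x. f i x + (\<Sum>i\<in>I. f i x)) \<le> L2_norm M (f i) + L2_norm M (\<lambda>x. \<Sum>i\<in>I. f i x)"
    by (intro L2_norm_triangle L2_sum) (use insert in auto)
  with insert show ?case by force
qed auto

lemma L2_norm_triangle_rev:
  assumes "f \<in> L2 M" "g \<in> L2 M"
  shows "\<bar>L2_norm M f - L2_norm M g\<bar> \<le> L2_dist M f g"
  using L2_norm_triangle_diff[OF assms L2_zero] L2_norm_triangle_diff[OF assms(2,1) L2_zero]
  by (simp add: L2_norm_diff_commute[of M f])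

section \<open>The inner product\<close>

lemma L2_inner_integrable:
  assumes "f \<in> L2 M" "g \<in> L2 M" shows "integrable M (\<lambda>x. cnj (f x) * g x)"
proof -
  note [measurable] = L2_measurable[OF assms(1)] L2_measurable[OF assms(2)]
  have "integrable M (\<lambda>x. (cmod (f x))\<^sup>2 + (cmod (g x))\<^sup>2)"
    using assms by (intro Bochner_Integration.integrable_add L2_integrable)
  moreover have "cmod (f x) * cmod (g x) \<le> (cmod (f x))\<^sup>2 + (cmod (g x))\<^sup>2" for x
    using sum_squares_bound[of "cmod (f x)" "cmod (g x)"]
      mult_nonneg_nonneg[of "cmod (f x)" "cmod (g x)"] norm_ge_zero[of "f x"] norm_ge_zero[of "g x"]
    by linarith
  moreover have "(\<lambda>x. cnj (f x) * g x) \<in> borel_measurable M"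
    using measurable_compose[OF L2_measurable[OF assms(1)] borel_measurable_continuous_onI[of cnj]]
    by (intro borel_measurable_times) (auto intro: continuous_intros)
  ultimately show ?thesis
    by (elim Bochner_Integration.integrable_bound) (auto simp: norm_mult)
qed

lemma L2_inner_diff_right:
  assumes "f \<in> L2 M" "g \<in> L2 M" "h \<in> L2 M"
  shows "L2_inner M f (\<lambda>x. g x - h x) = L2_inner M f g - L2_inner M f h"
  unfolding L2_inner_def using assms by (simp add: right_diff_distrib L2_inner_integrable)

lemma L2_inner_scale_right: "L2_inner M f (\<lambda>x. c * g x) = c * L2_inner M f g"
  unfolding L2_inner_def by (simp add: mult.left_commute)

lemma L2_inner_cnj: "L2_inner M g f = cnj (L2_inner M f g)"
  unfolding L2_inner_def by (subst Bochner_Integration.integral_cnj[of M "\<lambda>x. cnj (f x) * g x", symmetric]) (simp add: mult.commute)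

lemma L2_inner_scale_left: "L2_inner M (\<lambda>x. c * f x) g = cnj c * L2_inner M f g"
  by (subst (1 2) L2_inner_cnj) (simp add: L2_inner_scale_right)

lemma L2_inner_sum_right:
  assumes "f \<in> L2 M" "\<And>i. i \<in> I \<Longrightarrow> g i \<in> L2 M"
  shows "L2_inner M f (\<lambda>x. \<Sum>i\<in>I. g i x) = (\<Sum>i\<in>I. L2_inner M f (g i))"
  unfolding L2_inner_def sum_distrib_left
  by (rule Bochner_Integration.integral_sum) (use assms in \<open>auto intro: L2_inner_integrable\<close>)

lemma L2_inner_sum_left:
  assumes "f \<in> L2 M" "\<And>i. i \<in> I \<Longrightarrow> g i \<in> L2 M"
  shows "L2_inner M (\<lambda>x. \<Sum>i\<in>I. g i x) f = (\<Sum>i\<in>I. L2_inner M (g i) f)"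
  by (subst L2_inner_cnj, subst L2_inner_sum_right[OF assms], assumption)
     (simp add: cnj_sum L2_inner_cnj[of M _ f])

lemma L2_inner_cong_AE:
  assumes "f \<in> L2 M" "f' \<in> L2 M" "g \<in> L2 M" "g' \<in> L2 M"
    "AE x in M. f x = f' x" "AE x in M. g x = g' x"
  shows "L2_inner M f g = L2_inner M f' g'"
  unfolding L2_inner_def
proof (rule integral_cong_AE)
  show "AE x in M. cnj (f x) * g x = cnj (f' x) * g' x" using assms(5,6) by eventually_elim simp
qed (rule borel_measurable_integrable[OF L2_inner_integrable] assms)+

lemma L2_inner_self: "L2_inner M f f = of_real ((L2_norm M f)\<^sup>2)"
proof -
  have "cnj (f x) * f x = complex_of_real ((cmod (f x))\<^sup>2)" for x
    using complex_norm_square[of "f x"] by (simp add: mult.commute)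
  then show ?thesis
    unfolding L2_inner_def L2_norm_square by (simp del: of_real_power)
qed

lemma L2_norm_square_diff:
  assumes "f \<in> L2 M" "g \<in> L2 M"
  shows "(L2_dist M f g)\<^sup>2 = (L2_norm M f)\<^sup>2 - 2 * Re (L2_inner M f g) + (L2_norm M g)\<^sup>2"
proof -
  have *: "(\<lambda>x. f x - g x) \<in> L2 M" by (rule L2_diff[OF assms])
  have "L2_inner M (\<lambda>x. f x - g x) h = cnj (L2_inner M h f) - cnj (L2_inner M h g)" if "h \<in> L2 M" for h
    using assms that by (subst L2_inner_cnj) (simp add: L2_inner_diff_right)
  then have "L2_inner M (\<lambda>x. f x - g x) (\<lambda>x. f x - g x) =
    cnj (L2_inner M f f) - cnj (L2_inner M g f) - (cnj (L2_inner M f g) - cnj (L2_inner M g g))"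
    using assms * by (simp add: L2_inner_diff_right)
  also have "\<dots> = of_real ((L2_norm M f)\<^sup>2) - L2_inner M f g - (cnj (L2_inner M f g) - of_real ((L2_norm M g)\<^sup>2))"
    by (simp add: L2_inner_self L2_inner_cnj[of M g f])
  finally have "Re (of_real ((L2_dist M f g)\<^sup>2)) =
      Re (of_real ((L2_norm M f)\<^sup>2) - L2_inner M f g - (cnj (L2_inner M f g) - of_real ((L2_norm M g)\<^sup>2)))"
    unfolding L2_inner_self by (rule arg_cong)
  then show ?thesis by (simp del: of_real_power)
qed

text \<open>Integrate the weighted inequality \<open>u * v \<le> b / (2 * a) * u\<^sup>2 + a / (2 *
  b) * v\<^sup>2\<close>. The weights \<open>a\<close> and \<open>b\<close> exceed the norms by
  \<open>e\<close>, so that dividing by them is safe even for vanishing norms; then \<open>e\<close>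
  tends to 0.\<close>

lemma L2_Cauchy_Schwarz:
  assumes "f \<in> L2 M" "g \<in> L2 M"
  shows "cmod (L2_inner M f g) \<le> L2_norm M f * L2_norm M g"
proof -
  note [measurable] = L2_measurable[OF assms(1)] L2_measurable[OF assms(2)]
  have "cmod (L2_inner M f g) \<le> (L2_norm M f + e) * (L2_norm M g + e)" if e: "e > 0" for e
  proof -
    define a where "a = L2_norm M f + e"
    define b where "b = L2_norm M g + e"
    have ab: "a > 0" "b > 0" "L2_norm M f \<le> a" "L2_norm M g \<le> b"
      using e by (auto simp: a_def b_def add_nonneg_pos)
    have "cmod (L2_inner M f g) \<le> (LINT x|M. cmod (cnj (f x) * g x))"
      unfolding L2_inner_def by (rule integral_norm_bound)
    also have "\<dots> \<le> (LINT x|M. (b / (2 * a)) * (cmod (f x))\<^sup>2 + (a / (2 * b)) * (cmod (g x))\<^sup>2)"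
    proof (intro integral_mono integrable_norm L2_inner_integrable assms
        Bochner_Integration.integrable_add integrable_mult_right L2_integrable)
      fix x
      have "(b / (2 * a)) * (cmod (f x))\<^sup>2 + (a / (2 * b)) * (cmod (g x))\<^sup>2 - cmod (f x) * cmod (g x)
        = (b * cmod (f x) - a * cmod (g x))\<^sup>2 / (2 * a * b)"
        using ab(1,2) by (simp add: field_simps power2_eq_square)
      also have "\<dots> \<ge> 0" using ab by simp
      finally show "cmod (cnj (f x) * g x) \<le>
        (b / (2 * a)) * (cmod (f x))\<^sup>2 + (a / (2 * b)) * (cmod (g x))\<^sup>2"
        by (simp add: norm_mult)
    qed
    also have "\<dots> = (b / (2 * a)) * (L2_norm M f)\<^sup>2 + (a / (2 * b)) * (L2_norm M g)\<^sup>2"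
      using assms by (simp add: L2_norm_square L2_integrable)
    also have "\<dots> \<le> (b / (2 * a)) * a\<^sup>2 + (a / (2 * b)) * b\<^sup>2"
      using ab by (intro add_mono mult_left_mono power_mono) auto
    also have "\<dots> = a * b" using ab by (simp add: field_simps power2_eq_square)
    finally show ?thesis by (simp add: a_def b_def)
  qed
  moreover have "((\<lambda>e. (L2_norm M f + e) * (L2_norm M g + e)) \<longlongrightarrow>
      (L2_norm M f + 0) * (L2_norm M g + 0)) (at_right 0)"
    by (intro tendsto_intros)
  ultimately show ?thesis
    using tendsto_lowerbound[of "\<lambda>e. (L2_norm M f + e) * (L2_norm M g + e)" _ "at_right 0"
        "cmod (L2_inner M f g)"]
    by (auto simp: eventually_at_right_less eventually_at_filter)
qed

section \<open>Indicators and completeness\<close>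

lemma L2_norm_le_iff: "a \<ge> 0 \<Longrightarrow> L2_norm M f \<le> a \<longleftrightarrow> (LINT x|M. (cmod (f x))\<^sup>2) \<le> a\<^sup>2"
  unfolding L2_norm_def by (metis abs_of_nonneg real_sqrt_abs real_sqrt_le_iff)

lemma (in finite_measure) L2_indicator [intro]: "B \<in> sets M \<Longrightarrow> (indicator B :: 'a \<Rightarrow> complex) \<in> L2 M"
proof -
  assume [measurable]: "B \<in> sets M"
  have "(\<lambda>x. (cmod (indicator B x))\<^sup>2) = (indicator B :: 'a \<Rightarrow> real)"
    by (auto simp: indicator_def)
  then show ?thesis by (simp add: L2_def emeasure_finite less_top[symmetric])
qed

text \<open>A finite measure turns rapid decay of the increments in the mean square into summability of
  their \<open>L\<^sup>1\<close> norms, hence into pointwise convergence almost everywhere.\<close>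

lemma L2_complete:
  assumes "finite_measure M" and u: "\<And>k::nat. u k \<in> L2 M"
    and Cauchy: "\<And>e. e > 0 \<Longrightarrow> \<exists>K. \<forall>j\<ge>K. \<forall>k\<ge>K. L2_dist M (u j) (u k) < e"
  obtains h where "h \<in> L2 M" "(\<lambda>k. L2_dist M (u k) h) \<longlonglongrightarrow> 0"
proof -
  interpret finite_measure M by fact
  have um [measurable]: "u k \<in> borel_measurable M" for k using u L2_measurable by blast
  obtain K where K: "\<And>i j k. K i \<le> j \<Longrightarrow> K i \<le> k \<Longrightarrow> L2_dist M (u j) (u k) < (1/2) ^ i"
    using Cauchy[of "(1/2)^_"] by (metis half_gt_zero_iff zero_less_one zero_less_power)
  \<comment> \<open>Running maxima make the thresholds \<open>K i\<close> nondecreasing, so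
    \<open>r i\<close> and \<open>r (Suc i)\<close> both lie beyond \<open>K i\<close> and the
    increments inherit the rate \<open>(1/2) ^ i\<close>.\<close>
  define r where "r i = Max (K ` {..i})" for i :: nat
  have rK: "K i \<le> r i" "r i \<le> r (Suc i)" for i by (auto simp: r_def intro!: Max_mono)
  define d where "d i x = u (r (Suc i)) x - u (r i) x" for i x
  have dm [measurable]: "d i \<in> borel_measurable M" for i unfolding d_def by measurable
  have dL2: "d i \<in> L2 M" for i using L2_diff[OF u u] by (simp add: d_def[abs_def])
  have dn: "L2_norm M (d i) \<le> (1/2) ^ i" for i
    using K[of i "r (Suc i)" "r i"] rK(1)[of i] rK(2)[of i] by (simp add: d_def[abs_def])
  have dint: "(\<integral>\<^sup>+x. ennreal (cmod (d i x)) \<partial>M) \<le> ennreal ((1 + measure M (space M)) * (1/2) ^ i)" for i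
  proof -
    \<comment> \<open>Expanding the square of \<open>2 ^ i * cmod (d i x) - 1\<close> trades the
      modulus for its square. The factor \<open>2 ^ i\<close> balances the norm bound
      \<open>(1/2) ^ i\<close>, so that both terms integrate to a multiple of
      \<open>(1/2) ^ i\<close>.\<close>
    have pw: "cmod (d i x) \<le> 2 ^ i * (cmod (d i x))\<^sup>2 + (1/2) ^ i" for x
    proof -
      have "0 \<le> (2 ^ i * cmod (d i x) - 1)\<^sup>2 + 2 ^ i * cmod (d i x)" by simp
      then have "2 ^ i * cmod (d i x) \<le> (2 ^ i) * (2 ^ i * (cmod (d i x))\<^sup>2) + 1"
        by (simp add: power2_diff power_mult_distrib algebra_simps power2_eq_square)
      then show ?thesis by (simp add: field_simps power_one_over)
    qed
    have int: "integrable M (\<lambda>x. 2 ^ i * (cmod (d i x))\<^sup>2 + (1/2) ^ i)"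
      using L2_integrable[OF dL2] by auto
    have "(\<integral>\<^sup>+x. ennreal (cmod (d i x)) \<partial>M) \<le>
        (\<integral>\<^sup>+x. ennreal (2 ^ i * (cmod (d i x))\<^sup>2 + (1/2) ^ i) \<partial>M)"
      by (intro nn_integral_mono ennreal_leI pw)
    also have "\<dots> = ennreal (LINT x|M. 2 ^ i * (cmod (d i x))\<^sup>2 + (1/2) ^ i)"
      by (rule nn_integral_eq_integral[OF int]) auto
    also have "(LINT x|M. 2 ^ i * (cmod (d i x))\<^sup>2 + (1/2) ^ i) =
        2 ^ i * (L2_norm M (d i))\<^sup>2 + (1/2) ^ i * measure M (space M)"
      using L2_integrable[OF dL2] by (simp add: L2_norm_square)
    also have "\<dots> \<le> 2 ^ i * ((1/2) ^ i)\<^sup>2 + (1/2) ^ i * measure M (space M)"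
      by (intro add_mono mult_left_mono power_mono dn) auto
    also have "\<dots> = (1 + measure M (space M)) * (1/2) ^ i"
      by (simp add: field_simps power2_eq_square power_one_over)
    finally show ?thesis by (simp add: ennreal_leI)
  qed
  have "(\<integral>\<^sup>+x. (\<Sum>i. ennreal (cmod (d i x))) \<partial>M) = (\<Sum>i. \<integral>\<^sup>+x. ennreal (cmod (d i x)) \<partial>M)"
    by (rule nn_integral_suminf) auto
  also have "\<dots> \<le> (\<Sum>i. ennreal ((1 + measure M (space M)) * (1/2) ^ i))"
    by (intro suminf_le dint) auto
  also have "\<dots> = ennreal (\<Sum>i. (1 + measure M (space M)) * (1/2) ^ i)"
    by (rule suminf_ennreal2) (auto intro!: summable_mult summable_geometric)
  also have "\<dots> < \<infinity>" by simp
  finally have "AE x in M. (\<Sum>i. ennreal (cmod (d i x))) \<noteq> \<infinity>"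
    by (intro nn_integral_PInf_AE) auto
  then have conv: "AE x in M. convergent (\<lambda>i. u (r i) x)"
  proof eventually_elim
    case (elim x)
    then have "summable (\<lambda>i. cmod (d i x))"
      by (intro summable_suminf_not_top) (auto simp: top.not_eq_extremum)
    then have "summable (\<lambda>i. d i x)" by (rule summable_norm_cancel)
    then have "convergent (\<lambda>n. \<Sum>i<n. d i x)" by (simp add: summable_iff_convergent)
    then have "convergent (\<lambda>n. (\<Sum>i<n. d i x) + u (r 0) x)"
      by (intro convergent_add convergent_const)
    moreover have "(\<Sum>i<n. d i x) = u (r n) x - u (r 0) x" for n
      unfolding d_def by (rule sum_lessThan_telescope)
    ultimately show ?case by simp
  qed
  define h where "h x = lim (\<lambda>i. u (r i) x)" for x
  have hm [measurable]: "h \<in> borel_measurable M" unfolding h_def[abs_def] by measurable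
  \<comment> \<open>Fatou along the subsequence carries the Cauchy bound over to the limit
    \<open>h\<close>.\<close>
  have est: "(\<integral>\<^sup>+x. ennreal ((cmod (u k x - h x))\<^sup>2) \<partial>M) \<le> ennreal (((1/2) ^ i)\<^sup>2)" if "K i \<le> k" for i k
  proof -
    have "(\<integral>\<^sup>+x. ennreal ((cmod (u k x - h x))\<^sup>2) \<partial>M) =
      (\<integral>\<^sup>+x. liminf (\<lambda>j. ennreal ((cmod (u k x - u (r j) x))\<^sup>2)) \<partial>M)"
    proof (rule nn_integral_cong_AE, use conv in eventually_elim)
      fix x assume "convergent (\<lambda>i. u (r i) x)"
      then have "(\<lambda>i. u (r i) x) \<longlonglongrightarrow> h x" by (simp add: h_def convergent_LIMSEQ_iff)
      then have "(\<lambda>j. ennreal ((cmod (u k x - u (r j) x))\<^sup>2)) \<longlonglongrightarrow> ennreal ((cmod (u k x - h x))\<^sup>2)"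
        by (intro tendsto_intros tendsto_ennrealI)
      then show "ennreal ((cmod (u k x - h x))\<^sup>2) = liminf (\<lambda>j. ennreal ((cmod (u k x - u (r j) x))\<^sup>2))"
        by (intro lim_imp_Liminf[symmetric]) auto
    qed
    also have "\<dots> \<le> liminf (\<lambda>j. \<integral>\<^sup>+x. ennreal ((cmod (u k x - u (r j) x))\<^sup>2) \<partial>M)"
      by (rule nn_integral_liminf) measurable
    also have "\<dots> \<le> ennreal (((1/2) ^ i)\<^sup>2)"
    proof (rule Liminf_le)
      show "\<forall>\<^sub>F j in sequentially. (\<integral>\<^sup>+x. ennreal ((cmod (u k x - u (r j) x))\<^sup>2) \<partial>M) \<le> ennreal (((1/2) ^ i)\<^sup>2)"
        using eventually_ge_at_top[of i]
      proof eventually_elim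
        case (elim j)
        have "r i \<le> r j" using elim by (simp add: lift_Suc_mono_le[of r, OF rK(2)])
        then have "L2_dist M (u k) (u (r j)) \<le> (1/2) ^ i"
          using K[of i k "r j"] that rK(1)[of i] by simp
        then have "(LINT x|M. (cmod (u k x - u (r j) x))\<^sup>2) \<le> ((1/2) ^ i)\<^sup>2"
          by (subst (asm) L2_norm_le_iff) auto
        moreover have "(\<integral>\<^sup>+x. ennreal ((cmod (u k x - u (r j) x))\<^sup>2) \<partial>M) =
            ennreal (LINT x|M. (cmod (u k x - u (r j) x))\<^sup>2)"
          by (rule nn_integral_eq_integral) (use L2_integrable[OF L2_diff[OF u u]] in auto)
        ultimately show ?case by (simp add: ennreal_leI)
      qed
    qed simp
    finally show ?thesis .
  qed
  have dif: "(\<lambda>x. u k x - h x) \<in> L2 M" if "K i \<le> k" for i k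
    using est[OF that] unfolding L2_def
    by (auto intro!: integrableI_nonneg simp: le_less_trans)
  have norm: "L2_dist M (u k) h \<le> (1/2) ^ i" if "K i \<le> k" for i k
  proof -
    have "ennreal (LINT x|M. (cmod (u k x - h x))\<^sup>2) \<le> ennreal (((1/2) ^ i)\<^sup>2)"
      using est[OF that] nn_integral_eq_integral[OF L2_integrable[OF dif[OF that]]] by simp
    then show ?thesis by (subst L2_norm_le_iff) (auto simp: ennreal_le_iff)
  qed
  show thesis
  proof
    \<comment> \<open>\<open>h\<close> is a member of the sequence minus a square-integrable
      difference, which spares a separate bound on \<open>h\<close>.\<close>
    show "h \<in> L2 M" using L2_diff[OF u[of "K 0"] dif[of 0 "K 0"]] by simp
    show "(\<lambda>k. L2_dist M (u k) h) \<longlonglongrightarrow> 0"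
    proof (rule LIMSEQ_I)
      fix e :: real assume "e > 0"
      then obtain i where "(1/2::real) ^ i < e" using real_arch_pow_inv[of e "1/2"] by auto
      then show "\<exists>n0. \<forall>n\<ge>n0. norm (L2_dist M (u n) h - 0) < e"
        using norm[of i] by (intro exI[of _ "K i"]) (auto intro: le_less_trans)
    qed
  qed
qed

section \<open>Spectral integrals\<close>

definition simple_spectral ::
    "(real set \<Rightarrow> ('a \<Rightarrow> complex) \<Rightarrow> 'a \<Rightarrow> complex) \<Rightarrow> (real \<Rightarrow> complex) \<Rightarrow> ('a \<Rightarrow> complex) \<Rightarrow> 'a \<Rightarrow> complex" where
  "simple_spectral E s g = (\<lambda>x. \<Sum>c\<in>range s. c * E (s -` {c}) g x)"

lemma simple_function_borelD:
  assumes "simple_function borel (s :: real \<Rightarrow> 'b)"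
  shows "finite (range s)" "s -` {c} \<in> sets borel"
proof -
  show "finite (range s)" using assms by (simp add: simple_function_def)
  show "s -` {c} \<in> sets borel"
  proof (cases "c \<in> range s")
    case True then show ?thesis using assms by (auto simp: simple_function_def)
  next
    case False then have "s -` {c} = {}" by auto
    then show ?thesis by simp
  qed
qed

text \<open>Round real and imaginary parts down to multiples of \<open>1 / Suc n\<close>:
  boundedness leaves finitely many values, and the error is at most
  \<open>2 / Suc n\<close>.\<close>

lemma simple_function_uniform_approx:
  fixes f :: "'a \<Rightarrow> complex"
  assumes f [measurable]: "f \<in> borel_measurable M" and "\<And>x. cmod (f x) \<le> C"
  obtains s where "\<And>n. simple_function M (s n)" "uniform_limit UNIV s f sequentially"
proof -
  define d where "d n y = real_of_int \<lfloor>real (Suc n) * y\<rfloor> / real (Suc n)" for n y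
  define s where "s n x = Complex (d n (Re (f x))) (d n (Im (f x)))" for n x
  have d: "\<bar>d n y - y\<bar> \<le> 1 / real (Suc n)" for n y
  proof -
    have "d n y - y = (real_of_int \<lfloor>real (Suc n) * y\<rfloor> - real (Suc n) * y) / real (Suc n)"
      by (simp add: d_def field_simps)
    moreover have "\<bar>real_of_int \<lfloor>real (Suc n) * y\<rfloor> - real (Suc n) * y\<bar> \<le> 1"
      using floor_correct[of "real (Suc n) * y"] by linarith
    ultimately show ?thesis by (simp add: divide_right_mono abs_divide)
  qed
  have "simple_function M (s n)" for n
  proof -
    have fin: "finite (d n ` {-C..C})"
    proof (rule finite_subset)
      show "d n ` {-C..C} \<subseteq>
          (\<lambda>k. real_of_int k / real (Suc n)) ` {\<lfloor>real (Suc n) * -C\<rfloor>..\<lfloor>real (Suc n) * C\<rfloor>}"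
      proof safe
        fix y assume "y \<in> {-C..C}"
        then have "real (Suc n) * - C \<le> real (Suc n) * y" "real (Suc n) * y \<le> real (Suc n) * C"
          by (intro mult_left_mono; simp)+
        then have "\<lfloor>real (Suc n) * y\<rfloor> \<in> {\<lfloor>real (Suc n) * -C\<rfloor>..\<lfloor>real (Suc n) * C\<rfloor>}"
          unfolding atLeastAtMost_iff by (intro conjI floor_mono)
        then show "d n y \<in> (\<lambda>k. real_of_int k / real (Suc n)) ` {\<lfloor>real (Suc n) * -C\<rfloor>..\<lfloor>real (Suc n) * C\<rfloor>}"
          unfolding d_def by (rule imageI)
      qed
    qed auto
    have bd: "Re (f x) \<in> {-C..C}" "Im (f x) \<in> {-C..C}" for x
      using abs_Re_le_cmod[of "f x"] abs_Im_le_cmod[of "f x"] assms(2)[of x] by auto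
    have "s n ` space M \<subseteq> (\<lambda>(a, b). Complex a b) ` (d n ` {-C..C} \<times> d n ` {-C..C})"
    proof
      fix y assume "y \<in> s n ` space M"
      then obtain x where "y = (\<lambda>(a, b). Complex a b) (d n (Re (f x)), d n (Im (f x)))"
        by (auto simp: s_def)
      moreover have "(d n (Re (f x)), d n (Im (f x))) \<in> d n ` {-C..C} \<times> d n ` {-C..C}"
        using bd[of x] by blast
      ultimately show "y \<in> (\<lambda>(a, b). Complex a b) ` (d n ` {-C..C} \<times> d n ` {-C..C})" by (rule image_eqI)
    qed
    then have "finite (s n ` space M)" by (rule finite_subset) (use fin in auto)
    moreover have "s n \<in> borel_measurable M"
      unfolding s_def[abs_def] d_def Complex_eq by measurable
    ultimately show ?thesis by (simp add: simple_function_borel_measurable)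
  qed
  moreover have "uniform_limit UNIV s f sequentially"
  proof (rule uniform_limitI)
    fix e :: real assume "e > 0"
    then obtain N where N: "2 / real (Suc N) < e"
      using reals_Archimedean[of "e / 2"] by (auto simp: field_simps)
    show "\<forall>\<^sub>F n in sequentially. \<forall>x\<in>UNIV. dist (s n x) (f x) < e"
      using eventually_ge_at_top[of N]
    proof eventually_elim
      case (elim n)
      show ?case
      proof
        fix x
        have "dist (s n x) (f x) \<le> \<bar>Re (s n x - f x)\<bar> + \<bar>Im (s n x - f x)\<bar>"
          unfolding dist_norm by (rule cmod_le)
        also have "\<dots> \<le> 1 / real (Suc n) + 1 / real (Suc n)"
          using d[of n] by (intro add_mono) (simp_all add: s_def)
        also have "\<dots> \<le> 2 / real (Suc N)" using elim by (simp add: frac_le)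
        finally show "dist (s n x) (f x) < e" using N by simp
      qed
    qed
  qed
  ultimately show thesis using that by blast
qed

text \<open>The denominator \<open>a + 1\<close> covers \<open>a = 0\<close>, which saves a case
  split on vanishing norms in the epsilon arguments.\<close>

lemma small_factor:
  fixes a e :: real
  assumes "e > 0" "a \<ge> 0"
  obtains d where "d > 0" "d * a < e"
proof
  show "e / (a + 1) > 0" using assms by simp
  show "e / (a + 1) * a < e" using assms by (simp add: field_simps)
qed

section \<open>Simple functions of a projection-valued measure\<close>

locale spectral_measure = finite_measure M for M :: "'a measure" +
  fixes E :: "real set \<Rightarrow> ('a \<Rightarrow> complex) \<Rightarrow> 'a \<Rightarrow> complex"
  assumes pvm: "projection_valued_measure M E"
begin

abbreviation (input) Sp where "Sp \<equiv> simple_spectral E"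

abbreviation HS where "HS \<equiv> has_spectral_integral M E"

lemma E_L2: "B \<in> sets borel \<Longrightarrow> g \<in> L2 M \<Longrightarrow> E B g \<in> L2 M"
  and E_linear: "B \<in> sets borel \<Longrightarrow> g \<in> L2 M \<Longrightarrow> h \<in> L2 M \<Longrightarrow>
     AE x in M. E B (\<lambda>y. a * g y + b * h y) x = a * E B g x + b * E B h x"
  and E_adjoint: "B \<in> sets borel \<Longrightarrow> g \<in> L2 M \<Longrightarrow> h \<in> L2 M \<Longrightarrow>
     L2_inner M (E B g) h = L2_inner M g (E B h)"
  and E_Int: "B \<in> sets borel \<Longrightarrow> C \<in> sets borel \<Longrightarrow> g \<in> L2 M \<Longrightarrow>
     AE x in M. E B (E C g) x = E (B \<inter> C) g x"
  and E_empty: "g \<in> L2 M \<Longrightarrow> AE x in M. E {} g x = 0"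
  and E_UNIV: "g \<in> L2 M \<Longrightarrow> AE x in M. E UNIV g x = g x"
  and E_countably_additive: "range A \<subseteq> sets borel \<Longrightarrow> disjoint_family A \<Longrightarrow> g \<in> L2 M \<Longrightarrow>
     (\<lambda>n. L2_norm M (\<lambda>x. E (\<Union>i. A i) g x - (\<Sum>i<n. E (A i) g x))) \<longlonglongrightarrow> 0"
  using pvm unfolding projection_valued_measure_def by simp_all

lemma E_sum:
  assumes B: "B \<in> sets borel" and "finite I" "\<And>i. i \<in> I \<Longrightarrow> g i \<in> L2 M"
  shows "AE x in M. E B (\<lambda>y. \<Sum>i\<in>I. a i * g i y) x = (\<Sum>i\<in>I. a i * E B (g i) x)"
  using assms(2,3)
proof (induction I)
  case empty
  show ?case using E_linear[OF B L2_zero L2_zero, of 0 0] by simp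
next
  case (insert i I)
  have gi: "g i \<in> L2 M" and s: "(\<lambda>y. \<Sum>i\<in>I. a i * g i y) \<in> L2 M"
    using insert by (auto intro!: L2_sum L2_scale)
  have "AE x in M. E B (\<lambda>y. \<Sum>i\<in>I. a i * g i y) x = (\<Sum>i\<in>I. a i * E B (g i) x)"
    using insert by auto
  with E_linear[OF B gi s, of "a i" 1] show ?case
    by eventually_elim (use insert in simp)
qed

text \<open>Apply countable additivity to \<open>A\<close>, \<open>B\<close>, \<open>{}\<close>,
  \<open>{}\<close> and so on. From two terms on the defect is a constant sequence, and a constant
  that tends to 0 is 0.\<close>

lemma E_Un:
  assumes [measurable]: "A \<in> sets borel" "B \<in> sets borel" and disj: "A \<inter> B = {}" and g: "g \<in> L2 M"
  shows "AE x in M. E (A \<union> B) g x = E A g x + E B g x"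
proof -
  define F :: "nat \<Rightarrow> real set" where "F = binaryset A B"
  define u where "u x = E (A \<union> B) g x - (E A g x + E B g x)" for x
  have F: "range F \<subseteq> sets borel" "disjoint_family F" "(\<Union>i. F i) = A \<union> B"
    using disj by (auto simp: F_def range_binaryset_eq UN_binaryset_eq disjoint_family_on_def binaryset_def)
  have uL2: "u \<in> L2 M" unfolding u_def[abs_def] by (intro L2_diff L2_add E_L2 g) auto
  have "L2_norm M (\<lambda>x. E (\<Union>i. F i) g x - (\<Sum>i<n. E (F i) g x)) = L2_norm M u" if "n \<ge> 2" for n
  proof (rule L2_norm_cong_AE)
    show "(\<lambda>x. E (\<Union> (range F)) g x - (\<Sum>i<n. E (F i) g x)) \<in> L2 M"
      by (intro L2_diff L2_sum E_L2 g) (use F in auto)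
    show "AE x in M. E (\<Union> (range F)) g x - (\<Sum>i<n. E (F i) g x) = u x"
      using E_empty[OF g]
    proof eventually_elim
      case (elim x)
      have "n = Suc (Suc (n - 2))" using that by simp
      then obtain m where "n = Suc (Suc m)" by blast
      moreover have "F 0 = A" "F (Suc 0) = B" "F (Suc (Suc i)) = {}" for i
        by (auto simp: F_def binaryset_def)
      ultimately have "(\<Sum>i<n. E (F i) g x) = E A g x + E B g x"
        using elim by (simp add: sum.lessThan_Suc_shift del: sum.lessThan_Suc)
      then show ?case by (simp add: F(3) u_def)
    qed
  qed fact
  then have "(\<lambda>n. L2_norm M (\<lambda>x. E (\<Union>i. F i) g x - (\<Sum>i<n. E (F i) g x))) \<longlonglongrightarrow> L2_norm M u"
    by (intro tendsto_eventually eventually_sequentiallyI[of 2]) auto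
  then have "L2_norm M u = 0"
    using E_countably_additive[OF F(1,2) g] LIMSEQ_unique by blast
  then have "AE x in M. u x = 0" using L2_norm_eq_0_iff[OF uL2] by simp
  then show ?thesis by (simp add: u_def)
qed

lemma E_finite_UN:
  assumes g: "g \<in> L2 M" and "finite I" "\<And>i. i \<in> I \<Longrightarrow> B i \<in> sets borel" "disjoint_family_on B I"
  shows "AE x in M. E (\<Union>i\<in>I. B i) g x = (\<Sum>i\<in>I. E (B i) g x)"
  using assms(2-)
proof (induction I)
  case empty
  show ?case using E_empty[OF g] by simp
next
  case (insert i I)
  have "AE x in M. E (\<Union>i\<in>I. B i) g x = (\<Sum>i\<in>I. E (B i) g x)"
    using insert by (auto simp: disjoint_family_on_def)
  moreover have "AE x in M. E (B i \<union> (\<Union>i\<in>I. B i)) g x = E (B i) g x + E (\<Union>i\<in>I. B i) g x"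
  proof (rule E_Un[OF _ _ _ g])
    show "B i \<inter> (\<Union>i\<in>I. B i) = {}"
      using insert.hyps insert.prems by (fastforce simp: disjoint_family_on_def)
  qed (use insert in auto)
  ultimately show ?case by eventually_elim (use insert in simp)
qed

lemma simple_spectral_L2:
  assumes "simple_function borel s" "g \<in> L2 M"
  shows "Sp s g \<in> L2 M"
  unfolding simple_spectral_def
  using simple_function_borelD[OF assms(1)] assms(2) by (auto intro!: L2_sum L2_scale E_L2)

text \<open>Common refinement: the integral of \<open>c \<circ> p\<close> can be summed over the
  labels of \<open>p\<close>, even if \<open>c\<close> identifies labels or \<open>K\<close>
  contains labels that never occur. Taking pairs of values as labels puts two simple functions over
  one partition.\<close>

lemma simple_spectral_eq:
  assumes g: "g \<in> L2 M" and K: "finite K" "range p \<subseteq> K"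
    and p: "\<And>\<kappa>. p -` {\<kappa>} \<in> sets borel" and s: "\<And>x. s x = c (p x)"
  shows "AE x in M. Sp s g x = (\<Sum>\<kappa>\<in>K. c \<kappa> * E (p -` {\<kappa>}) g x)"
proof -
  have fin: "finite (range p)" using K finite_subset by blast
  have rs: "range s = c ` range p" using s by auto
  have "AE x in M. \<forall>b\<in>range s. E (s -` {b}) g x = (\<Sum>\<kappa>\<in>{\<kappa>\<in>range p. c \<kappa> = b}. E (p -` {\<kappa>}) g x)"
  proof (rule AE_finite_allI)
    show "finite (range s)" using rs fin by simp
    fix b
    have "s -` {b} = (\<Union>\<kappa>\<in>{\<kappa>\<in>range p. c \<kappa> = b}. p -` {\<kappa>})" using s by auto
    then show "AE x in M. E (s -` {b}) g x = (\<Sum>\<kappa>\<in>{\<kappa>\<in>range p. c \<kappa> = b}. E (p -` {\<kappa>}) g x)"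
      using E_finite_UN[OF g, of "{\<kappa>\<in>range p. c \<kappa> = b}" "\<lambda>\<kappa>. p -` {\<kappa>}"] fin p
      by (auto simp: disjoint_family_on_def)
  qed
  then show ?thesis using E_empty[OF g]
  proof eventually_elim
    case (elim x)
    \<comment> \<open>A label that \<open>p\<close> never attains has an empty fibre and contributes
      a multiple of \<open>E {}\<close>, which vanishes almost everywhere.\<close>
    have "(\<Sum>\<kappa>\<in>K. c \<kappa> * E (p -` {\<kappa>}) g x) = (\<Sum>\<kappa>\<in>range p. c \<kappa> * E (p -` {\<kappa>}) g x)"
    proof (rule sum.mono_neutral_right[OF K], rule ballI)
      fix \<kappa> assume "\<kappa> \<in> K - range p"
      then have "p -` {\<kappa>} = {}" by auto
      then show "c \<kappa> * E (p -` {\<kappa>}) g x = 0" using elim(2) by simp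
    qed
    also have "\<dots> = (\<Sum>b\<in>c ` range p. \<Sum>\<kappa>\<in>{\<kappa>\<in>range p. c \<kappa> = b}. c \<kappa> * E (p -` {\<kappa>}) g x)"
      by (rule sum.image_gen[OF fin])
    also have "\<dots> = (\<Sum>b\<in>range s. b * E (s -` {b}) g x)"
      unfolding rs[symmetric] using elim(1) by (auto intro!: sum.cong simp: sum_distrib_left)
    finally show ?case by (simp add: simple_spectral_def)
  qed
qed

lemma simple_spectral_const:
  assumes g: "g \<in> L2 M" shows "AE x in M. Sp (\<lambda>_. c) g x = c * g x"
  using E_UNIV[OF g]
  by eventually_elim (simp add: simple_spectral_def vimage_def)

lemma simple_spectral_linear:
  assumes g: "g \<in> L2 M" and s: "simple_function borel s" and t: "simple_function borel t"
  shows "AE x in M. Sp (\<lambda>\<omega>. a * s \<omega> + b * t \<omega>) g x =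
    a * Sp s g x + b * Sp t g x"
proof -
  let ?p = "\<lambda>x. (s x, t x)" and ?K = "range s \<times> range t"
  have K: "finite ?K" "range ?p \<subseteq> ?K" using simple_function_borelD s t by auto
  have p: "?p -` {\<kappa>} \<in> sets borel" for \<kappa>
  proof -
    have "?p -` {\<kappa>} = s -` {fst \<kappa>} \<inter> t -` {snd \<kappa>}" by auto
    then show ?thesis using simple_function_borelD(2)[OF s] simple_function_borelD(2)[OF t] by auto
  qed
  have "AE x in M. Sp s g x = (\<Sum>\<kappa>\<in>?K. fst \<kappa> * E (?p -` {\<kappa>}) g x)"
    "AE x in M. Sp t g x = (\<Sum>\<kappa>\<in>?K. snd \<kappa> * E (?p -` {\<kappa>}) g x)"
    "AE x in M. Sp (\<lambda>\<omega>. a * s \<omega> + b * t \<omega>) g x =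
       (\<Sum>\<kappa>\<in>?K. (a * fst \<kappa> + b * snd \<kappa>) * E (?p -` {\<kappa>}) g x)"
    by (rule simple_spectral_eq[OF g K p]; simp)+
  then show ?thesis
    by eventually_elim (simp add: sum_distrib_left sum.distrib distrib_right mult.assoc)
qed

text \<open>With pairs of values as labels, the rule that \<open>E B\<close> after
  \<open>E C\<close> is \<open>E (B \<inter> C)\<close> identifies the iterated sum with the sum
  over the refined partition.\<close>

lemma simple_spectral_mult:
  assumes g: "g \<in> L2 M" and s: "simple_function borel s" and t: "simple_function borel t"
  shows "AE x in M. Sp t (Sp s g) x =
    Sp (\<lambda>\<omega>. t \<omega> * s \<omega>) g x"
proof -
  let ?p = "\<lambda>x. (t x, s x)" and ?K = "range t \<times> range s"
  note sD = simple_function_borelD[OF s] and tD = simple_function_borelD[OF t]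
  have K: "finite ?K" "range ?p \<subseteq> ?K" using sD tD by auto
  have pe: "?p -` {\<kappa>} = t -` {fst \<kappa>} \<inter> s -` {snd \<kappa>}" for \<kappa> by auto
  have p: "?p -` {\<kappa>} \<in> sets borel" for \<kappa> unfolding pe using sD tD by auto
  have "AE x in M. Sp (\<lambda>\<omega>. t \<omega> * s \<omega>) g x =
       (\<Sum>\<kappa>\<in>?K. (fst \<kappa> * snd \<kappa>) * E (?p -` {\<kappa>}) g x)"
    by (rule simple_spectral_eq[OF g K p]) simp
  moreover have "AE x in M. \<forall>b\<in>range t. E (t -` {b}) (Sp s g) x =
      (\<Sum>a\<in>range s. a * E (t -` {b}) (E (s -` {a}) g) x)"
    unfolding simple_spectral_def
    by (rule AE_finite_allI[OF tD(1)], rule E_sum[OF tD(2) sD(1)]) (intro E_L2 sD(2) g)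
  moreover have "AE x in M. \<forall>\<kappa>\<in>?K. E (t -` {fst \<kappa>}) (E (s -` {snd \<kappa>}) g) x = E (?p -` {\<kappa>}) g x"
    unfolding pe by (rule AE_finite_allI[OF K(1)], rule E_Int) (use sD tD g in auto)
  ultimately show ?thesis
  proof eventually_elim
    case (elim x)
    have "Sp t (Sp s g) x =
        (\<Sum>b\<in>range t. \<Sum>a\<in>range s. b * (a * E (t -` {b}) (E (s -` {a}) g) x))"
      unfolding simple_spectral_def[of E t] using elim(2)
      by (auto simp: sum_distrib_left intro!: sum.cong)
    also have "\<dots> = (\<Sum>\<kappa>\<in>?K. fst \<kappa> * (snd \<kappa> * E (t -` {fst \<kappa>}) (E (s -` {snd \<kappa>}) g) x))"
      by (simp add: sum.cartesian_product case_prod_unfold)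
    also have "\<dots> = (\<Sum>\<kappa>\<in>?K. (fst \<kappa> * snd \<kappa>) * E (?p -` {\<kappa>}) g x)"
      using elim(3) by (intro sum.cong) (auto simp: mult.assoc)
    finally show ?case using elim(1) by simp
  qed
qed

text \<open>Pythagoras: for disjoint \<open>B\<close> and \<open>B'\<close>, self-adjointness moves
  \<open>E B\<close> to the other side of the inner product, where it meets \<open>E B'\<close> and
  leaves \<open>E {}\<close>.\<close>

lemma L2_norm_orthogonal_sum:
  assumes g: "g \<in> L2 M" and "finite K" and B: "\<And>\<kappa>. \<kappa> \<in> K \<Longrightarrow> B \<kappa> \<in> sets borel"
    and disj: "disjoint_family_on B K"
  shows "(L2_norm M (\<lambda>x. \<Sum>\<kappa>\<in>K. c \<kappa> * E (B \<kappa>) g x))\<^sup>2 = (\<Sum>\<kappa>\<in>K. (cmod (c \<kappa>) * L2_norm M (E (B \<kappa>) g))\<^sup>2)"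
proof -
  have L: "(\<lambda>x. c \<kappa> * E (B \<kappa>) g x) \<in> L2 M" if "\<kappa> \<in> K" for \<kappa> using B that g by (intro L2_scale E_L2)
  have orth: "L2_inner M (E (B \<kappa>) g) (E (B \<kappa>') g) = (if \<kappa> = \<kappa>' then of_real ((L2_norm M (E (B \<kappa>) g))\<^sup>2) else 0)"
    if "\<kappa> \<in> K" "\<kappa>' \<in> K" for \<kappa> \<kappa>'
  proof (cases "\<kappa> = \<kappa>'")
    case True then show ?thesis by (simp only: L2_inner_self if_True simp_thms)
  next
    case False
    then have "B \<kappa> \<inter> B \<kappa>' = {}" using disj that by (auto simp: disjoint_family_on_def)
    then have "AE x in M. E (B \<kappa>) (E (B \<kappa>') g) x = 0"
      using E_Int[of "B \<kappa>" "B \<kappa>'" g] E_empty[OF g] B that g by auto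
    then have "L2_inner M g (E (B \<kappa>) (E (B \<kappa>') g)) = L2_inner M g (\<lambda>x. 0)"
      using B that g by (intro L2_inner_cong_AE) (auto intro!: E_L2)
    then show ?thesis using False E_adjoint B that g E_L2 by (simp add: L2_inner_def)
  qed
  have "of_real ((L2_norm M (\<lambda>x. \<Sum>\<kappa>\<in>K. c \<kappa> * E (B \<kappa>) g x))\<^sup>2) =
      L2_inner M (\<lambda>x. \<Sum>\<kappa>\<in>K. c \<kappa> * E (B \<kappa>) g x) (\<lambda>x. \<Sum>\<kappa>\<in>K. c \<kappa> * E (B \<kappa>) g x)"
    by (simp only: L2_inner_self)
  also have "\<dots> = (\<Sum>\<kappa>\<in>K. \<Sum>\<kappa>'\<in>K. cnj (c \<kappa>) * c \<kappa>' * L2_inner M (E (B \<kappa>) g) (E (B \<kappa>') g))"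
    by (subst L2_inner_sum_left, use L in \<open>auto intro!: L2_sum sum.cong\<close>,
        subst L2_inner_sum_right)
       (auto intro!: sum.cong L simp: L2_inner_scale_left L2_inner_scale_right)
  also have "\<dots> = (\<Sum>\<kappa>\<in>K. \<Sum>\<kappa>'\<in>K. if \<kappa> = \<kappa>' then of_real ((cmod (c \<kappa>) * L2_norm M (E (B \<kappa>) g))\<^sup>2) else 0)"
    by (intro sum.cong refl)
       (auto simp: orth power_mult_distrib complex_norm_square mult.commute simp del: of_real_power)
  also have "\<dots> = of_real (\<Sum>\<kappa>\<in>K. (cmod (c \<kappa>) * L2_norm M (E (B \<kappa>) g))\<^sup>2)"
    using \<open>finite K\<close> by simp
  finally show ?thesis by (simp only: of_real_eq_iff)
qed

text \<open>Pythagoras is used twice over the level sets of \<open>s\<close>: with the values of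
  \<open>s\<close> as coefficients, and with all coefficients 1, where the sum restores
  \<open>g\<close> because the level sets cover the line.\<close>

lemma simple_spectral_norm_le:
  assumes g: "g \<in> L2 M" and s: "simple_function borel s" and C: "\<And>\<omega>. cmod (s \<omega>) \<le> C"
  shows "L2_norm M (Sp s g) \<le> C * L2_norm M g"
proof -
  note sD = simple_function_borelD[OF s]
  have "C \<ge> 0" using order_trans[OF norm_ge_zero C] .
  have disj: "disjoint_family_on (\<lambda>c. s -` {c}) (range s)" by (auto simp: disjoint_family_on_def)
  have UN: "(\<Union>c\<in>range s. s -` {c}) = UNIV" by auto
  have "(L2_norm M (\<lambda>x. \<Sum>c\<in>range s. 1 * E (s -` {c}) g x))\<^sup>2 = (\<Sum>c\<in>range s. (L2_norm M (E (s -` {c}) g))\<^sup>2)"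
    using L2_norm_orthogonal_sum[OF g sD(1) sD(2) disj, of "\<lambda>_. 1"] by simp
  moreover have "L2_norm M (\<lambda>x. \<Sum>c\<in>range s. 1 * E (s -` {c}) g x) = L2_norm M g"
  proof (rule L2_norm_cong_AE)
    show "AE x in M. (\<Sum>c\<in>range s. 1 * E (s -` {c}) g x) = g x"
      using E_UNIV[OF g] E_finite_UN[OF g sD(1) sD(2) disj, unfolded UN]
      by eventually_elim simp
  qed (auto intro!: L2_sum L2_scale E_L2 sD g simp del: mult_1)
  ultimately have g2: "(L2_norm M g)\<^sup>2 = (\<Sum>c\<in>range s. (L2_norm M (E (s -` {c}) g))\<^sup>2)" by simp
  have "(L2_norm M (Sp s g))\<^sup>2 = (\<Sum>c\<in>range s. (cmod c * L2_norm M (E (s -` {c}) g))\<^sup>2)"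
    unfolding simple_spectral_def by (rule L2_norm_orthogonal_sum[OF g sD(1) sD(2) disj])
  also have "\<dots> \<le> (\<Sum>c\<in>range s. (C * L2_norm M (E (s -` {c}) g))\<^sup>2)"
    using C by (intro sum_mono power_mono mult_right_mono) auto
  also have "\<dots> = (C * L2_norm M g)\<^sup>2"
    by (simp add: power_mult_distrib g2 sum_distrib_left)
  finally show ?thesis using \<open>C \<ge> 0\<close> by (simp add: power2_le_iff_abs_le)
qed

section \<open>Integrals of bounded functions as limits\<close>

lemma HS_L2: "HS f g h \<Longrightarrow> h \<in> L2 M"
  by (simp add: has_spectral_integral_def)

lemma HSI:
  assumes "h \<in> L2 M" "\<And>n. simple_function borel (s n)" "uniform_limit UNIV s f sequentially"
    "(\<lambda>n. L2_dist M (Sp (s n) g) h) \<longlonglongrightarrow> 0"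
  shows "HS f g h"
  unfolding has_spectral_integral_def using assms unfolding simple_spectral_def by blast

lemma HSE:
  assumes "HS f g h"
  obtains s where "\<And>n. simple_function borel (s n)" "uniform_limit UNIV s f sequentially"
    "(\<lambda>n. L2_dist M (Sp (s n) g) h) \<longlonglongrightarrow> 0"
  using assms unfolding has_spectral_integral_def simple_spectral_def by blast

lemma simple_spectral_diff_norm_le:
  assumes g: "g \<in> L2 M" and s: "simple_function borel s" and t: "simple_function borel t"
    and C: "\<And>\<omega>. cmod (s \<omega> - t \<omega>) \<le> C"
  shows "L2_dist M (Sp s g) (Sp t g) \<le> C * L2_norm M g"
proof -
  have d: "simple_function borel (\<lambda>\<omega>. 1 * s \<omega> + (-1) * t \<omega>)"
    using s t by (intro simple_function_add simple_function_mult) auto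
  have "L2_dist M (Sp s g) (Sp t g) =
     L2_norm M (Sp (\<lambda>\<omega>. 1 * s \<omega> + (-1) * t \<omega>) g)"
    using simple_spectral_linear[OF g s t, of 1 "-1"]
    by (intro L2_norm_cong_AE L2_diff simple_spectral_L2 s t g d) auto
  also have "\<dots> \<le> C * L2_norm M g"
    by (rule simple_spectral_norm_le[OF g d]) (use C in simp)
  finally show ?thesis .
qed

lemma uniform_limit_dist_le:
  assumes "uniform_limit UNIV s f sequentially" "uniform_limit UNIV t f sequentially" "e > 0"
  shows "\<forall>\<^sub>F n in sequentially. \<forall>\<omega>. cmod (s n \<omega> - t n \<omega>) \<le> (e::real)"
  using uniform_limitD[OF assms(1) half_gt_zero[OF assms(3)]]
    uniform_limitD[OF assms(2) half_gt_zero[OF assms(3)]]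
proof eventually_elim
  case (elim n)
  show ?case
  proof
    fix \<omega>
    have "dist (s n \<omega>) (t n \<omega>) \<le> dist (s n \<omega>) (f \<omega>) + dist (t n \<omega>) (f \<omega>)"
      by (rule dist_triangle2)
    moreover have "dist (s n \<omega>) (f \<omega>) < e / 2" "dist (t n \<omega>) (f \<omega>) < e / 2" using elim by auto
    ultimately show "cmod (s n \<omega> - t n \<omega>) \<le> e" unfolding dist_norm[symmetric] by linarith
  qed
qed

text \<open>\<open>has_spectral_integral\<close> only asserts that some approximating sequence
  exists. Two sequences with the same uniform limit become uniformly close, so their integrals share
  the limit and the sequence may be prescribed.\<close>

lemma HS_tendsto:
  assumes hs: "HS f g h" and g: "g \<in> L2 M"
    and s: "\<And>n. simple_function borel (s n)" "uniform_limit UNIV s f sequentially"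
  shows "(\<lambda>n. L2_dist M (Sp (s n) g) h) \<longlonglongrightarrow> 0"
proof -
  obtain t where t: "\<And>n. simple_function borel (t n)" "uniform_limit UNIV t f sequentially"
    "(\<lambda>n. L2_dist M (Sp (t n) g) h) \<longlonglongrightarrow> 0"
    using HSE[OF hs] by blast
  have "(\<lambda>n. L2_dist M (Sp (s n) g) (Sp (t n) g)) \<longlonglongrightarrow> 0"
  proof (rule LIMSEQ_I)
    fix e :: real assume e: "e > 0"
    obtain d where d: "d > 0" and de: "d * L2_norm M g < e"
      using small_factor[OF e L2_norm_nonneg[of M g]] by blast
    have "\<forall>\<^sub>F n in sequentially. L2_dist M (Sp (s n) g) (Sp (t n) g) < e"
      using uniform_limit_dist_le[OF s(2) t(2) d]
    proof eventually_elim
      case (elim n)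
      then have "L2_dist M (Sp (s n) g) (Sp (t n) g) \<le> d * L2_norm M g"
        by (intro simple_spectral_diff_norm_le g s t) auto
      then show ?case using de by simp
    qed
    then show "\<exists>n0. \<forall>n\<ge>n0. norm (L2_dist M (Sp (s n) g) (Sp (t n) g) - 0) < e"
      by (simp add: eventually_sequentially)
  qed
  from tendsto_add[OF this t(3)] have "(\<lambda>n. L2_dist M (Sp (s n) g) (Sp (t n) g)
     + L2_dist M (Sp (t n) g) h) \<longlonglongrightarrow> 0" by simp
  then show ?thesis
    by (rule Lim_null_comparison[rotated])
       (auto intro!: always_eventually L2_norm_triangle_diff simple_spectral_L2 s t g HS_L2[OF hs])
qed

lemma HS_norm_le:
  assumes hs: "HS f g h" and g: "g \<in> L2 M" and C: "\<And>\<omega>. cmod (f \<omega>) \<le> C"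
  shows "L2_norm M h \<le> C * L2_norm M g"
proof -
  obtain s where s: "\<And>n. simple_function borel (s n)" "uniform_limit UNIV s f sequentially"
    "(\<lambda>n. L2_dist M (Sp (s n) g) h) \<longlonglongrightarrow> 0"
    using HSE[OF hs] by blast
  \<comment> \<open>The approximants obey the bound of \<open>f\<close> only up to their uniform
    distance from \<open>f\<close>; \<open>e\<close> absorbs it and is sent to 0 afterwards.\<close>
  have "L2_norm M h \<le> (C + e) * L2_norm M g" if e: "e > 0" for e
  proof (rule tendsto_le[OF _ _ tendsto_const])
    show "(\<lambda>n. (C + e) * L2_norm M g + L2_dist M (Sp (s n) g) h)
        \<longlonglongrightarrow> (C + e) * L2_norm M g"
      using tendsto_add[OF tendsto_const s(3)] by simp
    show "\<forall>\<^sub>F n in sequentially. L2_norm M h \<le>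
        (C + e) * L2_norm M g + L2_dist M (Sp (s n) g) h"
      using uniform_limitD[OF s(2) e]
    proof eventually_elim
      case (elim n)
      have "cmod (s n \<omega>) \<le> C + e" for \<omega>
      proof -
        have "cmod (s n \<omega>) \<le> cmod (f \<omega>) + cmod (s n \<omega> - f \<omega>)"
          by (metis add.commute diff_add_cancel norm_triangle_ineq)
        also have "\<dots> \<le> C + e" using C elim by (intro add_mono) (auto simp: dist_norm less_imp_le)
        finally show ?thesis .
      qed
      then have "L2_norm M (Sp (s n) g) \<le> (C + e) * L2_norm M g"
        by (rule simple_spectral_norm_le[OF g s(1)])
      moreover have "\<bar>L2_norm M (Sp (s n) g) - L2_norm M h\<bar> \<le>
          L2_dist M (Sp (s n) g) h"
        by (intro L2_norm_triangle_rev simple_spectral_L2 s g HS_L2[OF hs])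
      ultimately show ?case by linarith
    qed
  qed auto
  moreover have "((\<lambda>e. (C + e) * L2_norm M g) \<longlongrightarrow> (C + 0) * L2_norm M g) (at_right 0)"
    by (intro tendsto_intros)
  ultimately show ?thesis
    by (intro tendsto_lowerbound[of "\<lambda>e. (C + e) * L2_norm M g" _ "at_right 0"])
       (auto simp: eventually_at_filter)
qed

lemma HS_linear:
  assumes f: "HS f g h" and f': "HS f' g h'" and g: "g \<in> L2 M"
  shows "HS (\<lambda>\<omega>. a * f \<omega> + b * f' \<omega>) g (\<lambda>x. a * h x + b * h' x)"
proof -
  obtain s where s: "\<And>n. simple_function borel (s n)" "uniform_limit UNIV s f sequentially"
    "(\<lambda>n. L2_dist M (Sp (s n) g) h) \<longlonglongrightarrow> 0"
    using HSE[OF f] by blast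
  obtain t where t: "\<And>n. simple_function borel (t n)" "uniform_limit UNIV t f' sequentially"
    "(\<lambda>n. L2_dist M (Sp (t n) g) h') \<longlonglongrightarrow> 0"
    using HSE[OF f'] by blast
  note L = HS_L2[OF f] HS_L2[OF f']
  show ?thesis
  proof (rule HSI)
    show "(\<lambda>x. a * h x + b * h' x) \<in> L2 M" by (intro L2_add L2_scale L)
    show sf: "simple_function borel (\<lambda>\<omega>. a * s n \<omega> + b * t n \<omega>)" for n
      using s t by (intro simple_function_add simple_function_mult) auto
    show "uniform_limit UNIV (\<lambda>n \<omega>. a * s n \<omega> + b * t n \<omega>) (\<lambda>\<omega>. a * f \<omega> + b * f' \<omega>) sequentially"
      by (intro uniform_limit_add bounded_linear.uniform_limit[OF bounded_linear_mult_right] s t)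
    show "(\<lambda>n. L2_norm M (\<lambda>x. Sp (\<lambda>\<omega>. a * s n \<omega> + b * t n \<omega>) g x - (a * h x + b * h' x))) \<longlonglongrightarrow> 0"
    proof (rule Lim_null_comparison)
      show "(\<lambda>n. cmod a * L2_dist M (Sp (s n) g) h +
           cmod b * L2_dist M (Sp (t n) g) h') \<longlonglongrightarrow> 0"
        using tendsto_add[OF tendsto_mult_left[OF s(3), of "cmod a"] tendsto_mult_left[OF t(3), of "cmod b"]] by simp
      show "\<forall>\<^sub>F n in sequentially. norm (L2_norm M (\<lambda>x. Sp (\<lambda>\<omega>. a * s n \<omega> + b * t n \<omega>) g x - (a * h x + b * h' x)))
        \<le> cmod a * L2_dist M (Sp (s n) g) h +
           cmod b * L2_dist M (Sp (t n) g) h'"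
      proof (rule always_eventually, rule allI)
        fix n
        have "L2_norm M (\<lambda>x. Sp (\<lambda>\<omega>. a * s n \<omega> + b * t n \<omega>) g x - (a * h x + b * h' x)) =
          L2_norm M (\<lambda>x. a * (Sp (s n) g x - h x) + b * (Sp (t n) g x - h' x))"
        proof (rule L2_norm_cong_AE)
          show "AE x in M. Sp (\<lambda>\<omega>. a * s n \<omega> + b * t n \<omega>) g x - (a * h x + b * h' x) =
             a * (Sp (s n) g x - h x) + b * (Sp (t n) g x - h' x)"
            using simple_spectral_linear[OF g s(1) t(1), of a n b n]
            by eventually_elim (simp add: algebra_simps)
        qed (intro L2_add L2_diff L2_scale simple_spectral_L2 sf s t g L)+
        also have "\<dots> \<le> L2_norm M (\<lambda>x. a * (Sp (s n) g x - h x)) +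
            L2_norm M (\<lambda>x. b * (Sp (t n) g x - h' x))"
          by (intro L2_norm_triangle L2_diff L2_scale simple_spectral_L2 s t g L)
        finally show "norm (L2_norm M (\<lambda>x. Sp (\<lambda>\<omega>. a * s n \<omega> + b * t n \<omega>) g x - (a * h x + b * h' x)))
        \<le> cmod a * L2_dist M (Sp (s n) g) h +
           cmod b * L2_dist M (Sp (t n) g) h'"
          by (simp add: L2_norm_scale)
      qed
    qed
  qed
qed

lemma HS_diff_norm_le:
  assumes "HS f g h" "HS f' g h'" "g \<in> L2 M" "\<And>\<omega>. cmod (f \<omega> - f' \<omega>) \<le> C"
  shows "L2_dist M h h' \<le> C * L2_norm M g"
  using HS_norm_le[OF HS_linear[OF assms(1-3), of 1 "-1"] assms(3), of C] assms(4) by simp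

text \<open>The difference of the two values integrates the zero function, so the norm bound holds
  with constant 0. This makes the choice in \<open>spectral_integral\<close> harmless.\<close>

lemma HS_unique:
  assumes "HS f g h" "HS f g h'" "g \<in> L2 M"
  shows "L2_dist M h h' = 0" "AE x in M. h x = h' x"
proof -
  show *: "L2_dist M h h' = 0"
    using HS_diff_norm_le[OF assms, of 0] L2_norm_nonneg[of M "\<lambda>x. h x - h' x"] by simp
  have "(\<lambda>x. h x - h' x) \<in> L2 M" using assms by (intro L2_diff HS_L2)
  with * show "AE x in M. h x = h' x" using L2_norm_eq_0_iff by fastforce
qed

lemma HS_const: assumes g: "g \<in> L2 M" shows "HS (\<lambda>_. c) g (\<lambda>x. c * g x)"
proof (rule HSI[where s="\<lambda>_ _. c"])
  have "L2_norm M (\<lambda>x. Sp (\<lambda>_. c) g x - c * g x) = 0"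
    using simple_spectral_const[OF g, of c]
    by (subst L2_norm_eq_0_iff) (auto intro!: L2_diff simple_spectral_L2 L2_scale g)
  then show "(\<lambda>n. L2_norm M (\<lambda>x. Sp (\<lambda>_. c) g x - c * g x)) \<longlonglongrightarrow> 0" by simp
qed (auto intro: L2_scale g uniform_limit_const)

lemma HS_indicator:
  assumes g: "g \<in> L2 M" and B [measurable]: "B \<in> sets borel"
  shows "HS (indicator B) g (E B g)"
proof (rule HSI[where s="\<lambda>_. indicator B"])
  let ?p = "\<lambda>x. x \<in> B" and ?c = "\<lambda>b. if b then 1 else 0 :: complex"
  have vim: "?p -` {True} = B" "?p -` {False} = - B" by auto
  have p: "?p -` {\<kappa>} \<in> sets borel" for \<kappa>
    by (cases \<kappa>) (use borel_comp[OF B] in \<open>simp_all only: vim B\<close>)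
  have "AE x in M. Sp (indicator B) g x = (\<Sum>\<kappa>\<in>UNIV. ?c \<kappa> * E (?p -` {\<kappa>}) g x)"
    by (rule simple_spectral_eq[OF g _ _ p]) (auto simp: indicator_def)
  then have "AE x in M. Sp (indicator B) g x - E B g x = 0"
    by eventually_elim (simp add: UNIV_bool vim)
  then have "L2_dist M (Sp (indicator B) g) (E B g) = 0"
    by (subst L2_norm_eq_0_iff) (auto intro!: L2_diff simple_spectral_L2 E_L2 g)
  then show "(\<lambda>n. L2_dist M (Sp (indicator B) g) (E B g)) \<longlonglongrightarrow> 0" by simp
qed (auto intro: E_L2 g uniform_limit_const)

lemma HS_sum:
  assumes g: "g \<in> L2 M" and "finite I" "\<And>i. i \<in> I \<Longrightarrow> HS (f i) g (h i)"
  shows "HS (\<lambda>\<omega>. \<Sum>i\<in>I. c i * f i \<omega>) g (\<lambda>x. \<Sum>i\<in>I. c i * h i x)"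
  using assms(2,3)
proof (induction I)
  case empty
  show ?case using HS_const[OF g, of 0] by simp
next
  case (insert i I)
  then show ?case using HS_linear[OF _ _ g, of "f i" "h i" "\<lambda>\<omega>. \<Sum>i\<in>I. c i * f i \<omega>" "\<lambda>x. \<Sum>i\<in>I. c i * h i x" "c i" 1]
    by simp
qed

text \<open>Split the error into \<open>t n\<close> applied to the error for \<open>f\<close>, plus
  the error for \<open>f'\<close> at the vector \<open>h\<close>. Boundedness of both integrands
  keeps the products \<open>t n \<omega> * s n \<omega>\<close> uniformly convergent.\<close>

lemma HS_mult:
  assumes f: "HS f g h" and f': "HS f' h k" and g: "g \<in> L2 M"
    and bd: "\<And>\<omega>. cmod (f \<omega>) \<le> C" "\<And>\<omega>. cmod (f' \<omega>) \<le> C'"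
  shows "HS (\<lambda>\<omega>. f' \<omega> * f \<omega>) g k"
proof -
  note L = HS_L2[OF f] HS_L2[OF f']
  obtain s where s: "\<And>n. simple_function borel (s n)" "uniform_limit UNIV s f sequentially"
    "(\<lambda>n. L2_dist M (Sp (s n) g) h) \<longlonglongrightarrow> 0"
    using HSE[OF f] by blast
  obtain t where t: "\<And>n. simple_function borel (t n)" "uniform_limit UNIV t f' sequentially"
    "(\<lambda>n. L2_dist M (Sp (t n) h) k) \<longlonglongrightarrow> 0"
    using HSE[OF f'] by blast
  have sf: "simple_function borel (\<lambda>\<omega>. t n \<omega> * s n \<omega>)" for n
    using s t by (intro simple_function_mult)
  show ?thesis
  proof (rule HSI[OF L(2) sf])
    show "uniform_limit UNIV (\<lambda>n \<omega>. t n \<omega> * s n \<omega>) (\<lambda>\<omega>. f' \<omega> * f \<omega>) sequentially"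
      by (intro bounded_bilinear.bounded_uniform_limit[OF bounded_bilinear_mult] s t)
         (use bd in \<open>auto simp: bounded_iff\<close>)
    let ?a = "\<lambda>n. L2_dist M (Sp (s n) g) h"
    let ?b = "\<lambda>n. L2_dist M (Sp (t n) h) k"
    show "(\<lambda>n. L2_dist M (Sp (\<lambda>\<omega>. t n \<omega> * s n \<omega>) g) k) \<longlonglongrightarrow> 0"
    proof (rule Lim_null_comparison)
      show "(\<lambda>n. (C' + 1) * ?a n + ?b n) \<longlonglongrightarrow> 0"
        using tendsto_add[OF tendsto_mult_left[OF s(3)] t(3)] by simp
      show "\<forall>\<^sub>F n in sequentially. norm (L2_dist M (Sp (\<lambda>\<omega>. t n \<omega> * s n \<omega>) g) k)
          \<le> (C' + 1) * ?a n + ?b n"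
        using uniform_limitD[OF t(2) zero_less_one]
      proof eventually_elim
        case (elim n)
        define u where "u = Sp (s n) g"
        have u: "u \<in> L2 M" unfolding u_def by (rule simple_spectral_L2[OF s(1) g])
        have C: "cmod (t n \<omega>) \<le> C' + 1" for \<omega>
        proof -
          have "cmod (t n \<omega>) \<le> cmod (f' \<omega>) + cmod (t n \<omega> - f' \<omega>)"
            by (metis add.commute diff_add_cancel norm_triangle_ineq)
          also have "\<dots> \<le> C' + 1" using bd elim by (intro add_mono) (auto simp: dist_norm less_imp_le)
          finally show ?thesis .
        qed
        \<comment> \<open>\<open>E B\<close> is linear only almost everywhere, but
          \<open>t n\<close> has finitely many values, so one null set serves all its level
          sets.\<close>
        have lin: "AE x in M. Sp (t n) (\<lambda>x. u x - h x) x =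
            Sp (t n) u x - Sp (t n) h x"
        proof -
          have "AE x in M. \<forall>b\<in>range (t n). E (t n -` {b}) (\<lambda>y. 1 * u y + (-1) * h y) x =
             1 * E (t n -` {b}) u x + (-1) * E (t n -` {b}) h x"
            by (rule AE_finite_allI[OF simple_function_borelD(1)[OF t(1)]],
                rule E_linear[OF simple_function_borelD(2)[OF t(1)] u L(1)])
          then show ?thesis
          proof eventually_elim
            case (elim x)
            have "Sp (t n) (\<lambda>x. u x - h x) x =
                (\<Sum>b\<in>range (t n). b * (1 * E (t n -` {b}) u x + (-1) * E (t n -` {b}) h x))"
              unfolding simple_spectral_def using elim by (auto intro!: sum.cong)
            then show ?case by (simp add: simple_spectral_def sum_subtractf right_diff_distrib)
          qed
        qed
        have "L2_dist M (Sp (\<lambda>\<omega>. t n \<omega> * s n \<omega>) g) k =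
          L2_norm M (\<lambda>x. Sp (t n) (\<lambda>x. u x - h x) x + (Sp (t n) h x - k x))"
        proof (rule L2_norm_cong_AE)
          show "AE x in M. Sp (\<lambda>\<omega>. t n \<omega> * s n \<omega>) g x - k x =
             Sp (t n) (\<lambda>x. u x - h x) x + (Sp (t n) h x - k x)"
            using lin simple_spectral_mult[OF g s(1) t(1), of n n]
            by eventually_elim (simp add: u_def)
        qed (intro L2_diff L2_add simple_spectral_L2 sf t g L u)+
        also have "\<dots> \<le> L2_norm M (Sp (t n) (\<lambda>x. u x - h x)) +
            L2_dist M (Sp (t n) h) k"
          by (intro L2_norm_triangle L2_diff simple_spectral_L2 t L u)
        also have "L2_norm M (Sp (t n) (\<lambda>x. u x - h x)) \<le> (C' + 1) * L2_dist M u h"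
          by (rule simple_spectral_norm_le[OF L2_diff[OF u L(1)] t(1) C])
        finally show ?case by (simp add: u_def)
      qed
    qed
  qed
qed

text \<open>Uniformly Cauchy simple functions have Cauchy integrals by the norm bound, and
  completeness supplies the limit.\<close>

lemma HS_exists:
  assumes g: "g \<in> L2 M" and f: "f \<in> borel_measurable borel" "\<And>\<omega>. cmod (f \<omega>) \<le> C"
  obtains h where "HS f g h"
proof -
  obtain s where s: "\<And>n. simple_function borel (s n)" "uniform_limit UNIV s f sequentially"
    using simple_function_uniform_approx[OF f] by blast
  obtain h where "h \<in> L2 M" "(\<lambda>k. L2_dist M (Sp (s k) g) h) \<longlonglongrightarrow> 0"
  proof (rule L2_complete[OF finite_measure_axioms, of "\<lambda>k. Sp (s k) g"])
    show "Sp (s k) g \<in> L2 M" for k by (rule simple_spectral_L2[OF s(1) g])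
    fix e :: real assume e: "e > 0"
    obtain d where d: "d > 0" and de: "d * L2_norm M g < e"
      using small_factor[OF e L2_norm_nonneg[of M g]] by blast
    obtain K where K: "\<And>n \<omega>. n \<ge> K \<Longrightarrow> dist (s n \<omega>) (f \<omega>) < d / 2"
      using uniform_limitD[OF s(2), of "d/2"] d by (auto simp: eventually_sequentially)
    have "L2_dist M (Sp (s j) g) (Sp (s k) g) < e"
      if "j \<ge> K" "k \<ge> K" for j k
    proof -
      have "cmod (s j \<omega> - s k \<omega>) \<le> d" for \<omega>
        using K[OF that(1), of \<omega>] K[OF that(2), of \<omega>] dist_triangle2[of "s j \<omega>" "s k \<omega>" "f \<omega>"]
        unfolding dist_norm[symmetric] by linarith
      then have "L2_dist M (Sp (s j) g) (Sp (s k) g) \<le> d * L2_norm M g"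
        by (intro simple_spectral_diff_norm_le g s)
      then show ?thesis using de by simp
    qed
    then show "\<exists>K. \<forall>j\<ge>K. \<forall>k\<ge>K. L2_dist M (Sp (s j) g) (Sp (s k) g) < e"
      by blast
  qed
  then show thesis using HSI s that by blast
qed

text \<open>For simple functions each \<open>E B\<close> is self-adjoint, so only the coefficients
  are conjugated; Cauchy-Schwarz carries the identity to the limit on both sides.\<close>

lemma HS_adjoint:
  assumes f: "HS f g h" and f': "HS (\<lambda>\<omega>. cnj (f \<omega>)) g' h'" and g: "g \<in> L2 M" "g' \<in> L2 M"
  shows "L2_inner M g' h = L2_inner M h' g"
proof -
  obtain s where s: "\<And>n. simple_function borel (s n)" "uniform_limit UNIV s f sequentially"
    "(\<lambda>n. L2_dist M (Sp (s n) g) h) \<longlonglongrightarrow> 0"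
    using HSE[OF f] by blast
  note L = HS_L2[OF f] HS_L2[OF f']
  define t where "t n \<omega> = cnj (s n \<omega>)" for n \<omega>
  have t: "simple_function borel (t n)" for n
    using simple_function_compose[OF s(1), of cnj n] by (simp add: t_def[abs_def] comp_def)
  have tl: "uniform_limit UNIV t (\<lambda>\<omega>. cnj (f \<omega>)) sequentially"
    unfolding t_def[abs_def] by (rule bounded_linear.uniform_limit[OF bounded_linear_cnj s(2)])
  note t0 = HS_tendsto[OF f' g(2) t tl]
  have eq: "L2_inner M g' (Sp (s n) g) = L2_inner M (Sp (t n) g') g" for n
  proof -
    note sD = simple_function_borelD[OF s(1)]
    have rt: "range (t n) = cnj ` range (s n)" by (auto simp: t_def)
    have "Sp (t n) g' = (\<lambda>x. \<Sum>c\<in>range (s n). cnj c * E (s n -` {c}) g' x)"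
      unfolding simple_spectral_def rt
      by (subst sum.reindex) (auto simp: inj_on_def t_def vimage_def)
    moreover have "L2_inner M (\<lambda>x. \<Sum>c\<in>range (s n). cnj c * E (s n -` {c}) g' x) g =
        (\<Sum>c\<in>range (s n). L2_inner M (\<lambda>x. cnj c * E (s n -` {c}) g' x) g)"
      by (intro L2_inner_sum_left g L2_scale E_L2 sD)
    moreover have "L2_inner M g' (Sp (s n) g) =
        (\<Sum>c\<in>range (s n). L2_inner M g' (\<lambda>x. c * E (s n -` {c}) g x))"
      unfolding simple_spectral_def by (intro L2_inner_sum_right g L2_scale E_L2 sD)
    ultimately show ?thesis
      by (simp add: L2_inner_scale_left L2_inner_scale_right E_adjoint sD g)
  qed
  have "(\<lambda>n. L2_inner M g' (Sp (s n) g)) \<longlonglongrightarrow> L2_inner M g' h"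
  proof (rule Lim_transform2[OF tendsto_const], rule Lim_null_comparison)
    show "(\<lambda>n. L2_norm M g' * L2_dist M (Sp (s n) g) h) \<longlonglongrightarrow> 0"
      using tendsto_mult_left[OF s(3)] by simp
    show "\<forall>\<^sub>F n in sequentially. norm (L2_inner M g' h - L2_inner M g' (Sp (s n) g)) \<le>
       L2_norm M g' * L2_dist M (Sp (s n) g) h"
      using L2_Cauchy_Schwarz[OF g(2) L2_diff[OF simple_spectral_L2[OF s(1) g(1)] L(1)]]
      by (simp add: L2_inner_diff_right simple_spectral_L2 s g L norm_minus_commute)
  qed
  moreover have "(\<lambda>n. L2_inner M (Sp (t n) g') g) \<longlonglongrightarrow> L2_inner M h' g"
  proof (rule Lim_transform2[OF tendsto_const], rule Lim_null_comparison)
    show "(\<lambda>n. L2_norm M g * L2_dist M (Sp (t n) g') h') \<longlonglongrightarrow> 0"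
      using tendsto_mult_left[OF t0] by simp
    have "norm (L2_inner M h' g - L2_inner M (Sp (t n) g') g) =
       norm (L2_inner M g (\<lambda>x. Sp (t n) g' x - h' x))" for n
      unfolding L2_inner_cnj[of M _ g] complex_cnj_diff[symmetric] complex_mod_cnj
      by (simp add: L2_inner_diff_right simple_spectral_L2 t g L norm_minus_commute)
    then show "\<forall>\<^sub>F n in sequentially. norm (L2_inner M h' g - L2_inner M (Sp (t n) g') g) \<le>
       L2_norm M g * L2_dist M (Sp (t n) g') h'"
      using L2_Cauchy_Schwarz[OF g(1) L2_diff[OF simple_spectral_L2[OF t g(2)] L(2)]] by simp
  qed
  ultimately show ?thesis unfolding eq by (rule LIMSEQ_unique)
qed

text \<open>Split \<open>g\<close> into \<open>E B g\<close> and the rest: the small bound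
  \<open>e\<close> acts on the first part, the crude bound \<open>C\<close> only on the mass of
  \<open>g\<close> outside \<open>B\<close>. In applications \<open>B\<close> is a bounded window of
  frequencies.\<close>

lemma HS_norm_le_split:
  assumes f: "HS f g h" and g: "g \<in> L2 M" and [measurable]: "f \<in> borel_measurable borel" "B \<in> sets borel"
    and C: "\<And>\<omega>. cmod (f \<omega>) \<le> C" and e: "\<And>\<omega>. \<omega> \<in> B \<Longrightarrow> cmod (f \<omega>) \<le> e" "e \<ge> 0"
  shows "L2_norm M h \<le> e * L2_norm M g + C * L2_dist M g (E B g)"
proof -
  have B: "HS (indicator B) g (E B g)" by (rule HS_indicator[OF g]) simp
  have B': "HS (\<lambda>\<omega>. 1 * 1 + (-1) * indicator B \<omega>) g (\<lambda>x. 1 * (1 * g x) + (-1) * E B g x)"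
    by (rule HS_linear[OF HS_const[OF g] B g])
  have L: "E B g \<in> L2 M" "(\<lambda>x. g x - E B g x) \<in> L2 M" by (auto intro!: L2_diff E_L2 g)
  obtain h1 where h1: "HS f (E B g) h1" using HS_exists[OF L(1) assms(3) C] by blast
  obtain h2 where h2: "HS f (\<lambda>x. g x - E B g x) h2" using HS_exists[OF L(2) assms(3) C] by blast
  have s1: "HS (\<lambda>\<omega>. f \<omega> * indicator B \<omega>) g h1"
    by (rule HS_mult[OF B h1 g _ C, of 1]) (auto simp: indicator_def)
  have s2: "HS (\<lambda>\<omega>. f \<omega> * (1 * 1 + (-1) * indicator B \<omega>)) g h2"
    by (rule HS_mult[OF B' _ g _ C, where C=1]) (use h2 in \<open>auto simp: indicator_def\<close>)
  have "HS f g (\<lambda>x. 1 * h1 x + 1 * h2 x)"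
    using HS_linear[OF s1 s2 g, of 1 1] by (simp add: algebra_simps)
  from HS_unique(2)[OF f this g] have "L2_norm M h = L2_norm M (\<lambda>x. h1 x + h2 x)"
    by (intro L2_norm_cong_AE L2_add HS_L2[OF f] HS_L2[OF s1] HS_L2[OF s2]) auto
  also have "\<dots> \<le> L2_norm M h1 + L2_norm M h2" by (intro L2_norm_triangle HS_L2[OF s1] HS_L2[OF s2])
  also have "L2_norm M h1 \<le> e * L2_norm M g"
    by (rule HS_norm_le[OF s1 g]) (use e in \<open>auto simp: indicator_def\<close>)
  also have "L2_norm M h2 \<le> C * L2_dist M g (E B g)"
    by (rule HS_norm_le[OF h2 L(2) C])
  finally show ?thesis by simp
qed

text \<open>Countable additivity along the annuli
  \<open>real i \<le> \<bar>\<omega>\<bar> < real (Suc i)\<close>, whose finite unions are the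
  windows. So a fixed vector has little mass at high frequencies.\<close>

lemma E_exhausts:
  assumes g: "g \<in> L2 M"
  shows "(\<lambda>n. L2_dist M g (E {\<omega>. \<bar>\<omega>\<bar> < real n} g)) \<longlonglongrightarrow> 0"
proof -
  define A where "A i = {\<omega>::real. real i \<le> \<bar>\<omega>\<bar> \<and> \<bar>\<omega>\<bar> < real (Suc i)}" for i :: nat
  have A [measurable]: "A i \<in> sets borel" for i unfolding A_def by measurable
  have disj: "disjoint_family A"
    unfolding disjoint_family_on_def A_def by (auto simp: set_eq_iff)
  have un: "(\<Union>i<n. A i) = {\<omega>. \<bar>\<omega>\<bar> < real n}" for n
  proof (induction n)
    case (Suc n)
    show ?case unfolding lessThan_Suc UN_insert Suc by (auto simp: A_def)
  qed auto
  have UN: "(\<Union>i. A i) = UNIV"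
  proof (rule UNIV_eq_I[symmetric])
    fix \<omega> :: real
    obtain n :: nat where "\<bar>\<omega>\<bar> < real n" using reals_Archimedean2 by blast
    then show "\<omega> \<in> (\<Union>i. A i)" using un[of n] by blast
  qed
  have "L2_norm M (\<lambda>x. E (\<Union>i. A i) g x - (\<Sum>i<n. E (A i) g x)) =
      L2_dist M g (E {\<omega>. \<bar>\<omega>\<bar> < real n} g)" for n
  proof (rule L2_norm_cong_AE)
    show "AE x in M. E (\<Union>i. A i) g x - (\<Sum>i<n. E (A i) g x) = g x - E {\<omega>. \<bar>\<omega>\<bar> < real n} g x"
      using E_UNIV[OF g] E_finite_UN[OF g, of "{..<n}" A] disj
      unfolding UN un by (auto simp: disjoint_family_on_def elim: eventually_elim2)
  qed (auto intro!: L2_diff L2_sum E_L2 g)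
  then show ?thesis using E_countably_additive[OF _ disj g] by (auto simp: image_subset_iff)
qed

end

section \<open>Discrete Koopman operators\<close>

text \<open>Functional calculus of the discrete generator. Vectors orthogonal to all
  \<open>v k\<close> are sent to 0 for every \<open>F\<close>, so \<open>F = 1\<close> gives the
  projection onto the span rather than the identity.\<close>

definition eigen_calculus ::
    "'a measure \<Rightarrow> nat \<Rightarrow> (nat \<Rightarrow> 'a \<Rightarrow> complex) \<Rightarrow> (nat \<Rightarrow> real) \<Rightarrow> (real \<Rightarrow> complex) \<Rightarrow>
     ('a \<Rightarrow> complex) \<Rightarrow> 'a \<Rightarrow> complex" where
  "eigen_calculus M d v \<omega> F g = (\<lambda>x. \<Sum>k=1..d. F (\<omega> k) * rank_one_projector M (v k) g x)"

locale orthonormal_family =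
  fixes M :: "'a measure" and d :: nat and v :: "nat \<Rightarrow> 'a \<Rightarrow> complex" and \<omega> :: "nat \<Rightarrow> real"
  assumes v_L2: "k \<in> {1..d} \<Longrightarrow> v k \<in> L2 M"
    and orthonormal: "j \<in> {1..d} \<Longrightarrow> k \<in> {1..d} \<Longrightarrow> L2_inner M (v j) (v k) = (if j = k then 1 else 0)"
begin

abbreviation Op where "Op \<equiv> eigen_calculus M d v \<omega>"

lemma Op_eq: "Op F g = (\<lambda>x. \<Sum>k=1..d. (F (\<omega> k) * L2_inner M (v k) g) * v k x)"
  unfolding eigen_calculus_def rank_one_projector_def by (simp add: mult_ac)

lemma Op_L2 [intro]: "Op F g \<in> L2 M"
  unfolding Op_eq by (intro L2_sum L2_scale v_L2)

lemma Op_add: "Op (\<lambda>y. a * F y + b * G y) g x = a * Op F g x + b * Op G g x"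
  unfolding eigen_calculus_def by (simp add: sum_distrib_left sum.distrib distrib_right mult.assoc)

lemma Op_diff_right:
  assumes "g \<in> L2 M" "h \<in> L2 M"
  shows "Op F (\<lambda>x. g x - h x) x = Op F g x - Op F h x"
  unfolding Op_eq sum_subtractf[symmetric]
  using assms v_L2 by (intro sum.cong) (auto simp: L2_inner_diff_right algebra_simps)

lemma inner_Op_right:
  assumes "h \<in> L2 M"
  shows "L2_inner M h (Op F g) = (\<Sum>k=1..d. F (\<omega> k) * L2_inner M (v k) g * L2_inner M h (v k))"
  unfolding Op_eq using assms v_L2
  by (subst L2_inner_sum_right) (auto intro: L2_scale simp: L2_inner_scale_right)

lemma inner_v_Op:
  assumes "j \<in> {1..d}"
  shows "L2_inner M (v j) (Op F g) = F (\<omega> j) * L2_inner M (v j) g"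
proof -
  have "L2_inner M (v j) (Op F g) =
      (\<Sum>k=1..d. if j = k then F (\<omega> k) * L2_inner M (v k) g else 0)"
    unfolding inner_Op_right[OF v_L2[OF assms]] using assms by (intro sum.cong) (auto simp: orthonormal)
  then show ?thesis using assms by simp
qed

lemma Op_mult: "Op F (Op G g) = Op (\<lambda>y. F y * G y) g"
proof
  show "Op F (Op G g) x = Op (\<lambda>y. F y * G y) g x" for x
    unfolding Op_eq[of F "Op G g"] Op_eq[of "\<lambda>y. F y * G y"]
    by (intro sum.cong refl) (simp add: inner_v_Op)
qed

lemma Op_norm_square:
  "(L2_norm M (Op F g))\<^sup>2 = (\<Sum>k=1..d. (cmod (F (\<omega> k)) * cmod (L2_inner M (v k) g))\<^sup>2)"
proof -
  have "of_real ((L2_norm M (Op F g))\<^sup>2) = L2_inner M (Op F g) (Op F g)" by (simp only: L2_inner_self)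
  also have "\<dots> = (\<Sum>k=1..d. F (\<omega> k) * L2_inner M (v k) g * cnj (F (\<omega> k) * L2_inner M (v k) g))"
    unfolding inner_Op_right[OF Op_L2] by (intro sum.cong refl) (simp add: L2_inner_cnj[of M "Op F g"] inner_v_Op)
  also have "\<dots> = of_real (\<Sum>k=1..d. (cmod (F (\<omega> k)) * cmod (L2_inner M (v k) g))\<^sup>2)"
    by (simp only: of_real_sum norm_mult[symmetric] complex_norm_square)
  finally show ?thesis by (simp only: of_real_eq_iff)
qed

text \<open>Expand the square of the distance from \<open>g\<close> to its projection onto the span
  of the family.\<close>

lemma Bessel:
  assumes g: "g \<in> L2 M"
  shows "(\<Sum>k=1..d. (cmod (L2_inner M (v k) g))\<^sup>2) \<le> (L2_norm M g)\<^sup>2"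
proof -
  have n: "(L2_norm M (Op (\<lambda>_. 1) g))\<^sup>2 = (\<Sum>k=1..d. (cmod (L2_inner M (v k) g))\<^sup>2)"
    by (simp add: Op_norm_square)
  have "L2_inner M g (Op (\<lambda>_. 1) g) = (\<Sum>k=1..d. L2_inner M (v k) g * cnj (L2_inner M (v k) g))"
    unfolding inner_Op_right[OF g] by (simp add: L2_inner_cnj[of M g])
  also have "\<dots> = of_real (\<Sum>k=1..d. (cmod (L2_inner M (v k) g))\<^sup>2)"
    by (simp only: of_real_sum complex_norm_square)
  finally have i: "Re (L2_inner M g (Op (\<lambda>_. 1) g)) = (\<Sum>k=1..d. (cmod (L2_inner M (v k) g))\<^sup>2)"
    by (simp only: Re_complex_of_real)
  have "0 \<le> (L2_dist M g (Op (\<lambda>_. 1) g))\<^sup>2" by simp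
  also have "\<dots> = (L2_norm M g)\<^sup>2 - (\<Sum>k=1..d. (cmod (L2_inner M (v k) g))\<^sup>2)"
    unfolding L2_norm_square_diff[OF g Op_L2] n i by simp
  finally show ?thesis by simp
qed

lemma Op_norm_le:
  assumes g: "g \<in> L2 M" and C: "\<And>k. k \<in> {1..d} \<Longrightarrow> cmod (F (\<omega> k)) \<le> C" "C \<ge> 0"
  shows "L2_norm M (Op F g) \<le> C * L2_norm M g"
proof -
  have "(L2_norm M (Op F g))\<^sup>2 \<le> (\<Sum>k=1..d. (C * cmod (L2_inner M (v k) g))\<^sup>2)"
    unfolding Op_norm_square using C by (intro sum_mono power_mono mult_right_mono) auto
  also have "\<dots> = C\<^sup>2 * (\<Sum>k=1..d. (cmod (L2_inner M (v k) g))\<^sup>2)"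
    by (simp add: power_mult_distrib sum_distrib_left)
  also have "\<dots> \<le> (C * L2_norm M g)\<^sup>2"
    using Bessel[OF g] by (simp add: power_mult_distrib mult_left_mono)
  finally show ?thesis using C by (simp add: power2_le_iff_abs_le)
qed

lemma Op_adjoint:
  assumes "g \<in> L2 M" "h \<in> L2 M"
  shows "L2_inner M h (Op F g) = L2_inner M (Op (\<lambda>y. cnj (F y)) h) g"
  unfolding L2_inner_cnj[of M "Op _ h"] inner_Op_right[OF assms(1)] inner_Op_right[OF assms(2)]
  by (simp add: cnj_sum L2_inner_cnj[symmetric] mult_ac)

end

section \<open>Cells of equal measure and averaging\<close>

locale equal_cells = finite_measure M for M :: "'a measure" +
  fixes C :: "'a set set"
  assumes finite_cells: "finite C" and cell_sets: "p \<in> C \<Longrightarrow> p \<in> sets M"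
    and null_overlap: "p \<in> C \<Longrightarrow> p' \<in> C \<Longrightarrow> p \<noteq> p' \<Longrightarrow> emeasure M (p \<inter> p') = 0"
    and cell_measure: "p \<in> C \<Longrightarrow> measure M p = measure M (space M) / real (card C)"
    and measure_pos: "measure M (space M) > 0"
begin

lemma inner_indicator:
  assumes [measurable]: "A \<in> sets M" "B \<in> sets M"
  shows "L2_inner M (indicator A) (indicator B) = of_real (measure M (A \<inter> B))"
proof -
  have "(\<lambda>x. cnj (indicator A x) * indicator B x) = (\<lambda>x. complex_of_real (indicator (A \<inter> B) x))"
    by (auto simp: indicator_def)
  then show ?thesis by (simp add: L2_inner_def)
qed

lemma cell_average_eq:
  "cell_average M C g p = of_real (real (card C) / measure M (space M)) * L2_inner M (indicator p) g"
proof -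
  have "(\<lambda>x. cnj (indicator p x) * g x) = (\<lambda>x. g x * indicator p x)" by (auto simp: indicator_def)
  then show ?thesis by (simp add: cell_average_def L2_inner_def)
qed

lemma inner_cells:
  assumes "p \<in> C" "p' \<in> C"
  shows "of_real (real (card C) / measure M (space M)) * L2_inner M (indicator p) (indicator p')
    = (if p = p' then 1 else (0::complex))"
proof -
  have "card C > 0" using assms finite_cells by (auto simp: card_gt_0_iff)
  then show ?thesis
    using assms cell_measure measure_pos null_overlap
    by (auto simp: inner_indicator cell_sets measure_def)
qed

lemma AE_cells_disjoint: "AE x in M. \<forall>p\<in>C. \<forall>p'\<in>C. p \<noteq> p' \<longrightarrow> x \<notin> p \<inter> p'"
proof (rule AE_finite_allI[OF finite_cells], rule AE_finite_allI[OF finite_cells])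
  fix p p' assume p: "p \<in> C" "p' \<in> C"
  show "AE x in M. p \<noteq> p' \<longrightarrow> x \<notin> p \<inter> p'"
  proof (cases "p = p'")
    case False
    have "p \<inter> p' \<in> null_sets M" using null_overlap[OF p False] cell_sets p by auto
    then show ?thesis by (auto dest: AE_not_in)
  qed simp
qed

text \<open>Almost every point lies in at most one cell. The target type is left open because
  measures need the identity over the reals and operators need it over the complex numbers.\<close>

lemma AE_sum_cells:
  assumes "Q \<subseteq> C"
  shows "AE x in M. (\<Sum>p\<in>Q. indicator p x) = (indicator (\<Union>Q) x :: 'b::{comm_monoid_add,zero_neq_one})"
  using AE_cells_disjoint
proof eventually_elim
  case (elim x)
  show ?case
  proof (cases "\<exists>p\<in>Q. x \<in> p")
    case True
    then obtain p where p: "p \<in> Q" "x \<in> p" by blast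
    have "(\<Sum>p'\<in>Q. indicator p' x) = (\<Sum>p'\<in>Q. if p = p' then 1 else (0::'b))"
      using elim p assms by (intro sum.cong) (auto simp: indicator_def)
    also have "\<dots> = 1" using p finite_subset[OF assms finite_cells] by simp
    finally show ?thesis using p by (auto simp: indicator_def)
  qed (auto simp: indicator_def intro!: sum.neutral)
qed

lemma measure_cell_union:
  assumes "Q \<subseteq> C"
  shows "measure M (\<Union>Q) = real (card Q) * (measure M (space M) / real (card C))"
proof -
  have fin: "finite Q" by (rule finite_subset[OF assms finite_cells])
  have s: "\<Union>Q \<in> sets M" using fin assms cell_sets by (intro sets.finite_Union) auto
  have "measure M (\<Union>Q) = (LINT x|M. indicator (\<Union>Q) x)" using s by simp
  also have "\<dots> = (LINT x|M. (\<Sum>p\<in>Q. indicator p x))"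
    using AE_sum_cells[OF assms, where ?'b = real] s assms cell_sets
    by (intro integral_cong_AE) (auto intro!: borel_measurable_sum borel_measurable_indicator elim!: eventually_mono)
  also have "\<dots> = (\<Sum>p\<in>Q. measure M p)"
    using assms cell_sets by (subst Bochner_Integration.integral_sum)
      (auto intro!: integrable_real_indicator sum.cong simp: emeasure_finite less_top[symmetric])
  also have "\<dots> = (\<Sum>p\<in>Q. measure M (space M) / real (card C))"
    using assms cell_measure by (intro sum.cong) auto
  finally show ?thesis by simp
qed

lemma cell_sum_L2: "\<sigma> ` C \<subseteq> sets M \<Longrightarrow> (\<lambda>x. \<Sum>p\<in>C. a p * indicator (\<sigma> p) x) \<in> L2 M"
  by (intro L2_sum L2_scale L2_indicator) auto

text \<open>Distinct cells are orthogonal, and the factor in \<open>cell_average\<close> is the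
  inverse of the common cell measure, so the average over \<open>\<sigma> p\<close> reads off one
  coefficient. With the identity for \<open>\<sigma>\<close> this recovers the coefficients of a
  cell function.\<close>

lemma cell_average_permuted:
  assumes \<sigma>: "bij_betw \<sigma> C C" and p: "p \<in> C"
  shows "cell_average M C (\<lambda>x. \<Sum>p\<in>C. a p * indicator (\<sigma> p) x) (\<sigma> p) = a p"
proof -
  have \<sigma>C: "\<sigma> p \<in> C" if "p \<in> C" for p using \<sigma> that by (rule bij_betwE[rule_format])
  have "cell_average M C (\<lambda>x. \<Sum>p\<in>C. a p * indicator (\<sigma> p) x) (\<sigma> p) =
     (\<Sum>p'\<in>C. a p' * (of_real (real (card C) / measure M (space M)) *
        L2_inner M (indicator (\<sigma> p)) (indicator (\<sigma> p'))))"
    unfolding cell_average_eq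
    by (subst L2_inner_sum_right)
       (use p in \<open>auto intro!: L2_scale L2_indicator cell_sets \<sigma>C sum.cong
          simp: L2_inner_scale_right sum_distrib_left\<close>)
  also have "\<dots> = (\<Sum>p'\<in>C. if p = p' then a p' else 0)"
  proof (intro sum.cong refl)
    fix p' assume p': "p' \<in> C"
    have "\<sigma> p = \<sigma> p' \<longleftrightarrow> p = p'" using \<sigma> p p' by (auto simp: bij_betw_def inj_on_eq_iff)
    then show "a p' * (of_real (real (card C) / measure M (space M)) *
        L2_inner M (indicator (\<sigma> p)) (indicator (\<sigma> p'))) = (if p = p' then a p' else 0)"
      unfolding inner_cells[OF \<sigma>C[OF p] \<sigma>C[OF p']] by simp
  qed
  also have "\<dots> = a p" using p finite_cells by simp
  finally show ?thesis .
qed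

lemma cell_average_cong_AE:
  assumes "f \<in> L2 M" "g \<in> L2 M" "AE x in M. f x = g x" "p \<in> C"
  shows "cell_average M C f p = cell_average M C g p"
  unfolding cell_average_eq using assms by (intro arg_cong2[where f="(*)"] L2_inner_cong_AE) (auto intro: cell_sets)

lemma cell_average_sum:
  assumes "p \<in> C" "\<And>i. i \<in> I \<Longrightarrow> g i \<in> L2 M"
  shows "cell_average M C (\<lambda>x. \<Sum>i\<in>I. c i * g i x) p = (\<Sum>i\<in>I. c i * cell_average M C (g i) p)"
  unfolding cell_average_eq
  by (subst L2_inner_sum_right)
     (use assms in \<open>auto intro!: L2_scale L2_indicator cell_sets sum.cong simp: L2_inner_scale_right sum_distrib_left\<close>)

lemma averaging_in_cell_space: "averaging M C g \<in> cell_space M C"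
  unfolding cell_space_def averaging_def
  using cell_sum_L2[of "\<lambda>p. p"] cell_sets by (auto intro!: exI[of _ "cell_average M C g"])

lemma averaging_L2 [intro]: "averaging M C g \<in> L2 M"
  using averaging_in_cell_space by (simp add: cell_space_def)

lemma cell_average_averaging: "p \<in> C \<Longrightarrow> cell_average M C (averaging M C g) p = cell_average M C g p"
  unfolding averaging_def using cell_average_permuted[of "\<lambda>p. p" p] by (simp add: bij_betw_def)

text \<open>Averaging keeps the inner product with each cell, so it is the orthogonal projection
  onto the cell functions. This is what later allows \<open>g\<close> in place of its
  average.\<close>

lemma inner_cell_space_averaging:
  assumes w: "w \<in> cell_space M C" and g: "g \<in> L2 M"
  shows "L2_inner M w (averaging M C g) = L2_inner M w g"
proof -
  obtain c where c: "AE x in M. w x = (\<Sum>p\<in>C. c p * indicator p x)" using w by (auto simp: cell_space_def)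
  have wL: "w \<in> L2 M" using w by (simp add: cell_space_def)
  have sL: "(\<lambda>x. \<Sum>p\<in>C. c p * indicator p x) \<in> L2 M" using cell_sum_L2[of "\<lambda>p. p"] cell_sets by auto
  have "L2_inner M w h = (\<Sum>p\<in>C. cnj (c p) * L2_inner M (indicator p) h)" if h: "h \<in> L2 M" for h
  proof -
    have "L2_inner M w h = L2_inner M (\<lambda>x. \<Sum>p\<in>C. c p * indicator p x) h"
      by (rule L2_inner_cong_AE[OF wL sL h h c]) simp
    also have "\<dots> = (\<Sum>p\<in>C. cnj (c p) * L2_inner M (indicator p) h)"
      by (subst L2_inner_sum_left)
         (auto intro!: h L2_scale L2_indicator cell_sets sum.cong simp: L2_inner_scale_left)
    finally show ?thesis .
  qed
  moreover have "L2_inner M (indicator p) (averaging M C g) = L2_inner M (indicator p) g" if "p \<in> C" for p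
  proof -
    have "card C > 0" using that finite_cells by (auto simp: card_gt_0_iff)
    then show ?thesis using cell_average_averaging[OF that, of g] measure_pos by (simp add: cell_average_eq)
  qed
  ultimately show ?thesis using g averaging_L2 by simp
qed

lemma averaging_cell_space:
  assumes w: "w \<in> cell_space M C"
  shows "AE x in M. averaging M C w x = w x"
proof -
  obtain c where c: "AE x in M. w x = (\<Sum>p\<in>C. c p * indicator p x)" using w by (auto simp: cell_space_def)
  have wL: "w \<in> L2 M" using w by (simp add: cell_space_def)
  have sL: "(\<lambda>x. \<Sum>p\<in>C. c p * indicator p x) \<in> L2 M" using cell_sum_L2[of "\<lambda>p. p"] cell_sets by auto
  have "cell_average M C w p = c p" if "p \<in> C" for p
    using cell_average_cong_AE[OF wL sL c that] cell_average_permuted[of "\<lambda>p. p" p c] that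
    by (simp add: bij_betw_def)
  then have "averaging M C w = (\<lambda>x. \<Sum>p\<in>C. c p * indicator p x)"
    unfolding averaging_def by (auto intro!: ext sum.cong)
  then show ?thesis using c by (auto elim!: eventually_mono)
qed

end

section \<open>Iterates of a cell permutation and their spectrum\<close>

lemma int_iterate_neg: "int_iterate C T (- int m) = inv_into C T ^^ m"
  \<comment> \<open>At \<open>m = 0\<close> the definition takes its nonnegative branch; both
    branches are the identity there.\<close>
  by (cases "m = 0") (simp_all add: int_iterate_def)

locale cell_permutation = equal_cells +
  fixes T :: "'a set \<Rightarrow> 'a set"
  assumes T_bij: "bij_betw T C C"
begin

abbreviation backward :: "nat \<Rightarrow> 'a set \<Rightarrow> 'a set" where "backward m \<equiv> inv_into C T ^^ m"

text \<open>The Laplace sum runs over positive times. These move cells by the inverse of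
  \<open>T\<close>, as the Koopman convention demands.\<close>

definition U :: "nat \<Rightarrow> ('a \<Rightarrow> complex) \<Rightarrow> 'a \<Rightarrow> complex" where "U m = discrete_koopman M C T (int m)"

lemma backward_bij: "bij_betw (backward m) C C"
proof (induction m)
  case 0
  show ?case by (simp add: bij_betw_def)
next
  case (Suc m)
  show ?case using bij_betw_trans[OF Suc bij_betw_inv_into[OF T_bij]] by (simp only: funpow.simps)
qed

lemma backward_in: "p \<in> C \<Longrightarrow> backward m p \<in> C"
  using bij_betwE[OF backward_bij] by blast

lemma U_eq: "U m g = (\<lambda>x. \<Sum>p\<in>C. cell_average M C g p * indicator (backward m p) x)"
  by (simp add: U_def discrete_koopman_def int_iterate_neg)

lemma U_L2 [intro]: "U m g \<in> L2 M"
  unfolding U_eq by (rule cell_sum_L2) (auto intro: cell_sets backward_in)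

lemma U_0: "U 0 g = averaging M C g"
  unfolding U_eq averaging_def by simp

text \<open>A coefficient travels with its cell: after \<open>m\<close> steps the one of
  \<open>p\<close> sits on \<open>backward m p\<close>. Reindexing by that permutation lets the next
  step read it there.\<close>

lemma U_Suc: "U (Suc m) g = U 1 (U m g)"
proof
  fix x
  have "U 1 (U m g) x = (\<Sum>p\<in>C. cell_average M C (U m g) (backward m p) * indicator (backward 1 (backward m p)) x)"
    unfolding U_eq[of 1] by (rule sum.reindex_bij_betw[OF backward_bij, symmetric])
  also have "\<dots> = (\<Sum>p\<in>C. cell_average M C g p * indicator (backward (Suc m) p) x)"
    by (intro sum.cong refl) (simp add: U_eq[of m] cell_average_permuted[OF backward_bij])
  finally show "U (Suc m) g x = U 1 (U m g) x" by (simp add: U_eq[of "Suc m"])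
qed

lemma U_sum:
  assumes "\<And>i. i \<in> I \<Longrightarrow> g i \<in> L2 M"
  shows "U m (\<lambda>x. \<Sum>i\<in>I. c i * g i x) = (\<lambda>x. \<Sum>i\<in>I. c i * U m (g i) x)"
proof
  fix x
  have "U m (\<lambda>x. \<Sum>i\<in>I. c i * g i x) x =
      (\<Sum>p\<in>C. \<Sum>i\<in>I. c i * cell_average M C (g i) p * indicator (backward m p) x)"
    unfolding U_eq using assms by (intro sum.cong refl) (simp add: cell_average_sum sum_distrib_right)
  also have "\<dots> = (\<Sum>i\<in>I. c i * U m (g i) x)"
    unfolding U_eq by (subst sum.swap) (simp add: sum_distrib_left mult.assoc)
  finally show "U m (\<lambda>x. \<Sum>i\<in>I. c i * g i x) x = (\<Sum>i\<in>I. c i * U m (g i) x)" .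
qed

lemma U_add_scale:
  assumes "f \<in> L2 M" "h \<in> L2 M"
  shows "U m (\<lambda>x. f x + a * h x) x = U m f x + a * U m h x"
proof -
  have "U m (\<lambda>x. \<Sum>b\<in>(UNIV::bool set). (if b then 1 else a) * (if b then f else h) x) x =
      (\<Sum>b\<in>(UNIV::bool set). (if b then 1 else a) * U m (if b then f else h) x)"
    by (subst U_sum) (use assms in auto)
  then show ?thesis by (simp add: UNIV_bool add.commute)
qed

lemma U_cong:
  assumes "\<And>p. p \<in> C \<Longrightarrow> cell_average M C f p = cell_average M C g p"
  shows "U m f = U m g"
  unfolding U_eq using assms by (auto intro!: ext sum.cong)

lemma U_eigen:
  assumes w: "w \<in> cell_space M C" and eig: "AE x in M. U 1 w x = c * w x"
  shows "AE x in M. U m w x = c ^ m * w x"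
proof (induction m)
  case 0
  \<comment> \<open>At time 0 the operator is averaging, which fixes a cell function only almost
    everywhere.\<close>
  show ?case using averaging_cell_space[OF w] by (simp add: U_0)
next
  case (Suc m)
  have wL: "w \<in> L2 M" using w by (simp add: cell_space_def)
  have "U 1 (U m w) = U 1 (\<lambda>x. c ^ m * w x)"
    by (rule U_cong, rule cell_average_cong_AE[OF U_L2 L2_scale[OF wL] Suc.IH])
  also have "\<dots> = (\<lambda>x. c ^ m * U 1 w x)"
    using U_sum[of "{()}" "\<lambda>_. w" 1 "\<lambda>_. c ^ m"] wL by simp
  finally have "U (Suc m) w = (\<lambda>x. c ^ m * U 1 w x)" unfolding U_Suc .
  then show ?case using eig by (auto elim!: eventually_mono simp: mult_ac)
qed

end

locale discrete_spectrum = cell_permutation +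
  fixes v \<theta> and \<tau> :: real
  assumes eigenbasis: "discrete_eigenbasis M C T (card C) v \<theta>" and \<tau>_pos: "\<tau> > 0"
begin

sublocale orthonormal_family M "card C" v "\<lambda>k. \<theta> k / \<tau>"
  by standard (use eigenbasis in \<open>auto simp: discrete_eigenbasis_def orthonormal_basis_def cell_space_def\<close>)

text \<open>The branch of the argument in [-pi, pi) keeps all discrete frequencies in the range
  where \<open>laplace_sum_approx\<close> holds uniformly.\<close>

lemma frequency_bound: "k \<in> {1..card C} \<Longrightarrow> \<bar>(\<theta> k / \<tau>) * \<tau>\<bar> \<le> pi"
proof -
  assume "k \<in> {1..card C}"
  then have "- pi \<le> \<theta> k \<and> \<theta> k < pi" using eigenbasis by (auto simp: discrete_eigenbasis_def)
  then show ?thesis using \<tau>_pos by (simp add: abs_le_iff)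
qed

lemma v_cell_space: "k \<in> {1..card C} \<Longrightarrow> v k \<in> cell_space M C"
  using eigenbasis by (auto simp: discrete_eigenbasis_def orthonormal_basis_def)

lemma Op_one:
  assumes g: "g \<in> L2 M"
  shows "AE x in M. Op (\<lambda>_. 1) g x = averaging M C g x"
proof -
  obtain c where c: "AE x in M. averaging M C g x = (\<Sum>k\<in>{1..card C}. c k * v k x)"
    using eigenbasis averaging_in_cell_space[of g]
    unfolding discrete_eigenbasis_def orthonormal_basis_def by blast
  have sL: "(\<lambda>x. \<Sum>k\<in>{1..card C}. c k * v k x) \<in> L2 M" by (intro L2_sum L2_scale v_L2)
  have "L2_inner M (v j) g = c j" if j: "j \<in> {1..card C}" for j
  proof -
    have "L2_inner M (v j) g = L2_inner M (v j) (averaging M C g)"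
      using inner_cell_space_averaging[OF v_cell_space[OF j] g] by simp
    also have "\<dots> = L2_inner M (v j) (\<lambda>x. \<Sum>k\<in>{1..card C}. c k * v k x)"
      by (rule L2_inner_cong_AE[OF v_L2[OF j] v_L2[OF j] averaging_L2 sL _ c]) simp
    also have "\<dots> = (\<Sum>k\<in>{1..card C}. c k * L2_inner M (v j) (v k))"
      by (subst L2_inner_sum_right[OF v_L2[OF j] L2_scale[OF v_L2]]) (simp_all add: L2_inner_scale_right)
    also have "\<dots> = (\<Sum>k\<in>{1..card C}. if j = k then c k else 0)"
      using j by (intro sum.cong refl) (simp add: orthonormal)
    also have "\<dots> = c j" using j by simp
    finally show ?thesis .
  qed
  then have "Op (\<lambda>_. 1) g = (\<lambda>x. \<Sum>k\<in>{1..card C}. c k * v k x)" unfolding Op_eq by simp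
  then show ?thesis using c by (auto elim!: eventually_mono)
qed

text \<open>\<open>U m\<close> depends only on cell averages, so \<open>g\<close> may be replaced by
  its expansion in the eigenbasis; each eigenfunction picks up the \<open>m\<close>-th power of its
  eigenvalue, which is the exponential of its frequency at time
  \<open>real m * \<tau>\<close>.\<close>

lemma U_eq_Op:
  assumes g: "g \<in> L2 M"
  shows "AE x in M. U m g x = Op (\<lambda>y. exp (\<i> * of_real (y * (real m * \<tau>)))) g x"
proof -
  let ?c = "\<lambda>k. L2_inner M (v k) g"
  have one: "Op (\<lambda>_. 1) g = (\<lambda>x. \<Sum>k=1..card C. ?c k * v k x)" unfolding Op_eq by simp
  have "U m g = U m (Op (\<lambda>_. 1) g)"
    by (rule U_cong, subst cell_average_averaging[symmetric], assumption,
        rule cell_average_cong_AE[OF averaging_L2 Op_L2])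
       (use Op_one[OF g] in \<open>auto elim!: eventually_mono\<close>)
  also have "\<dots> = (\<lambda>x. \<Sum>k=1..card C. ?c k * U m (v k) x)"
    unfolding one by (rule U_sum) (rule v_L2)
  finally have U: "U m g = (\<lambda>x. \<Sum>k=1..card C. ?c k * U m (v k) x)" .
  have "AE x in M. \<forall>k\<in>{1..card C}. U m (v k) x = exp (\<i> * of_real (\<theta> k)) ^ m * v k x"
  proof (rule AE_finite_allI)
    fix k assume k: "k \<in> {1..card C}"
    then have "AE x in M. U 1 (v k) x = exp (\<i> * of_real (\<theta> k)) * v k x"
      using eigenbasis by (auto simp: discrete_eigenbasis_def U_def)
    then show "AE x in M. U m (v k) x = exp (\<i> * of_real (\<theta> k)) ^ m * v k x"
      by (rule U_eigen[OF v_cell_space[OF k]])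
  qed simp
  then show ?thesis
  proof eventually_elim
    case (elim x)
    have "exp (\<i> * of_real (\<theta> k)) ^ m = exp (\<i> * of_real (\<theta> k / \<tau> * (real m * \<tau>)))" for k
      using \<tau>_pos by (simp add: exp_of_nat_mult[symmetric] mult_ac)
    then show ?case unfolding U Op_eq using elim by (intro sum.cong refl) (simp add: mult_ac)
  qed
qed

text \<open>Read off from the spectral form, whose symbol has modulus 1; it is an inequality because
  \<open>U m\<close> first projects to the cell functions.\<close>

lemma U_norm_le:
  assumes g: "g \<in> L2 M"
  shows "L2_norm M (U m g) \<le> L2_norm M g"
proof -
  have "L2_norm M (U m g) = L2_norm M (Op (\<lambda>y. exp (\<i> * of_real (y * (real m * \<tau>)))) g)"
    by (rule L2_norm_cong_AE[OF U_L2 Op_L2 U_eq_Op[OF g]])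
  also have "\<dots> \<le> 1 * L2_norm M g" by (rule Op_norm_le[OF g]) auto
  finally show ?thesis by simp
qed

end

section \<open>Hausdorff distance along the flow\<close>

lemma is_norm_nonneg: "is_norm nrm \<Longrightarrow> 0 \<le> nrm x"
proof -
  assume n: "is_norm nrm"
  have "nrm (x + (-1) *\<^sub>R x) \<le> nrm x + nrm ((-1) *\<^sub>R x)" "nrm ((-1) *\<^sub>R x) = \<bar>-1\<bar> * nrm x" "nrm 0 = 0"
    using n unfolding is_norm_def by blast+
  then show ?thesis by simp
qed

lemma is_norm_eq_0: "is_norm nrm \<Longrightarrow> nrm x = 0 \<longleftrightarrow> x = 0"
  by (simp add: is_norm_def)

lemma is_norm_scale: "is_norm nrm \<Longrightarrow> nrm (c *\<^sub>R x) = \<bar>c\<bar> * nrm x"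
  by (simp add: is_norm_def)

lemma is_norm_triangle: "is_norm nrm \<Longrightarrow> nrm (x + y) \<le> nrm x + nrm y"
  by (simp add: is_norm_def)

lemma is_norm_commute: "is_norm nrm \<Longrightarrow> nrm (x - y) = nrm (y - x)"
  using is_norm_scale[of nrm "-1" "x - y"] by simp

lemma is_norm_triangle3: "is_norm nrm \<Longrightarrow> nrm (x - z) \<le> nrm (x - y) + nrm (y - z)"
  using is_norm_triangle[of nrm "x - y" "y - z"] by simp

lemma is_norm_sum_le:
  assumes "is_norm nrm" shows "nrm (\<Sum>i\<in>I. f i) \<le> (\<Sum>i\<in>I. nrm (f i))"
proof (induction I rule: infinite_finite_induct)
  case (insert i I)
  then show ?case using is_norm_triangle[OF assms, of "f i" "\<Sum>i\<in>I. f i"] by simp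
qed (simp_all add: is_norm_eq_0[OF assms, THEN iffD2])

lemma is_norm_upper:
  fixes nrm :: "'a::euclidean_space \<Rightarrow> real"
  assumes n: "is_norm nrm"
  obtains C where "\<And>x. nrm x \<le> C * norm x"
proof
  fix x :: 'a
  have "nrm x = nrm (\<Sum>b\<in>Basis. (x \<bullet> b) *\<^sub>R b)" by (simp add: euclidean_representation)
  also have "\<dots> \<le> (\<Sum>b\<in>Basis. nrm ((x \<bullet> b) *\<^sub>R b))" by (rule is_norm_sum_le[OF n])
  also have "\<dots> \<le> (\<Sum>b\<in>Basis. norm x * nrm b)"
    by (intro sum_mono) (simp add: is_norm_scale[OF n] is_norm_nonneg[OF n] Basis_le_norm mult_right_mono)
  also have "\<dots> = (\<Sum>b\<in>Basis. nrm b) * norm x" by (simp add: sum_distrib_left mult.commute)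
  finally show "nrm x \<le> (\<Sum>b\<in>Basis. nrm b) * norm x" .
qed

lemma is_norm_continuous:
  fixes nrm :: "'a::euclidean_space \<Rightarrow> real"
  assumes n: "is_norm nrm"
  shows "continuous_on A nrm"
proof -
  obtain C where C: "\<And>x. nrm x \<le> C * norm x" using is_norm_upper[OF n] by blast
  have "dist (nrm x) (nrm y) \<le> \<bar>C\<bar> * dist x y" for x y
  proof -
    have "\<bar>nrm x - nrm y\<bar> \<le> nrm (x - y)"
      using is_norm_triangle[OF n, of "x - y" y] is_norm_triangle[OF n, of "y - x" x]
        is_norm_commute[OF n, of x y] by auto
    also have "\<dots> \<le> C * norm (x - y)" by (rule C)
    also have "\<dots> \<le> \<bar>C\<bar> * norm (x - y)" by (intro mult_right_mono) auto
    finally show ?thesis by (simp add: dist_norm)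
  qed
  then have "\<bar>C\<bar>-lipschitz_on A nrm" by (intro lipschitz_onI) auto
  then show ?thesis by (rule lipschitz_on_continuous_on)
qed

text \<open>The constant is the minimum of \<open>nrm\<close> over the compact Euclidean unit
  sphere, positive because 0 is not on it.\<close>

lemma is_norm_lower:
  fixes nrm :: "'a::euclidean_space \<Rightarrow> real"
  assumes n: "is_norm nrm"
  obtains c where "c > 0" "\<And>x. c * norm x \<le> nrm x"
proof -
  obtain b :: 'a where "b \<in> Basis" by (meson ex_in_conv nonempty_Basis)
  then have "sphere (0::'a) 1 \<noteq> {}" by (auto simp: set_eq_iff intro!: exI[of _ b])
  then obtain u where u: "u \<in> sphere 0 1" "\<And>x. x \<in> sphere 0 1 \<Longrightarrow> nrm u \<le> nrm x"
    using continuous_attains_inf[OF compact_sphere _ is_norm_continuous[OF n]] by metis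
  show thesis
  proof
    show "nrm u > 0"
      using is_norm_nonneg[OF n, of u] is_norm_eq_0[OF n, of u] u(1) by (auto simp: less_le)
    fix x
    show "nrm u * norm x \<le> nrm x"
    proof (cases "x = 0")
      case True then show ?thesis using is_norm_nonneg[OF n] by simp
    next
      case False
      have "nrm u \<le> nrm ((1 / norm x) *\<^sub>R x)" by (rule u(2)) (use False in simp)
      then show ?thesis using False by (simp add: is_norm_scale[OF n] field_simps)
    qed
  qed
qed

section \<open>Hausdorff distance\<close>

context
  fixes nrm :: "'a::euclidean_space \<Rightarrow> real"
  assumes n: "is_norm nrm"
begin

lemma INF_norm_le: "y \<in> B \<Longrightarrow> (INF y\<in>B. nrm (x - y)) \<le> nrm (x - y)"
  by (rule cINF_lower) (auto intro!: bdd_belowI2[of _ 0] is_norm_nonneg[OF n])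

lemma INF_norm_le': "y \<in> B \<Longrightarrow> (INF y\<in>B. nrm (y - x)) \<le> nrm (y - x)"
  by (rule cINF_lower) (auto intro!: bdd_belowI2[of _ 0] is_norm_nonneg[OF n])

lemma INF_norm_shift:
  assumes "B \<noteq> {}" "nrm (x - x') \<le> e"
  shows "(INF y\<in>B. nrm (x - y)) \<le> (INF y\<in>B. nrm (x' - y)) + e"
proof -
  have "(INF y\<in>B. nrm (x - y)) - e \<le> (INF y\<in>B. nrm (x' - y))"
  proof (rule cINF_greatest[OF assms(1)])
    fix y assume y: "y \<in> B"
    show "(INF y\<in>B. nrm (x - y)) - e \<le> nrm (x' - y)"
      using INF_norm_le[OF y, of x] is_norm_triangle3[OF n, of x y x'] assms(2) by simp
  qed
  then show ?thesis by simp
qed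

text \<open>A real \<open>SUP\<close> has its meaning only over bounded sets, so a common bound
  \<open>R\<close> on all distances accompanies the estimates on
  \<open>hausdorff_dist\<close>.\<close>

lemma hausdorff_bdd_above:
  assumes R: "\<And>x y. x \<in> A \<Longrightarrow> y \<in> B \<Longrightarrow> nrm (x - y) \<le> R" and ne: "A \<noteq> {}" "B \<noteq> {}"
  shows "bdd_above ((\<lambda>x. INF y\<in>B. nrm (x - y)) ` A)" "bdd_above ((\<lambda>y. INF x\<in>A. nrm (x - y)) ` B)"
proof -
  show "bdd_above ((\<lambda>x. INF y\<in>B. nrm (x - y)) ` A)"
    using ne R INF_norm_le by (intro bdd_aboveI2[of _ _ R]) (metis all_not_in_conv order_trans)
  show "bdd_above ((\<lambda>y. INF x\<in>A. nrm (x - y)) ` B)"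
    using ne R INF_norm_le' by (intro bdd_aboveI2[of _ _ R]) (metis all_not_in_conv order_trans)
qed

lemma hausdorff_dist_bounds:
  assumes R: "\<And>x y. x \<in> A \<Longrightarrow> y \<in> B \<Longrightarrow> nrm (x - y) \<le> R" and ne: "A \<noteq> {}" "B \<noteq> {}"
  shows "0 \<le> hausdorff_dist nrm A B" "hausdorff_dist nrm A B \<le> R"
proof -
  obtain a b where ab: "a \<in> A" "b \<in> B" using ne by auto
  have "0 \<le> (INF y\<in>B. nrm (a - y))" using ne by (intro cINF_greatest is_norm_nonneg[OF n])
  also have "\<dots> \<le> (SUP x\<in>A. INF y\<in>B. nrm (x - y))"
    by (rule cSUP_upper[OF ab(1) hausdorff_bdd_above(1)[OF assms]])
  finally show "0 \<le> hausdorff_dist nrm A B" by (simp add: hausdorff_dist_def)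
  have "(INF y\<in>B. nrm (x - y)) \<le> R" if "x \<in> A" for x
    using INF_norm_le[OF ab(2)] R[OF that ab(2)] by (rule order_trans)
  moreover have "(INF x\<in>A. nrm (x - y)) \<le> R" if "y \<in> B" for y
    using INF_norm_le'[OF ab(1)] R[OF ab(1) that] by (rule order_trans)
  ultimately show "hausdorff_dist nrm A B \<le> R"
    unfolding hausdorff_dist_def using ne by (intro max.boundedI cSUP_least)
qed

text \<open>The two images are indexed by the same \<open>K\<close>, so each point has a partner
  within \<open>e\<close>. With two times of the flow for \<open>f\<close> and \<open>f'\<close>,
  this makes the distance Lipschitz in time.\<close>

lemma hausdorff_dist_perturb:
  assumes R: "\<And>x y. x \<in> f ` K \<Longrightarrow> y \<in> B \<Longrightarrow> nrm (x - y) \<le> R"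
      "\<And>x y. x \<in> f' ` K \<Longrightarrow> y \<in> B \<Longrightarrow> nrm (x - y) \<le> R"
    and ne: "K \<noteq> {}" "B \<noteq> {}" and e: "\<And>a. a \<in> K \<Longrightarrow> nrm (f a - f' a) \<le> e"
  shows "hausdorff_dist nrm (f ` K) B \<le> hausdorff_dist nrm (f' ` K) B + e"
proof -
  have ne': "f ` K \<noteq> {}" "f' ` K \<noteq> {}" using ne by auto
  note bdd = hausdorff_bdd_above[OF R(2) ne'(2) ne(2)]
  have "(INF y\<in>B. nrm (x - y)) \<le> hausdorff_dist nrm (f' ` K) B + e" if x: "x \<in> f ` K" for x
  proof -
    obtain a where a: "a \<in> K" "x = f a" using x by blast
    have "(INF y\<in>B. nrm (x - y)) \<le> (INF y\<in>B. nrm (f' a - y)) + e"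
      unfolding a by (rule INF_norm_shift[OF ne(2) e[OF a(1)]])
    also have "(INF y\<in>B. nrm (f' a - y)) \<le> (SUP x\<in>f' ` K. INF y\<in>B. nrm (x - y))"
      using a by (intro cSUP_upper bdd) auto
    finally show ?thesis by (simp add: hausdorff_dist_def)
  qed
  moreover have "(INF x\<in>f ` K. nrm (x - y)) \<le> hausdorff_dist nrm (f' ` K) B + e" if "y \<in> B" for y
  proof -
    have "(INF x\<in>f ` K. nrm (x - y)) - e \<le> (INF x\<in>f' ` K. nrm (x - y))"
    proof (rule cINF_greatest[OF ne'(2)])
      fix x assume "x \<in> f' ` K"
      then obtain a where a: "a \<in> K" "x = f' a" by auto
      show "(INF x\<in>f ` K. nrm (x - y)) - e \<le> nrm (x - y)"
        using INF_norm_le'[of "f a" "f ` K" y] a e[OF a(1)] is_norm_triangle3[OF n, of "f a" y "f' a"]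
        by auto
    qed
    also have "\<dots> \<le> (SUP y\<in>B. INF x\<in>f' ` K. nrm (x - y))" using that by (intro cSUP_upper bdd)
    finally show ?thesis by (simp add: hausdorff_dist_def)
  qed
  ultimately show ?thesis
    unfolding hausdorff_dist_def[of nrm "f ` K"] using ne ne' by (intro max.boundedI cSUP_least)
qed

lemma hausdorff_dist_nearest:
  assumes R: "\<And>x y. x \<in> A \<Longrightarrow> y \<in> B \<Longrightarrow> nrm (x - y) \<le> R" and A: "compact A" "A \<noteq> {}" and y: "y \<in> B"
  obtains x where "x \<in> A" "nrm (x - y) \<le> hausdorff_dist nrm A B"
proof -
  have "continuous_on A (\<lambda>x. nrm (x - y))"
    by (intro continuous_on_compose2[OF is_norm_continuous[OF n, of UNIV]] continuous_intros) auto
  then obtain x where x: "x \<in> A" "\<And>z. z \<in> A \<Longrightarrow> nrm (x - y) \<le> nrm (z - y)"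
    using continuous_attains_inf[OF A] by metis
  have "nrm (x - y) \<le> (INF x\<in>A. nrm (x - y))" by (rule cINF_greatest[OF A(2) x(2)])
  also have "\<dots> \<le> (SUP y\<in>B. INF x\<in>A. nrm (x - y))"
    using y by (intro cSUP_upper hausdorff_bdd_above(2)[OF R A(2)]) auto
  also have "\<dots> \<le> hausdorff_dist nrm A B" by (simp add: hausdorff_dist_def)
  finally show thesis using that x(1) by blast
qed

end

text \<open>For negative \<open>s\<close> the ceiling of the modulus is constant on intervals closed
  at the left end, so the left endpoint, a grid time, belongs to the piece with \<open>m\<close>
  backward steps.\<close>

lemma \<xi>_steps_piece:
  assumes "\<tau> n > 0" "m \<ge> 1" "- (real m * \<tau> n) \<le> s" "s < - (real (m - 1) * \<tau> n)"
  shows "\<xi>_steps \<tau> n s = - int m"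
proof -
  have "s < 0"
  proof -
    have "0 \<le> real (m - 1) * \<tau> n" using assms(1) by simp
    then show ?thesis using assms(4) by linarith
  qed
  moreover have "\<lceil>\<bar>s\<bar> / \<tau> n\<rceil> = int m"
  proof (rule ceiling_unique)
    show "real_of_int (int m) - 1 < \<bar>s\<bar> / \<tau> n" "\<bar>s\<bar> / \<tau> n \<le> real_of_int (int m)"
      using assms \<open>s < 0\<close> by (simp_all add: field_simps of_nat_diff)
  qed
  ultimately show ?thesis by (simp add: \<xi>_steps_def)
qed

section \<open>The flow, its invariant measure and neighbourhoods\<close>

locale measure_flow =
  fixes nrm :: "'a::euclidean_space \<Rightarrow> real" and X :: "'a set" and S :: "real \<Rightarrow> 'a \<Rightarrow> 'a"
    and \<mu> :: "'a measure"
  assumes norm_nrm: "is_norm nrm" and compact_X: "compact X" and flow: "lipschitz_flow nrm X S"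
    and adm: "admissible_measure X S \<mu>"
begin

sublocale finite_measure \<mu>
  using adm by (simp add: admissible_measure_def)

lemma sets_\<mu>: "sets \<mu> = sets (restrict_space borel X)"
  using adm by (simp add: admissible_measure_def)

lemma space_\<mu>: "space \<mu> = X"
  using sets_eq_imp_space_eq[OF sets_\<mu>] by (simp add: space_restrict_space)

lemma X_borel: "X \<in> sets borel"
  using compact_X by (simp add: borel_compact)

lemma in_sets_\<mu>: "B \<in> sets \<mu> \<longleftrightarrow> B \<in> sets borel \<and> B \<subseteq> X"
  unfolding sets_\<mu> using X_borel by (subst sets_restrict_space_iff) auto

lemma compact_in_sets: "compact A \<Longrightarrow> A \<subseteq> X \<Longrightarrow> A \<in> sets \<mu>"
  by (simp add: in_sets_\<mu> borel_compact)

lemma X_pos: "measure \<mu> X > 0" "X \<noteq> {}"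
proof -
  have "emeasure \<mu> X \<noteq> 0" using adm by (simp add: admissible_measure_def)
  then show "X \<noteq> {}" "measure \<mu> X > 0" by (auto simp: emeasure_eq_measure less_le)
qed

lemma S_in: "x \<in> X \<Longrightarrow> S t x \<in> X"
  and S_S: "x \<in> X \<Longrightarrow> S t (S s x) = S (t + s) x"
  and S_0: "x \<in> X \<Longrightarrow> S 0 x = x"
  using flow by (auto simp: lipschitz_flow_def is_flow_def)

lemma S_inv: "x \<in> X \<Longrightarrow> S t (S (- t) x) = x" "x \<in> X \<Longrightarrow> S (- t) (S t x) = x"
  by (simp_all add: S_S S_0)

lemma measure_S: "B \<in> sets \<mu> \<Longrightarrow> measure \<mu> (S t ` B) = measure \<mu> B"
  using adm by (simp add: admissible_measure_def measure_def)

lemma S_lipschitz: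
  assumes "t > 0"
  obtains L where "L > 0" "\<And>r s x y. \<bar>r\<bar> \<le> t \<Longrightarrow> \<bar>s\<bar> \<le> t \<Longrightarrow> x \<in> X \<Longrightarrow> y \<in> X \<Longrightarrow>
    nrm (S r x - S s y) \<le> L * (\<bar>r - s\<bar> + nrm (x - y))"
proof -
  obtain L where L: "\<forall>s\<in>{-t..t}. \<forall>r\<in>{-t..t}. \<forall>x\<in>X. \<forall>y\<in>X.
        nrm (S s x - S r y) \<le> L * (\<bar>s - r\<bar> + nrm (x - y))"
    using flow assms unfolding lipschitz_flow_def by blast
  show thesis
  proof
    \<comment> \<open>The constant supplied by \<open>lipschitz_flow\<close> has no prescribed
      sign.\<close>
    show "\<bar>L\<bar> + 1 > 0" by simp
    fix r s x y assume a: "\<bar>r\<bar> \<le> t" "\<bar>s\<bar> \<le> t" "x \<in> X" "y \<in> X"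
    then have "nrm (S r x - S s y) \<le> L * (\<bar>r - s\<bar> + nrm (x - y))" using L by (simp add: abs_le_iff)
    also have "\<dots> \<le> (\<bar>L\<bar> + 1) * (\<bar>r - s\<bar> + nrm (x - y))"
      using is_norm_nonneg[OF norm_nrm, of "x - y"] by (intro mult_right_mono) auto
    finally show "nrm (S r x - S s y) \<le> (\<bar>L\<bar> + 1) * (\<bar>r - s\<bar> + nrm (x - y))" .
  qed
qed

lemma S_continuous: "continuous_on X (S t)"
proof -
  \<comment> \<open>The Lipschitz hypothesis is stated on symmetric intervals of positive length;
    \<open>\<bar>t\<bar> + 1\<close> covers \<open>t = 0\<close>. The two norm comparisons then
    translate it into the Euclidean metric.\<close>
  obtain L where L: "L > 0" "\<And>r s x y. \<bar>r\<bar> \<le> \<bar>t\<bar> + 1 \<Longrightarrow> \<bar>s\<bar> \<le> \<bar>t\<bar> + 1 \<Longrightarrow> x \<in> X \<Longrightarrow> y \<in> X \<Longrightarrow>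
    nrm (S r x - S s y) \<le> L * (\<bar>r - s\<bar> + nrm (x - y))"
    using S_lipschitz[of "\<bar>t\<bar> + 1"] by (metis abs_ge_zero add_nonneg_pos zero_less_one)
  obtain C where C: "\<And>x. nrm x \<le> C * norm x" using is_norm_upper[OF norm_nrm] by blast
  obtain c where c: "c > 0" "\<And>x. c * norm x \<le> nrm x" using is_norm_lower[OF norm_nrm] by blast
  have "dist (S t x) (S t y) \<le> (L * \<bar>C\<bar> / c) * dist x y" if "x \<in> X" "y \<in> X" for x y
  proof -
    have "c * norm (S t x - S t y) \<le> nrm (S t x - S t y)" by (rule c)
    also have "\<dots> \<le> L * nrm (x - y)" using L(2)[of t t x y] that by simp
    also have "\<dots> \<le> L * (C * norm (x - y))" using L C by simp
    also have "\<dots> \<le> L * (\<bar>C\<bar> * norm (x - y))" using L by (intro mult_left_mono mult_right_mono) auto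
    finally show ?thesis using c by (simp add: dist_norm field_simps)
  qed
  then have "(L * \<bar>C\<bar> / c)-lipschitz_on X (S t)" using L c by (intro lipschitz_onI) auto
  then show ?thesis by (rule lipschitz_on_continuous_on)
qed

lemma compact_S: "compact A \<Longrightarrow> A \<subseteq> X \<Longrightarrow> compact (S t ` A)" "A \<subseteq> X \<Longrightarrow> S t ` A \<subseteq> X"
  by (auto intro: compact_continuous_image continuous_on_subset[OF S_continuous] S_in)

lemma X_nrm_bounded: obtains R where "\<And>x y. x \<in> X \<Longrightarrow> y \<in> X \<Longrightarrow> nrm (x - y) \<le> R"
proof -
  have "compact ((\<lambda>z. nrm (fst z - snd z)) ` (X \<times> X))"
    by (intro compact_continuous_image compact_Times compact_X
        continuous_on_compose2[OF is_norm_continuous[OF norm_nrm, of UNIV]] continuous_intros) auto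
  then have "bdd_above ((\<lambda>z. nrm (fst z - snd z)) ` (X \<times> X))"
    by (intro bounded_imp_bdd_above compact_imp_bounded)
  then obtain R where "\<forall>w\<in>(\<lambda>z. nrm (fst z - snd z)) ` (X \<times> X). w \<le> R" unfolding bdd_above_def by blast
  then have "nrm (x - y) \<le> R" if "x \<in> X" "y \<in> X" for x y using that by force
  then show thesis by (rule that)
qed

text \<open>On the piece \<open>[-m\<tau>, -(m-1)\<tau>)\<close> the discrete set does not change, and the Hausdorff distance to
  it varies by at most \<open>L\<tau>\<close>; so the integral controls the sum over the left endpoints.\<close>

lemma hausdorff_sum_le_integral:
  assumes A: "A \<subseteq> X" "A \<noteq> {}" and B: "\<And>k. B k \<subseteq> X" "\<And>k. B k \<noteq> {}"
    and \<tau>: "\<tau> i > 0" and N: "real N * \<tau> i < t"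
    and L: "\<And>r s x y. \<bar>r\<bar> \<le> t \<Longrightarrow> \<bar>s\<bar> \<le> t \<Longrightarrow> x \<in> X \<Longrightarrow> y \<in> X \<Longrightarrow>
      nrm (S r x - S s y) \<le> L * (\<bar>r - s\<bar> + nrm (x - y))" "L > 0"
  shows "\<tau> i * (\<Sum>m=1..N. hausdorff_dist nrm (S (- (real m * \<tau> i)) ` A) (B (- int m))) \<le>
    (LBINT s=ereal (- t)..ereal t. hausdorff_dist nrm (S s ` A) (B (\<xi>_steps \<tau> i s))) + L * \<tau> i * t"
proof -
  define h where "h s k = hausdorff_dist nrm (S s ` A) (B k)" for s k
  obtain R where R: "\<And>x y. x \<in> X \<Longrightarrow> y \<in> X \<Longrightarrow> nrm (x - y) \<le> R" using X_nrm_bounded by blast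
  have t: "t > 0" using N \<tau> by (meson le_less_trans less_imp_le mult_nonneg_nonneg of_nat_0_le_iff)
  have R': "nrm (x - y) \<le> R" if "x \<in> S s ` A" "y \<in> B k" for s k x y
    using R that A(1) B(1) compact_S(2) by blast
  have h_bounds: "0 \<le> h s k" "h s k \<le> R" for s k
    using hausdorff_dist_bounds[OF norm_nrm R'[of _ s _ k]] A B unfolding h_def by auto
  have h_lip: "h r k \<le> h s k + L * \<bar>r - s\<bar>" if "\<bar>r\<bar> \<le> t" "\<bar>s\<bar> \<le> t" for r s k
    unfolding h_def
  proof (rule hausdorff_dist_perturb[OF norm_nrm R' R' A(2) B(2)])
    fix a assume "a \<in> A"
    then show "nrm (S r a - S s a) \<le> L * \<bar>r - s\<bar>"
      using L(1)[OF that, of a a] A(1) is_norm_eq_0[OF norm_nrm, of 0] by auto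
  qed auto
  have h_cont: "continuous_on {-t..t} (\<lambda>s. h s k)" for k
  proof (rule lipschitz_on_continuous_on[of L], rule lipschitz_onI)
    fix r s assume "r \<in> {-t..t}" "s \<in> {-t..t}"
    then have "h r k \<le> h s k + L * \<bar>r - s\<bar>" "h s k \<le> h r k + L * \<bar>s - r\<bar>"
      by (auto intro!: h_lip simp: abs_le_iff)
    then show "dist (h r k) (h s k) \<le> L * dist r s" by (auto simp: dist_real_def abs_minus_commute)
  qed (use L in simp)
  \<comment> \<open>\<open>LBINT\<close> between extended reals integrates over the open interval,
    hence this indicator.\<close>
  define H where "H s = indicator {-t<..<t} s *\<^sub>R h s (\<xi>_steps \<tau> i s)" for s
  have xi_meas: "\<xi>_steps \<tau> i \<in> measurable borel (count_space UNIV)"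
    unfolding \<xi>_steps_def[abs_def] by measurable
  \<comment> \<open>For each fixed \<open>k\<close> the integrand is continuous on a closed
    interval, and the step count takes countably many values; together this gives
    measurability.\<close>
  have "(\<lambda>s. indicator {-t..t} s *\<^sub>R h s (\<xi>_steps \<tau> i s)) \<in> borel_measurable borel"
    by (rule measurable_compose_countable[OF _ xi_meas], rule borel_measurable_continuous_on_indicator)
       (auto intro: h_cont)
  then have "(\<lambda>s. indicator {-t<..<t} s *\<^sub>R (indicator {-t..t} s *\<^sub>R h s (\<xi>_steps \<tau> i s))) \<in> borel_measurable borel"
    by measurable
  also have "(\<lambda>s. indicator {-t<..<t} s *\<^sub>R (indicator {-t..t} s *\<^sub>R h s (\<xi>_steps \<tau> i s))) = H"
    by (auto simp: H_def indicator_def)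
  finally have [measurable]: "H \<in> borel_measurable borel" .
  have H_int: "integrable lborel H"
  proof (rule Bochner_Integration.integrable_bound[of _ "\<lambda>s. R * indicator {-t<..<t} s"])
    show "AE x in lborel. norm (H x) \<le> norm (R * indicator {- t<..<t} x)"
      using h_bounds by (auto simp: H_def indicator_def intro!: AE_I2 order_trans[OF _ abs_ge_self])
    show "integrable lborel (\<lambda>s. R * indicator {-t<..<t} s)"
      using t by (intro integrable_mult_right integrable_real_indicator) auto
  qed simp
  have H_eq: "(LBINT s=ereal (- t)..ereal t. h s (\<xi>_steps \<tau> i s)) = (LINT s|lborel. H s)"
    using t by (simp add: interval_lebesgue_integral_def set_lebesgue_integral_def H_def)
  define J where "J m = {- (real m * \<tau> i)..< - (real (m - 1) * \<tau> i)}" for m :: nat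
  define c where "c m = h (- (real m * \<tau> i)) (- int m) - L * \<tau> i" for m :: nat
  have mN: "real m * \<tau> i < t" if "m \<in> {1..N}" for m
  proof -
    have "real m * \<tau> i \<le> real N * \<tau> i" using that \<tau> by (intro mult_right_mono) auto
    then show ?thesis using N by simp
  qed
  \<comment> \<open>A step function minorises the integrand: on the \<open>m\<close>-th piece it is
    the value at the left endpoint less the Lipschitz loss, elsewhere 0. The strict bound on
    \<open>N\<close> keeps every piece inside the open interval.\<close>
  have le: "(\<Sum>m=1..N. c m * indicator (J m) s) \<le> H s" for s
  proof (cases "\<exists>m\<in>{1..N}. s \<in> J m")
    case True
    then obtain m where m: "m \<in> {1..N}" "s \<in> J m" by blast
    have xi: "\<xi>_steps \<tau> i s = - int m'" if "m' \<in> {1..N}" "s \<in> J m'" for m'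
      using \<xi>_steps_piece[of \<tau> i m' s] \<tau> that by (auto simp: J_def)
    have "(\<Sum>m'=1..N. c m' * indicator (J m') s) = (\<Sum>m'=1..N. if m = m' then c m' else 0)"
    proof (intro sum.cong refl)
      fix m' assume m': "m' \<in> {1..N}"
      have "s \<in> J m' \<longleftrightarrow> m = m'" using xi[OF m] xi[OF m'] m(2) by auto
      then show "c m' * indicator (J m') s = (if m = m' then c m' else 0)" by (simp add: indicator_def)
    qed
    also have "\<dots> = c m" using m by simp
    also have "\<dots> \<le> H s"
    proof -
      have "0 \<le> real (m - 1) * \<tau> i" using \<tau> by simp
      then have s: "- t < s" "s < t" using m(2) mN[OF m(1)] t unfolding J_def by auto
      have "\<bar>- (real m * \<tau> i) - s\<bar> \<le> \<tau> i"
        using m unfolding J_def by (auto simp: of_nat_diff algebra_simps)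
      then have "L * \<bar>- (real m * \<tau> i) - s\<bar> \<le> L * \<tau> i" using L by simp
      moreover have "h (- (real m * \<tau> i)) (- int m) \<le> h s (- int m) + L * \<bar>- (real m * \<tau> i) - s\<bar>"
        using s mN[OF m(1)] \<tau> by (intro h_lip) auto
      ultimately show ?thesis using s by (simp add: c_def H_def xi[OF m])
    qed
    finally show ?thesis .
  next
    case False
    then have "(\<Sum>m=1..N. c m * indicator (J m) s) = 0" by (intro sum.neutral) auto
    also have "0 \<le> H s" using h_bounds by (simp add: H_def)
    finally show ?thesis .
  qed
  have J: "measure lborel (J m) = \<tau> i" "J m \<in> sets lborel" "emeasure lborel (J m) < \<infinity>"
    if "m \<in> {1..N}" for m
    using that \<tau> by (auto simp: J_def of_nat_diff algebra_simps)
  have "(\<Sum>m=1..N. c m * \<tau> i) = (\<Sum>m=1..N. LINT s|lborel. c m * indicator (J m) s)"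
    using J by (intro sum.cong refl) simp
  also have "\<dots> = (LINT s|lborel. (\<Sum>m=1..N. c m * indicator (J m) s))"
    using J by (intro Bochner_Integration.integral_sum[symmetric]) auto
  also have "\<dots> \<le> (LINT s|lborel. H s)"
    using J by (intro integral_mono H_int le Bochner_Integration.integrable_sum) auto
  finally have "(\<Sum>m=1..N. c m * \<tau> i) \<le> (LINT s|lborel. H s)" .
  moreover have "(\<Sum>m=1..N. c m * \<tau> i) = \<tau> i * (\<Sum>m=1..N. h (- (real m * \<tau> i)) (- int m)) - L * \<tau> i * (real N * \<tau> i)"
    unfolding c_def by (simp add: sum_distrib_left sum_subtractf algebra_simps)
  moreover have "L * \<tau> i * (real N * \<tau> i) \<le> L * \<tau> i * t" using L \<tau> N by (intro mult_left_mono) auto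
  ultimately show ?thesis unfolding H_eq[symmetric] h_def by linarith
qed

text \<open>The weak inequality makes the neighbourhood of a compact set compact, hence measurable,
  and so are its images under the flow.\<close>

definition nhd :: "real \<Rightarrow> 'a set \<Rightarrow> 'a set" where
  "nhd r A = {y \<in> X. \<exists>a\<in>A. nrm (a - y) \<le> r}"

lemma nhd_subset: "nhd r A \<subseteq> X"
  by (auto simp: nhd_def)

lemma compact_nhd:
  assumes A: "compact A" "A \<subseteq> X" shows "compact (nhd r A)"
proof -
  have "nhd r A = snd ` ((A \<times> X) \<inter> (\<lambda>z. nrm (fst z - snd z)) -` {..r})"
    unfolding nhd_def by force
  moreover have "compact ((A \<times> X) \<inter> (\<lambda>z. nrm (fst z - snd z)) -` {..r})"
    by (intro compact_Int_closed compact_Times A compact_X continuous_closed_vimage closed_atMost)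
       (auto intro!: continuous_on_interior[of UNIV] continuous_on_compose2[OF is_norm_continuous[OF norm_nrm, of UNIV]] continuous_intros)
  ultimately show ?thesis
    by (simp add: compact_continuous_image continuous_on_snd)
qed

lemma nhd_sets: "compact A \<Longrightarrow> A \<subseteq> X \<Longrightarrow> nhd r A \<in> sets \<mu>"
  by (intro compact_in_sets compact_nhd nhd_subset)

text \<open>Continuity from above along the radii \<open>1 / Suc k\<close>: a point in all these
  neighbourhoods has distance 0 from its nearest point in \<open>A\<close>, which exists by
  compactness.\<close>

lemma nhd_measure:
  assumes A: "compact A" "A \<subseteq> X" and e: "e > 0"
  obtains r where "r > 0" "\<And>r'. r' \<le> r \<Longrightarrow> measure \<mu> (nhd r' A) \<le> measure \<mu> A + e"
proof -
  define N where "N k = nhd (1 / real (Suc k)) A" for k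
  have dec: "decseq N"
    unfolding decseq_def N_def nhd_def by (fastforce simp: frac_le intro: order_trans)
  have "(\<Inter>k. N k) = A"
  proof (intro equalityI subsetI)
    fix y assume y: "y \<in> (\<Inter>k. N k)"
    then have yX: "y \<in> X" and ne: "A \<noteq> {}" by (auto simp: N_def nhd_def)
    have "continuous_on A (\<lambda>x. nrm (x - y))"
      by (intro continuous_on_compose2[OF is_norm_continuous[OF norm_nrm, of UNIV]] continuous_intros) auto
    then obtain x where x: "x \<in> A" "\<And>z. z \<in> A \<Longrightarrow> nrm (x - y) \<le> nrm (z - y)"
      using continuous_attains_inf[OF A(1) ne] by metis
    have "nrm (x - y) \<le> 1 / real (Suc k)" for k
    proof -
      obtain a where "a \<in> A" "nrm (a - y) \<le> 1 / real (Suc k)" using y by (auto simp: N_def nhd_def)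
      then show ?thesis using x(2)[of a] by simp
    qed
    then have "nrm (x - y) \<le> 0"
      by (intro LIMSEQ_le_const[OF LIMSEQ_inverse_real_of_nat]) (auto simp: inverse_eq_divide)
    then have "x = y" using is_norm_nonneg[OF norm_nrm, of "x - y"] is_norm_eq_0[OF norm_nrm, of "x - y"] by simp
    then show "y \<in> A" using x by simp
  next
    fix y assume "y \<in> A"
    then show "y \<in> (\<Inter>k. N k)"
      using A is_norm_eq_0[OF norm_nrm, of 0] by (auto simp: N_def nhd_def intro!: bexI[of _ y])
  qed
  moreover have "(\<lambda>k. measure \<mu> (N k)) \<longlonglongrightarrow> measure \<mu> (\<Inter>k. N k)"
    by (rule finite_Lim_measure_decseq[OF _ dec]) (auto simp: N_def nhd_sets[OF A])
  ultimately have "(\<lambda>k. measure \<mu> (N k)) \<longlonglongrightarrow> measure \<mu> A" by simp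
  from order_tendstoD(2)[OF this, of "measure \<mu> A + e"] e
  obtain k where k: "measure \<mu> (N k) < measure \<mu> A + e" by (auto simp: eventually_sequentially)
  show thesis
  proof
    show "1 / real (Suc k) > 0" by simp
    fix r' assume "r' \<le> 1 / real (Suc k)"
    then have "nhd r' A \<subseteq> N k" unfolding N_def nhd_def by (blast intro: order_trans)
    then have "measure \<mu> (nhd r' A) \<le> measure \<mu> (N k)"
      by (intro finite_measure_mono) (auto simp: N_def nhd_sets[OF A])
    then show "measure \<mu> (nhd r' A) \<le> measure \<mu> A + e" using k by simp
  qed
qed

end

section \<open>Indicators of compact sets\<close>

lemma (in finite_measure) L2_norm_indicator_diff:
  assumes [measurable]: "A \<in> sets M" "B \<in> sets M"
  shows "L2_dist M (indicator A) (indicator B) = sqrt (measure M (A - B) + measure M (B - A))"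
proof -
  have "(\<lambda>x. (cmod (indicator A x - indicator B x))\<^sup>2) = (\<lambda>x. indicator (A - B) x + indicator (B - A) x)"
    by (auto simp: indicator_def)
  then show ?thesis
    by (simp add: L2_norm_def emeasure_finite less_top[symmetric])
qed

context measure_flow
begin

text \<open>Invertibility turns a preimage at time \<open>t\<close> into an image at time
  \<open>- t\<close>; this is where sets start to move in negative time.\<close>

lemma indicator_S:
  assumes "A \<subseteq> X" "x \<in> X" shows "indicator A (S t x) = indicator (S (- t) ` A) x"
proof -
  have "S t x \<in> A \<longleftrightarrow> x \<in> S (- t) ` A"
  proof
    assume "S t x \<in> A"
    then show "x \<in> S (- t) ` A" using S_inv(2)[OF assms(2), of t] by (intro image_eqI[of _ _ "S t x"]) auto
  next
    assume "x \<in> S (- t) ` A"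
    then obtain a where "a \<in> A" "x = S (- t) a" by blast
    then show "S t x \<in> A" using S_inv(1)[of a t] assms(1) by auto
  qed
  then show ?thesis by (simp add: indicator_def)
qed

text \<open>Pushing \<open>\<mu>\<close> forward along the inclusion of \<open>X\<close> gives a
  finite Borel measure on the whole space, to which inner regularity by compact sets
  applies.\<close>

lemma inner_regular_\<mu>:
  assumes B: "B \<in> sets \<mu>" and e: "e > 0"
  obtains K where "compact K" "K \<subseteq> B" "measure \<mu> (B - K) \<le> e"
proof -
  define N where "N = distr \<mu> borel (\<lambda>x. x)"
  have m: "(\<lambda>x. x) \<in> measurable \<mu> borel"
  proof (rule measurableI)
    fix A :: "'a set" assume "A \<in> sets borel"
    then show "(\<lambda>x. x) -` A \<inter> space \<mu> \<in> sets \<mu>"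
      by (auto simp: space_\<mu> in_sets_\<mu> X_borel)
  qed auto
  have N: "emeasure N A = emeasure \<mu> A" if "A \<in> sets \<mu>" for A
  proof -
    have A: "A \<in> sets borel" "A \<inter> X = A" using that by (auto simp: in_sets_\<mu>)
    then show ?thesis unfolding N_def by (subst emeasure_distr[OF m]) (auto simp: space_\<mu>)
  qed
  have Bb: "B \<in> sets borel" "B \<subseteq> X" using B by (auto simp: in_sets_\<mu>)
  have fin: "emeasure N (space N) \<noteq> \<infinity>"
    unfolding N_def by (subst emeasure_distr[OF m]) (auto simp: emeasure_finite)
  have "emeasure \<mu> B = (SUP K \<in> {K. K \<subseteq> B \<and> compact K}. emeasure N K)"
    using inner_regular[OF _ fin Bb(1)] N[OF B] by (simp add: N_def)
  also have "\<dots> = (SUP K \<in> {K. K \<subseteq> B \<and> compact K}. emeasure \<mu> K)"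
    using Bb by (intro SUP_cong refl N compact_in_sets) auto
  finally have sup: "emeasure \<mu> B = (SUP K \<in> {K. K \<subseteq> B \<and> compact K}. emeasure \<mu> K)" .
  have "\<exists>K\<in>{K. K \<subseteq> B \<and> compact K}. emeasure \<mu> B < emeasure \<mu> K + ennreal e"
  proof (rule SUP_approx_ennreal[OF _ _ sup])
    show "{K. K \<subseteq> B \<and> compact K} \<noteq> {}" by auto
  qed (use e in \<open>auto simp: emeasure_finite\<close>)
  then obtain K where K: "K \<subseteq> B" "compact K" "emeasure \<mu> B < emeasure \<mu> K + ennreal e" by auto
  have Ks: "K \<in> sets \<mu>" using K Bb by (intro compact_in_sets) auto
  have "measure \<mu> B \<le> measure \<mu> K + e"
    using K(3) e by (simp add: emeasure_eq_measure ennreal_plus[symmetric] ennreal_less_iff del: ennreal_plus)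
  then have "measure \<mu> (B - K) \<le> e" using finite_measure_Diff[OF B Ks K(1)] by simp
  with K that show thesis by blast
qed

text \<open>Indicators of compact sets span a dense subspace.\<close>

lemma L2_compact_induct [consumes 1, case_names compact add limit]:
  assumes g: "g \<in> L2 \<mu>"
    and compact: "\<And>K. compact K \<Longrightarrow> K \<subseteq> X \<Longrightarrow> Q (indicator K :: 'a \<Rightarrow> complex)"
    and lin: "\<And>a f h. f \<in> L2 \<mu> \<Longrightarrow> h \<in> L2 \<mu> \<Longrightarrow> Q f \<Longrightarrow> Q h \<Longrightarrow> Q (\<lambda>x. f x + a * h x)"
    and lim: "\<And>f. f \<in> L2 \<mu> \<Longrightarrow>
      (\<And>e. e > 0 \<Longrightarrow> \<exists>h\<in>L2 \<mu>. Q h \<and> L2_dist \<mu> f h \<le> e) \<Longrightarrow> Q f"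
  shows "Q g"
proof -
  have ind: "Q (indicator B)" if B: "B \<in> sets \<mu>" for B
  proof (rule lim[OF L2_indicator[OF B]])
    fix e :: real assume e: "e > 0"
    then obtain K where K: "compact K" "K \<subseteq> B" "measure \<mu> (B - K) \<le> e\<^sup>2"
      using inner_regular_\<mu>[OF B, of "e\<^sup>2"] by auto
    have KX: "K \<subseteq> X" using K B by (auto simp: in_sets_\<mu>)
    note Ks = compact_in_sets[OF K(1) KX]
    have "measure \<mu> (K - B) = 0" using K by (metis Diff_eq_empty_iff measure_empty)
    then have "L2_dist \<mu> (indicator B) (indicator K) = sqrt (measure \<mu> (B - K))"
      using L2_norm_indicator_diff[OF B Ks] by simp
    also have "\<dots> \<le> e" using K(3) e real_sqrt_le_mono by fastforce
    finally show "\<exists>h\<in>L2 \<mu>. Q h \<and> L2_dist \<mu> (indicator B) h \<le> e"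
      using compact[OF K(1) KX] L2_indicator[OF Ks] by blast
  qed
  have zero: "Q (\<lambda>x. 0)" using ind[of "{}"] by (simp add: indicator_def[abs_def])
  have simple: "Q f" if f: "simple_function \<mu> f" for f
  proof -
    have fin: "finite (f ` X)" and fs: "f -` {c} \<inter> X \<in> sets \<mu>" if "c \<in> f ` X" for c
      using f that by (auto simp: simple_function_def space_\<mu>)
    have L: "(\<lambda>x. \<Sum>c\<in>I. c * indicator (f -` {c} \<inter> X) x) \<in> L2 \<mu> \<and>
        Q (\<lambda>x. \<Sum>c\<in>I. c * indicator (f -` {c} \<inter> X) x)" if "finite I" "I \<subseteq> f ` X" for I
      using that
    proof (induction I)
      case empty then show ?case using zero by simp
    next
      case (insert c I)
      have c: "f -` {c} \<inter> X \<in> sets \<mu>" using insert fs by auto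
      have IH: "(\<lambda>x. \<Sum>c\<in>I. c * indicator (f -` {c} \<inter> X) x) \<in> L2 \<mu>"
        "Q (\<lambda>x. \<Sum>c\<in>I. c * indicator (f -` {c} \<inter> X) x)" using insert by auto
      have "(\<lambda>x. \<Sum>c\<in>insert c I. c * indicator (f -` {c} \<inter> X) x) =
          (\<lambda>x. (\<Sum>c\<in>I. c * indicator (f -` {c} \<inter> X) x) + c * indicator (f -` {c} \<inter> X) x)"
        by (simp only: sum.insert[OF insert.hyps] add.commute)
      then show ?case
        using lin[OF IH(1) L2_indicator[OF c] IH(2) ind[OF c], of c]
          L2_add[OF IH(1) L2_scale[OF L2_indicator[OF c]], of c]
        by (simp only: simp_thms)
    qed
    have finX: "finite (f ` X)" using f by (simp add: simple_function_def space_\<mu>)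
    have eq: "f x = (\<Sum>c\<in>f ` X. c * indicator (f -` {c} \<inter> X) x)" if "x \<in> X" for x
    proof -
      have "(\<Sum>c\<in>f ` X. c * indicator (f -` {c} \<inter> X) x) = (\<Sum>c\<in>f ` X. if f x = c then c else 0)"
        using that by (intro sum.cong) (auto simp: indicator_def)
      then show ?thesis using finX that by simp
    qed
    have fL: "f \<in> L2 \<mu>"
      using L[OF finX order_refl] eq
        L2_cong_space[of \<mu> f "\<lambda>x. \<Sum>c\<in>f ` X. c * indicator (f -` {c} \<inter> X) x", unfolded space_\<mu>]
      by blast
    \<comment> \<open>\<open>f\<close> and its representation agree on \<open>X\<close> only, so
      \<open>Q\<close> is transferred by the limit rule at distance 0 instead of by
      equality.\<close>
    have z: "L2_norm \<mu> (\<lambda>x. f x - (\<Sum>c\<in>f ` X. c * indicator (f -` {c} \<inter> X) x)) = L2_norm \<mu> (\<lambda>x. 0)"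
      by (rule L2_norm_cong_space) (simp add: space_\<mu> eq[symmetric])
    show "Q f"
    proof (rule lim[OF fL])
      fix e :: real assume "e > 0"
      then show "\<exists>h\<in>L2 \<mu>. Q h \<and> L2_dist \<mu> f h \<le> e"
        using L[OF finX order_refl] z by (intro bexI[of _ "\<lambda>x. \<Sum>c\<in>f ` X. c * indicator (f -` {c} \<inter> X) x"]) auto
    qed
  qed
  show ?thesis
  proof (rule lim[OF g])
    fix e :: real assume e: "e > 0"
    note [measurable] = L2_measurable[OF g]
    obtain F where F: "\<And>i. simple_function \<mu> (F i)" "\<And>x. x \<in> space \<mu> \<Longrightarrow> (\<lambda>i. F i x) \<longlonglongrightarrow> g x"
      "\<And>i x. x \<in> space \<mu> \<Longrightarrow> dist (F i x) 0 \<le> 2 * dist (g x) 0"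
      using borel_measurable_implies_sequence_metric[OF L2_measurable[OF g], of 0] by blast
    note [measurable] = borel_measurable_simple_function[OF F(1)]
    \<comment> \<open>The approximants are dominated by twice the modulus of \<open>g\<close>, and 9
      is the square of 1 + 2.\<close>
    have bd: "(cmod (g x - F i x))\<^sup>2 \<le> 9 * (cmod (g x))\<^sup>2" if "x \<in> space \<mu>" for x i
    proof -
      have "cmod (g x - F i x) \<le> cmod (g x) + cmod (F i x)" by (rule norm_triangle_ineq4)
      also have "\<dots> \<le> 3 * cmod (g x)" using F(3)[OF that, of i] by simp
      finally have "(cmod (g x - F i x))\<^sup>2 \<le> (3 * cmod (g x))\<^sup>2" by (intro power_mono) auto
      then show ?thesis by (simp add: power_mult_distrib)
    qed
    have "(\<lambda>i. LINT x|\<mu>. (cmod (g x - F i x))\<^sup>2) \<longlonglongrightarrow> (LINT x|\<mu>. 0)"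
    proof (rule integral_dominated_convergence)
      show "integrable \<mu> (\<lambda>x. 9 * (cmod (g x))\<^sup>2)" using L2_integrable[OF g] by simp
      show "AE x in \<mu>. (\<lambda>i. (cmod (g x - F i x))\<^sup>2) \<longlonglongrightarrow> 0"
      proof (rule AE_I2)
        fix x assume "x \<in> space \<mu>"
        from F(2)[OF this] have "(\<lambda>i. (cmod (g x - F i x))\<^sup>2) \<longlonglongrightarrow> (cmod (g x - g x))\<^sup>2"
          by (intro tendsto_intros)
        then show "(\<lambda>i. (cmod (g x - F i x))\<^sup>2) \<longlonglongrightarrow> 0" by simp
      qed
    qed (use bd in \<open>auto intro!: AE_I2\<close>)
    then have "(\<lambda>i. L2_dist \<mu> g (F i)) \<longlonglongrightarrow> sqrt 0"
      unfolding L2_norm_def by (intro tendsto_real_sqrt) simp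
    from order_tendstoD(2)[OF this, of e] e obtain i where i: "L2_dist \<mu> g (F i) < e"
      by (auto simp: eventually_sequentially)
    have "integrable \<mu> (\<lambda>x. (cmod (g x - F i x))\<^sup>2)"
      by (rule Bochner_Integration.integrable_bound[of _ "\<lambda>x. 9 * (cmod (g x))\<^sup>2"])
         (use L2_integrable[OF g] bd in \<open>auto intro!: AE_I2\<close>)
    then have "(\<lambda>x. g x - F i x) \<in> L2 \<mu>" by (simp add: L2_def)
    from L2_diff[OF g this] have "F i \<in> L2 \<mu>" by simp
    then show "\<exists>h\<in>L2 \<mu>. Q h \<and> L2_dist \<mu> g h \<le> e"
      using i simple[OF F(1)] by (intro bexI[of _ "F i"]) auto
  qed
qed

end

section \<open>Discrete images of cell covers\<close>

locale cell_flow = measure_flow nrm X S \<mu> + discrete_spectrum \<mu> C T v \<theta> \<tau>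
  for nrm :: "'a::euclidean_space \<Rightarrow> real" and X S \<mu> C T v \<theta> \<tau> +
  fixes d :: real
  assumes cover: "\<Union>C = X" and diam: "p \<in> C \<Longrightarrow> x \<in> p \<Longrightarrow> y \<in> p \<Longrightarrow> nrm (x - y) \<le> d"
begin

lemma cell_cover_facts:
  assumes "A \<subseteq> X"
  shows "A \<subseteq> cell_cover C A" "cell_cover C A \<subseteq> nhd d A" "cell_cover C A \<in> sets \<mu>"
proof -
  show "A \<subseteq> cell_cover C A" using assms cover unfolding cell_cover_def by blast
  show "cell_cover C A \<subseteq> nhd d A"
  proof
    fix y assume "y \<in> cell_cover C A"
    then obtain p a where p: "p \<in> C" "y \<in> p" "a \<in> p" "a \<in> A" unfolding cell_cover_def by blast
    then show "y \<in> nhd d A" using diam[OF p(1,3,2)] cover by (auto simp: nhd_def)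
  qed
  show "cell_cover C A \<in> sets \<mu>"
    unfolding cell_cover_def using finite_cells cell_sets by (intro sets.finite_Union) auto
qed

lemma cell_image_backward:
  "cell_image C T (- int m) B = \<Union>(backward m ` {p \<in> C. p \<subseteq> B})"
  by (simp add: cell_image_def int_iterate_neg)

text \<open>Hausdorff distances require nonempty sets. An iterate of a cell is again a cell, and
  cells have positive measure.\<close>

lemma cell_image_facts:
  assumes "A \<subseteq> X" "A \<noteq> {}"
  shows "cell_image C T k (cell_cover C A) \<subseteq> X" "cell_image C T k (cell_cover C A) \<noteq> {}"
proof -
  have "bij_betw (int_iterate C T k) C C"
  proof (cases "k \<ge> 0")
    case True
    have "bij_betw (T ^^ m) C C" for m
      using bij_betw_funpow[OF T_bij] .
    then show ?thesis using True by (simp add: int_iterate_def)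
  next
    case False
    then show ?thesis using backward_bij by (simp add: int_iterate_def)
  qed
  then have it: "int_iterate C T k p \<in> C" if "p \<in> C" for p using that bij_betwE by blast
  then show "cell_image C T k (cell_cover C A) \<subseteq> X"
    using cover unfolding cell_image_def by blast
  obtain a where a: "a \<in> A" using assms by auto
  then obtain p where p: "p \<in> C" "a \<in> p" using assms cover by blast
  then have pA: "p \<in> {p \<in> C. p \<subseteq> cell_cover C A}" using a unfolding cell_cover_def by blast
  have "int_iterate C T k p \<noteq> {}"
  proof
    assume "int_iterate C T k p = {}"
    then have "measure \<mu> (space \<mu>) / real (card C) = 0"
      using cell_measure[OF it[OF p(1)]] by simp
    then show False using measure_pos p finite_cells by auto
  qed
  then show "cell_image C T k (cell_cover C A) \<noteq> {}" using pA unfolding cell_image_def by blast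
qed

text \<open>The indicator of the cover has average 1 on the cells inside it and 0 on the others, so
  \<open>U m\<close> just moves the cells of the cover.\<close>

lemma U_cell_cover:
  assumes A: "A \<subseteq> X"
  shows "AE x in \<mu>. U m (indicator (cell_cover C A)) x = indicator (cell_image C T (- int m) (cell_cover C A)) x"
proof -
  let ?A = "cell_cover C A" and ?Q = "{p \<in> C. p \<subseteq> cell_cover C A}"
  have As: "?A \<in> sets \<mu>" by (rule cell_cover_facts[OF A])
  have avg: "cell_average \<mu> C (indicator ?A) p = (if p \<subseteq> ?A then 1 else 0)" if p: "p \<in> C" for p
  proof -
    have card: "card C > 0" using p finite_cells by (auto simp: card_gt_0_iff)
    have "measure \<mu> (p \<inter> ?A) = (if p \<subseteq> ?A then measure \<mu> (space \<mu>) / real (card C) else 0)"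
    proof (cases "p \<subseteq> ?A")
      case True then show ?thesis using cell_measure[OF p] by (simp add: Int_absorb2)
    next
      case False
      \<comment> \<open>A cell meeting \<open>A\<close> would belong to the cover. Hence
        \<open>p\<close> differs from all cells of the cover and overlaps each of them in a null set
        only.\<close>
      then have pA: "p \<inter> A = {}" using p unfolding cell_cover_def by blast
      have "AE x in \<mu>. x \<notin> p \<inter> ?A"
        using AE_cells_disjoint
      proof eventually_elim
        case (elim x)
        then show ?case using p pA unfolding cell_cover_def by blast
      qed
      moreover have "{x \<in> space \<mu>. \<not> x \<notin> p \<inter> ?A} = p \<inter> ?A"
        using sets.sets_into_space[OF As] by blast
      ultimately have "emeasure \<mu> (p \<inter> ?A) = 0"
        using AE_iff_measurable[of "p \<inter> ?A" \<mu> "\<lambda>x. x \<notin> p \<inter> ?A"] As cell_sets[OF p] by blast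
      then have "measure \<mu> (p \<inter> ?A) = 0" by (simp add: measure_def)
      then show ?thesis using False by simp
    qed
    then show ?thesis
      using card measure_pos by (simp add: cell_average_eq inner_indicator[OF cell_sets[OF p] As])
  qed
  have Q: "backward m ` ?Q \<subseteq> C" using backward_in by blast
  have inj: "inj_on (backward m) ?Q" using backward_bij by (auto simp: bij_betw_def inj_on_def)
  have "U m (indicator ?A) x = (\<Sum>p\<in>backward m ` ?Q. indicator p x)" for x
  proof -
    have "U m (indicator ?A) x = (\<Sum>p\<in>C. (if p \<subseteq> ?A then indicator (backward m p) x else 0))"
      unfolding U_eq by (intro sum.cong refl) (simp add: avg)
    also have "\<dots> = (\<Sum>p\<in>?Q. indicator (backward m p) x)"
      using finite_cells by (simp add: sum.inter_filter)
    also have "\<dots> = (\<Sum>p\<in>backward m ` ?Q. indicator p x)"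
      by (simp add: sum.reindex[OF inj])
    finally show ?thesis .
  qed
  then show ?thesis
    using AE_sum_cells[OF Q, where ?'b = complex] unfolding cell_image_backward by simp
qed

text \<open>A permutation keeps the number of cells, and equal cell measures turn this into equality
  of measures.\<close>

lemma cell_image_measure:
  assumes A: "A \<subseteq> X"
  shows "measure \<mu> (cell_image C T (- int m) (cell_cover C A)) = measure \<mu> (cell_cover C A)"
    "cell_image C T (- int m) (cell_cover C A) \<in> sets \<mu>"
proof -
  let ?A = "cell_cover C A" and ?Q = "{p \<in> C. p \<subseteq> cell_cover C A}"
  have Q: "backward m ` ?Q \<subseteq> C" using backward_in by blast
  have inj: "inj_on (backward m) ?Q" using backward_bij by (auto simp: bij_betw_def inj_on_def)
  have "\<Union>?Q = ?A" unfolding cell_cover_def by blast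
  then have "measure \<mu> ?A = real (card ?Q) * (measure \<mu> (space \<mu>) / real (card C))"
    using measure_cell_union[of ?Q] by auto
  then show "measure \<mu> (cell_image C T (- int m) ?A) = measure \<mu> ?A"
    unfolding cell_image_backward measure_cell_union[OF Q] card_image[OF inj] by simp
  show "cell_image C T (- int m) ?A \<in> sets \<mu>"
    unfolding cell_image_backward using Q finite_cells cell_sets
    by (intro sets.finite_Union) auto
qed

lemma U_diff_norm_le:
  assumes "f \<in> L2 \<mu>" "h \<in> L2 \<mu>"
  shows "L2_dist \<mu> (U m f) (U m h) \<le> L2_dist \<mu> f h"
proof -
  have "U m (\<lambda>x. f x - h x) = (\<lambda>x. U m f x - U m h x)"
    using U_add_scale[OF assms, of m "-1"] by auto
  then show ?thesis using U_norm_le[OF L2_diff[OF assms], of m] by simp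
qed

text \<open>The flow preserves \<open>\<mu>\<close> and the discrete map permutes cells of equal measure, so the set
  \<open>B\<close> reached by the cells has at least the measure of \<open>A\<close>, and \<open>B \<subseteq> S\<^sup>s(nhd r A)\<close> bounds both
  halves of the symmetric difference of \<open>B\<close> and \<open>S\<^sup>s(A)\<close>.\<close>

lemma koopman_indicator_diff:
  assumes A: "compact A" "A \<subseteq> X" and r: "r \<ge> 0"
    and B: "cell_image C T (- int m) (cell_cover C A) \<subseteq> S (- t) ` nhd r A"
    and e: "measure \<mu> (nhd r A) \<le> measure \<mu> A + e" and e': "measure \<mu> (nhd d A) \<le> measure \<mu> A + e'"
  shows "L2_norm \<mu> (\<lambda>x. indicator A (S t x) - U m (indicator A) x) \<le> sqrt (2 * e) + sqrt e'"
proof -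
  let ?A = "cell_cover C A"
  define B where "B = cell_image C T (- int m) ?A"
  define D where "D = S (- t) ` A"
  define N where "N = S (- t) ` nhd r A"
  note cov = cell_cover_facts[OF A(2)]
  have As: "A \<in> sets \<mu>" by (rule compact_in_sets[OF A])
  have Ds: "D \<in> sets \<mu>" unfolding D_def using compact_S A by (intro compact_in_sets) auto
  have Ns: "N \<in> sets \<mu>" unfolding N_def
    using compact_S compact_nhd[OF A] nhd_subset by (intro compact_in_sets) auto
  have Bs: "B \<in> sets \<mu>" unfolding B_def by (rule cell_image_measure[OF A(2)])
  have AN: "A \<subseteq> nhd r A"
    using A(2) r is_norm_eq_0[OF norm_nrm, of 0] by (auto simp: nhd_def intro!: bexI[of _ "_"])
  have DN: "D \<subseteq> N" unfolding D_def N_def using AN by (rule image_mono)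
  have BN: "B \<subseteq> N" using B unfolding B_def N_def .
  have muN: "measure \<mu> N \<le> measure \<mu> A + e"
    unfolding N_def using measure_S[OF nhd_sets[OF A]] e by simp
  have muD: "measure \<mu> D = measure \<mu> A" unfolding D_def by (rule measure_S[OF As])
  have muB: "measure \<mu> B \<ge> measure \<mu> A"
    unfolding B_def cell_image_measure[OF A(2)] by (rule finite_measure_mono[OF cov(1,3)])
  have "measure \<mu> (D - B) \<le> measure \<mu> (N - B)" by (rule finite_measure_mono) (use DN Ns Bs in auto)
  also have "\<dots> \<le> e" using finite_measure_Diff[OF Ns Bs BN] muN muB by simp
  finally have DB: "measure \<mu> (D - B) \<le> e" .
  have "measure \<mu> (B - D) \<le> measure \<mu> (N - D)" by (rule finite_measure_mono) (use BN Ns Ds in auto)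
  also have "\<dots> \<le> e" using finite_measure_Diff[OF Ns Ds DN] muN muD by simp
  finally have BD: "measure \<mu> (B - D) \<le> e" .
  \<comment> \<open>The squared distance of two indicators is the measure of the symmetric
    difference, here two halves of at most \<open>e\<close> each.\<close>
  have "L2_norm \<mu> (\<lambda>x. indicator A (S t x) - indicator B x) = L2_dist \<mu> (indicator D) (indicator B)"
  proof (rule L2_norm_cong_space)
    show "indicator A (S t x) - indicator B x = (indicator D x - indicator B x :: complex)"
      if "x \<in> space \<mu>" for x using that A(2) by (simp add: indicator_S D_def space_\<mu>)
  qed
  also have "\<dots> \<le> sqrt (2 * e)"
    unfolding L2_norm_indicator_diff[OF Ds Bs] using DB BD by (intro real_sqrt_le_mono) simp
  finally have 1: "L2_norm \<mu> (\<lambda>x. indicator A (S t x) - indicator B x) \<le> sqrt (2 * e)" .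
  \<comment> \<open>Replacing \<open>A\<close> by its cell cover costs at most
    \<open>sqrt e'\<close>: \<open>U m\<close> is a contraction, and the cover stays in
    \<open>nhd d A\<close>.\<close>
  have 2: "L2_dist \<mu> (indicator B) (U m (indicator A)) \<le> sqrt e'"
  proof -
    have "L2_dist \<mu> (indicator B) (U m (indicator A)) =
        L2_dist \<mu> (U m (indicator ?A)) (U m (indicator A))"
      using U_cell_cover[OF A(2), of m]
      by (intro L2_norm_cong_AE L2_diff U_L2 L2_indicator Bs) (auto simp: B_def)
    also have "\<dots> \<le> L2_dist \<mu> (indicator ?A) (indicator A)"
      by (intro U_diff_norm_le L2_indicator cov As)
    also have "\<dots> = sqrt (measure \<mu> (?A - A) + measure \<mu> (A - ?A))"
      by (rule L2_norm_indicator_diff[OF cov(3) As])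
    also have "\<dots> \<le> sqrt e'"
    proof -
      have "measure \<mu> (A - ?A) = 0" using cov(1) by (metis Diff_eq_empty_iff measure_empty)
      moreover have "measure \<mu> (?A - A) \<le> measure \<mu> (nhd d A - A)"
        by (rule finite_measure_mono) (use cov nhd_sets[OF A] As in auto)
      moreover have "A \<subseteq> nhd d A" using cov by auto
      ultimately show ?thesis
        using finite_measure_Diff[OF nhd_sets[OF A] As] e' by (intro real_sqrt_le_mono) simp
    qed
    finally show ?thesis .
  qed
  have "(\<lambda>x. indicator A (S t x) :: complex) \<in> L2 \<mu>"
  proof -
    have "(\<lambda>x. indicator A (S t x) :: complex) \<in> L2 \<mu> \<longleftrightarrow> (indicator D :: 'a \<Rightarrow> complex) \<in> L2 \<mu>"
      by (rule L2_cong_space) (use A(2) in \<open>simp add: indicator_S D_def space_\<mu>\<close>)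
    then show ?thesis using L2_indicator[OF Ds] by simp
  qed
  from L2_norm_triangle_diff[OF this L2_indicator[OF Bs] U_L2, of m "indicator A"]
  show ?thesis using 1 2 by simp
qed

end

section \<open>Convergence of the discrete evolution in time average\<close>

locale periodic_approximation = measure_flow nrm X S \<mu>
  for nrm :: "'a::euclidean_space \<Rightarrow> real" and X S \<mu> +
  fixes E \<tau> q l P T v \<theta>
  assumes koopman_E: "koopman_spectral_measure S \<mu> E"
    and time_steps: "time_steps \<tau>"
    and partitions: "partition_sequence nrm X \<mu> q l P"
    and T_bij: "\<And>n. n \<ge> 1 \<Longrightarrow> bij_betw (T n) (P n) (P n)"
    and approx: "periodically_approximates nrm X S \<tau> P T"
    and eigen: "\<And>n. n \<ge> 1 \<Longrightarrow> discrete_eigenbasis \<mu> (P n) (T n) (q n) (v n) (\<theta> n)"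
begin

sublocale spectral_measure \<mu> E
  by standard (use koopman_E in \<open>simp add: koopman_spectral_measure_def\<close>)

lemma \<tau>_pos: "i \<ge> 1 \<Longrightarrow> \<tau> i > 0" and \<tau>_0: "\<tau> \<longlonglongrightarrow> 0"
  using time_steps by (auto simp: time_steps_def)

lemma l_0: "l \<longlonglongrightarrow> 0" and card_P: "i \<ge> 1 \<Longrightarrow> card (P i) = q i"
  using partitions by (auto simp: partition_sequence_def)

lemma cell_flow: "i \<ge> 1 \<Longrightarrow> cell_flow nrm X S \<mu> (P i) (T i) (v i) (\<theta> i) (\<tau> i) (l i)"
proof unfold_locales
  assume i: "i \<ge> 1"
  note P = partitions[unfolded partition_sequence_def]
  show "finite (P i)" "\<Union>(P i) = X" using P i by auto
  show "\<And>p. p \<in> P i \<Longrightarrow> p \<in> sets \<mu>" using P i by auto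
  show "\<And>p p'. p \<in> P i \<Longrightarrow> p' \<in> P i \<Longrightarrow> p \<noteq> p' \<Longrightarrow> emeasure \<mu> (p \<inter> p') = 0"
    using P[THEN conjunct2, THEN conjunct1] i by simp
  show "\<And>p. p \<in> P i \<Longrightarrow> measure \<mu> p = measure \<mu> (space \<mu>) / real (card (P i))"
    using P i by (simp add: space_\<mu>)
  show "measure \<mu> (space \<mu>) > 0" using X_pos by (simp add: space_\<mu>)
  show "bij_betw (T i) (P i) (P i)" by (rule T_bij[OF i])
  show "discrete_eigenbasis \<mu> (P i) (T i) (card (P i)) (v i) (\<theta> i)" using eigen[OF i] card_P[OF i] by simp
  show "\<tau> i > 0" by (rule \<tau>_pos[OF i])
  show "\<And>p x y. p \<in> P i \<Longrightarrow> x \<in> p \<Longrightarrow> y \<in> p \<Longrightarrow> nrm (x - y) \<le> l i"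
    using P[THEN conjunct2, THEN conjunct2, THEN conjunct2, THEN conjunct2, THEN conjunct1] i by simp
qed

lemma koopman_HS:
  "g \<in> L2 \<mu> \<Longrightarrow> has_spectral_integral \<mu> E (\<lambda>\<omega>. exp (\<i> * of_real (\<omega> * t))) g (\<lambda>x. g (S t x))"
  using koopman_E unfolding koopman_spectral_measure_def koopman_def comp_def by blast

lemma koopman_L2: "g \<in> L2 \<mu> \<Longrightarrow> (\<lambda>x. g (S t x)) \<in> L2 \<mu>"
  using koopman_HS HS_L2 by blast

text \<open>Read off from the spectral integral, whose integrand has modulus 1.\<close>

lemma koopman_norm_le: "g \<in> L2 \<mu> \<Longrightarrow> L2_norm \<mu> (\<lambda>x. g (S t x)) \<le> L2_norm \<mu> g"
  using HS_norm_le[OF koopman_HS, of g t 1] by simp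

definition error :: "nat \<Rightarrow> nat \<Rightarrow> ('a \<Rightarrow> complex) \<Rightarrow> real" where
  "error i m g = L2_norm \<mu> (\<lambda>x. g (S (real m * \<tau> i) x) - discrete_koopman \<mu> (P i) (T i) (int m) g x)"

text \<open>A Riemann sum with mesh \<open>\<tau> i\<close>, at right endpoints, for the integral of
  the error over (0, t].\<close>

definition mean_error :: "real \<Rightarrow> nat \<Rightarrow> ('a \<Rightarrow> complex) \<Rightarrow> real" where
  "mean_error t i g = \<tau> i * (\<Sum>m=1..nat \<lfloor>t / \<tau> i\<rfloor>. error i m g)"

lemma steps_le:
  assumes "i \<ge> 1" "t > 0"
  shows "real (nat \<lfloor>t / \<tau> i\<rfloor>) * \<tau> i \<le> t"
proof -
  have "real (nat \<lfloor>t / \<tau> i\<rfloor>) \<le> t / \<tau> i" using assms \<tau>_pos[of i] by simp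
  then show ?thesis using \<tau>_pos[OF assms(1)] by (simp add: field_simps)
qed

lemma mean_error_le:
  assumes i: "i \<ge> 1" and t: "t > 0" and c: "c \<ge> 0"
    and le: "\<And>m. m \<in> {1..nat \<lfloor>t / \<tau> i\<rfloor>} \<Longrightarrow> error i m g \<le> c + \<delta> m"
  shows "mean_error t i g \<le> t * c + \<tau> i * (\<Sum>m=1..nat \<lfloor>t / \<tau> i\<rfloor>. \<delta> m)"
proof -
  have "mean_error t i g \<le> \<tau> i * (\<Sum>m=1..nat \<lfloor>t / \<tau> i\<rfloor>. c + \<delta> m)"
    unfolding mean_error_def using \<tau>_pos[OF i] le by (intro mult_left_mono sum_mono) auto
  also have "\<dots> = (real (nat \<lfloor>t / \<tau> i\<rfloor>) * \<tau> i) * c + \<tau> i * (\<Sum>m=1..nat \<lfloor>t / \<tau> i\<rfloor>. \<delta> m)"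
    by (simp add: sum.distrib algebra_simps)
  also have "(real (nat \<lfloor>t / \<tau> i\<rfloor>) * \<tau> i) * c \<le> t * c"
    by (rule mult_right_mono[OF steps_le[OF i t] c])
  finally show ?thesis by simp
qed

lemma mean_error_nonneg: "i \<ge> 1 \<Longrightarrow> mean_error t i g \<ge> 0"
  unfolding mean_error_def error_def using \<tau>_pos[of i] by (intro mult_nonneg_nonneg sum_nonneg) auto

lemma error_triangle:
  assumes "i \<ge> 1" and f: "f \<in> L2 \<mu>" and h: "h \<in> L2 \<mu>"
  shows "error i m (\<lambda>x. f x + a * h x) \<le> error i m f + cmod a * error i m h"
proof -
  interpret D: cell_flow nrm X S \<mu> "P i" "T i" "v i" "\<theta> i" "\<tau> i" "l i" by (rule cell_flow[OF assms(1)])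
  have "error i m (\<lambda>x. f x + a * h x) = L2_norm \<mu> (\<lambda>x. (f (S (real m * \<tau> i) x) - D.U m f x) +
      a * (h (S (real m * \<tau> i) x) - D.U m h x))"
    unfolding error_def D.U_def[symmetric] D.U_add_scale[OF f h] by (simp add: algebra_simps)
  also have "\<dots> \<le> L2_norm \<mu> (\<lambda>x. f (S (real m * \<tau> i) x) - D.U m f x) +
      L2_norm \<mu> (\<lambda>x. a * (h (S (real m * \<tau> i) x) - D.U m h x))"
    by (intro L2_norm_triangle L2_scale L2_diff koopman_L2 f h D.U_L2)
  finally show ?thesis by (simp add: error_def D.U_def[symmetric] L2_norm_scale)
qed

lemma error_le:
  assumes "i \<ge> 1" and f: "f \<in> L2 \<mu>"
  shows "error i m f \<le> 2 * L2_norm \<mu> f"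
proof -
  interpret D: cell_flow nrm X S \<mu> "P i" "T i" "v i" "\<theta> i" "\<tau> i" "l i" by (rule cell_flow[OF assms(1)])
  show ?thesis
    unfolding error_def D.U_def[symmetric]
    using L2_norm_diff_le[OF koopman_L2[OF f, of "real m * \<tau> i"] D.U_L2[of m f]]
      koopman_norm_le[OF f, of "real m * \<tau> i"] D.U_norm_le[OF f, of m] by simp
qed

text \<open>A Markov-type argument. At a time whose Hausdorff distance \<open>\<delta>\<close>
  satisfies \<open>L * \<delta> \<le> r\<close> the error is at most \<open>3 * sqrt c\<close>. At
  any other time the trivial bound \<open>2 * k\<close> is at most
  \<open>2 * k * L * \<delta> / r\<close>. So the error never exceeds
  \<open>3 * sqrt c + W * \<delta>\<close>, and the hypothesis makes the Riemann sum of
  \<open>\<delta>\<close> small.\<close>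

lemma mean_error_compact:
  assumes K: "compact K" "K \<subseteq> X" "K \<noteq> {}" and t: "t > 0"
  shows "(\<lambda>i. mean_error t i (indicator K)) \<longlonglongrightarrow> 0"
proof (rule LIMSEQ_I)
  fix e :: real assume e: "e > 0"
  \<comment> \<open>Chosen so that the term \<open>3 * sqrt c\<close> contributes 3 * e / 8 over the
    time \<open>t\<close>, leaving more than e / 2 for the Hausdorff term.\<close>
  define c where "c = (e / (8 * t))\<^sup>2"
  have c: "c > 0" "sqrt c = e / (8 * t)" using e t by (auto simp: c_def real_sqrt_abs)
  define B where "B i k = cell_image (P i) (T i) k (cell_cover (P i) K)" for i k
  \<comment> \<open>The grid times reach at most \<open>t\<close>; the longer horizon
    \<open>t + 1\<close> gives the strict inequality needed by
    \<open>hausdorff_sum_le_integral\<close>.\<close>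
  define I where "I i = (LBINT s=ereal (- (t + 1))..ereal (t + 1).
      hausdorff_dist nrm (S s ` K) (B i (\<xi>_steps \<tau> i s)))" for i
  define \<delta> where "\<delta> i m = hausdorff_dist nrm (S (- (real m * \<tau> i)) ` K) (B i (- int m))" for i m
  have Ks: "K \<in> sets \<mu>" by (rule compact_in_sets[OF K(1,2)])
  have KL: "(indicator K :: 'a \<Rightarrow> complex) \<in> L2 \<mu>" by (rule L2_indicator[OF Ks])
  define k where "k = L2_norm \<mu> (indicator K :: 'a \<Rightarrow> complex)"
  have k: "k \<ge> 0" by (simp add: k_def)
  obtain L where L: "L > 0" "\<And>r s x y. \<bar>r\<bar> \<le> t + 1 \<Longrightarrow> \<bar>s\<bar> \<le> t + 1 \<Longrightarrow> x \<in> X \<Longrightarrow> y \<in> X \<Longrightarrow>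
    nrm (S r x - S s y) \<le> L * (\<bar>r - s\<bar> + nrm (x - y))"
    using S_lipschitz[of "t + 1"] t by (metis add_pos_pos zero_less_one)
  obtain r where r: "r > 0" "\<And>r'. r' \<le> r \<Longrightarrow> measure \<mu> (nhd r' K) \<le> measure \<mu> K + c"
    using nhd_measure[OF K(1,2) c(1)] by blast
  obtain R where R: "\<And>x y. x \<in> X \<Longrightarrow> y \<in> X \<Longrightarrow> nrm (x - y) \<le> R" using X_nrm_bounded by blast
  define W where "W = 2 * k * L / r"
  have W: "W \<ge> 0" using k L r by (simp add: W_def)
  have B: "B i j \<subseteq> X" "B i j \<noteq> {}" if "i \<ge> 1" for i j
    using cell_flow.cell_image_facts[OF cell_flow[OF that] K(2,3)] by (auto simp: B_def)
  have R': "nrm (x - y) \<le> R" if "i \<ge> 1" "x \<in> S s ` K" "y \<in> B i j" for i s x y j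
    using R that B[OF that(1), of j] compact_S(2)[OF K(2), of s] by blast
  have \<delta>_nonneg: "\<delta> i m \<ge> 0" if "i \<ge> 1" for i m
    unfolding \<delta>_def
    by (rule hausdorff_dist_bounds(1)[OF norm_nrm R'[OF that]]) (use B[OF that] K(3) in auto)
  have I0: "I \<longlonglongrightarrow> 0"
    using approx K unfolding periodically_approximates_def I_def B_def by blast
  have "(\<lambda>i. W * (I i + L * \<tau> i * (t + 1))) \<longlonglongrightarrow> W * (0 + L * 0 * (t + 1))"
    by (intro tendsto_intros I0 \<tau>_0)
  then have "\<forall>\<^sub>F i in sequentially. W * (I i + L * \<tau> i * (t + 1)) < e / 2"
    by (rule order_tendstoD(2)) (use e in simp)
  moreover have "\<forall>\<^sub>F i in sequentially. l i < r" by (rule order_tendstoD(2)[OF l_0 r(1)])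
  ultimately have "\<forall>\<^sub>F i in sequentially. norm (mean_error t i (indicator K) - 0) < e"
    using eventually_ge_at_top[of 1]
  proof eventually_elim
    case (elim i)
    note i = elim(3)
    interpret D: cell_flow nrm X S \<mu> "P i" "T i" "v i" "\<theta> i" "\<tau> i" "l i" by (rule cell_flow[OF i])
    have "error i m (indicator K) \<le> 3 * sqrt c + W * \<delta> i m" if m: "m \<in> {1..nat \<lfloor>t / \<tau> i\<rfloor>}" for m
    proof (cases "L * \<delta> i m \<le> r")
      case True
      have "real m * \<tau> i \<le> real (nat \<lfloor>t / \<tau> i\<rfloor>) * \<tau> i"
        using m \<tau>_pos[OF i] by (intro mult_right_mono) auto
      also have "\<dots> \<le> t" by (rule steps_le[OF i t])
      finally have mt: "\<bar>real m * \<tau> i\<bar> \<le> t + 1" using \<tau>_pos[OF i] by simp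
      \<comment> \<open>Each \<open>y\<close> has a partner within \<open>\<delta> i m\<close> in
        the image of \<open>K\<close>. Flowing both forward by \<open>real m * \<tau> i\<close>
        takes the partner into \<open>K\<close> and stretches their distance by at most
        \<open>L\<close>.\<close>
      have "B i (- int m) \<subseteq> S (- (real m * \<tau> i)) ` nhd r K"
      proof
        fix y assume y: "y \<in> B i (- int m)"
        then have yX: "y \<in> X" using B[OF i] by blast
        have ne: "S (- (real m * \<tau> i)) ` K \<noteq> {}" using K(3) by simp
        obtain x where x: "x \<in> S (- (real m * \<tau> i)) ` K" "nrm (x - y) \<le> \<delta> i m"
          unfolding \<delta>_def
        proof (rule hausdorff_dist_nearest[OF norm_nrm _ compact_S(1)[OF K(1,2)] ne y])
          show "nrm (x - y) \<le> R" if "x \<in> S (- (real m * \<tau> i)) ` K" "y \<in> B i (- int m)" for x y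
            by (rule R'[OF i that])
        qed
        then obtain a where a: "a \<in> K" "x = S (- (real m * \<tau> i)) a" by blast
        have aX: "a \<in> X" using a K by auto
        have "nrm (a - S (real m * \<tau> i) y) = nrm (S (real m * \<tau> i) x - S (real m * \<tau> i) y)"
          unfolding a S_inv(1)[OF aX] ..
        also have "\<dots> \<le> L * nrm (x - y)"
          using L(2)[OF mt mt, of x y] yX aX a S_in by simp
        also have "\<dots> \<le> L * \<delta> i m" using L x by simp
        also have "\<dots> \<le> r" by (rule True)
        finally have "S (real m * \<tau> i) y \<in> nhd r K" using a S_in[OF yX] by (auto simp: nhd_def)
        then show "y \<in> S (- (real m * \<tau> i)) ` nhd r K"
          using S_inv(2)[OF yX, of "real m * \<tau> i"] by (metis image_eqI)
      qed
      then have "error i m (indicator K) \<le> sqrt (2 * c) + sqrt c"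
        unfolding error_def D.U_def[symmetric] using r elim(2)
        by (intro D.koopman_indicator_diff K) (auto simp: B_def)
      also have "sqrt (2 * c) \<le> 2 * sqrt c" using c(1) real_sqrt_le_mono[of "2 * c" "4 * c"] by (simp add: real_sqrt_mult)
      finally have "error i m (indicator K) \<le> 3 * sqrt c" by simp
      then show ?thesis using mult_nonneg_nonneg[OF W \<delta>_nonneg[OF i, of m]] by linarith
    next
      case False
      then have "1 \<le> L * \<delta> i m / r" using r by (simp add: field_simps)
      then have "2 * k * 1 \<le> 2 * k * (L * \<delta> i m / r)" using k by (intro mult_left_mono) auto
      moreover have "error i m (indicator K) \<le> 2 * k" unfolding k_def by (rule error_le[OF i KL])
      moreover have "sqrt c \<ge> 0" using c(1) by simp
      moreover have "W * \<delta> i m = 2 * k * (L * \<delta> i m / r)" by (simp add: W_def)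
      ultimately show ?thesis by linarith
    qed
    then have "mean_error t i (indicator K) \<le> t * (3 * sqrt c) + \<tau> i * (\<Sum>m=1..nat \<lfloor>t / \<tau> i\<rfloor>. W * \<delta> i m)"
      by (intro mean_error_le[OF i t]) (use c(1) in auto)
    also have "t * (3 * sqrt c) = 3 * e / 8" using t by (simp add: c)
    also have "\<tau> i * (\<Sum>m=1..nat \<lfloor>t / \<tau> i\<rfloor>. W * \<delta> i m) = W * (\<tau> i * (\<Sum>m=1..nat \<lfloor>t / \<tau> i\<rfloor>. \<delta> i m))"
      by (simp add: sum_distrib_left mult_ac)
    also have "\<dots> \<le> W * (I i + L * \<tau> i * (t + 1))"
      unfolding I_def \<delta>_def
      by (intro mult_left_mono W hausdorff_sum_le_integral K B[OF i] \<tau>_pos[OF i] L)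
         (use steps_le[OF i t] in auto)
    finally show ?case using elim(1) e mean_error_nonneg[OF i, of t "indicator K"] by simp
  qed
  then show "\<exists>N. \<forall>i\<ge>N. norm (mean_error t i (indicator K) - 0) < e" by (simp add: eventually_sequentially)
qed

theorem mean_error_tendsto_0:
  assumes g: "g \<in> L2 \<mu>" and t: "t > 0"
  shows "(\<lambda>i. mean_error t i g) \<longlonglongrightarrow> 0"
  using g
proof (induction rule: L2_compact_induct)
  case (compact K)
  show ?case
  proof (cases "K = {}")
    \<comment> \<open>\<open>periodically_approximates\<close> speaks of nonempty sets only.\<close>
    case True
    have K: "(indicator K :: 'a \<Rightarrow> complex) = (\<lambda>x. 0)" using True by auto
    have "error i m (indicator K) = 0" if "i \<ge> 1" for i m
      using error_le[OF that L2_zero, of m] unfolding K by (simp add: error_def order_antisym)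
    then show ?thesis
      by (intro tendsto_eventually eventually_sequentiallyI[of 1]) (simp add: mean_error_def)
  next
    case False
    then show ?thesis using mean_error_compact[OF compact] t by simp
  qed
next
  case (add a f h)
  show ?case
  proof (rule Lim_null_comparison)
    show "(\<lambda>i. mean_error t i f + cmod a * mean_error t i h) \<longlonglongrightarrow> 0"
      using tendsto_add[OF add(3) tendsto_mult_left[OF add(4), of "cmod a"]] by simp
    show "\<forall>\<^sub>F i in sequentially. norm (mean_error t i (\<lambda>x. f x + a * h x)) \<le> mean_error t i f + cmod a * mean_error t i h"
      using eventually_ge_at_top[of 1]
    proof eventually_elim
      case (elim i)
      have "mean_error t i (\<lambda>x. f x + a * h x) \<le> \<tau> i * (\<Sum>m=1..nat \<lfloor>t / \<tau> i\<rfloor>. error i m f + cmod a * error i m h)"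
        unfolding mean_error_def using \<tau>_pos[OF elim] error_triangle[OF elim add(1,2)]
        by (intro mult_left_mono sum_mono) auto
      also have "\<dots> = mean_error t i f + cmod a * mean_error t i h"
        by (simp add: mean_error_def sum.distrib sum_distrib_left algebra_simps)
      finally show ?case using mean_error_nonneg[OF elim] by simp
    qed
  qed
next
  case (limit f)
  show ?case
  proof (rule LIMSEQ_I)
    fix e :: real assume e: "e > 0"
    then have "e / (4 * t) > 0" using t by simp
    then obtain h where h: "h \<in> L2 \<mu>" "(\<lambda>i. mean_error t i h) \<longlonglongrightarrow> 0" "L2_dist \<mu> f h \<le> e / (4 * t)"
      using limit(2) by blast
    have "\<forall>\<^sub>F i in sequentially. mean_error t i h < e / 4" by (rule order_tendstoD(2)[OF h(2)]) (use e in simp)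
    then have "\<forall>\<^sub>F i in sequentially. norm (mean_error t i f - 0) < e"
      using eventually_ge_at_top[of 1]
    proof eventually_elim
      case (elim i)
      have fh: "(\<lambda>x. f x - h x) \<in> L2 \<mu>" by (rule L2_diff[OF limit(1) h(1)])
      \<comment> \<open>The trivial bound doubles the distance e / (4 * t) between \<open>f\<close>
        and \<open>h\<close>, so the sum over the time \<open>t\<close> loses only e / 2.\<close>
      have "error i m f \<le> e / (2 * t) + error i m h" for m
        using error_triangle[OF elim(2) h(1) fh, of m 1] error_le[OF elim(2) fh, of m] h(3) by simp
      then have "mean_error t i f \<le> t * (e / (2 * t)) + \<tau> i * (\<Sum>m=1..nat \<lfloor>t / \<tau> i\<rfloor>. error i m h)"
        using e t by (intro mean_error_le[OF elim(2)]) auto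
      also have "\<dots> = e / 2 + mean_error t i h" using t by (simp add: mean_error_def)
      finally show ?case using elim e mean_error_nonneg[OF elim(2), of t f] by simp
    qed
    then show "\<exists>N. \<forall>i\<ge>N. norm (mean_error t i f - 0) < e" by (simp add: eventually_sequentially)
  qed
qed

end

section \<open>Convergence of functions of the generator\<close>

text \<open>The quotient of \<open>exp w - 1\<close> by \<open>w\<close> extends continuously to 0
  with value 1. Its zeros are the nonzero multiples of 2 * pi * i, outside this compact box, so its
  modulus has a positive minimum there.\<close>

lemma exp_minus_one_lower_bound:
  obtains c where "c > 0" "\<And>w. 0 \<le> Re w \<Longrightarrow> Re w \<le> 1 \<Longrightarrow> \<bar>Im w\<bar> \<le> pi \<Longrightarrow> c * cmod w \<le> cmod (exp w - 1)"
proof -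
  define K where "K = cbox (Complex 0 (- pi)) (Complex 1 pi)"
  define f :: "complex \<Rightarrow> complex" where "f w = (if w = 0 then 1 else (exp w - 1) / w)" for w
  have "isCont f w" for w
  proof (cases "w = 0")
    case True
    have "DERIV exp (0::complex) :> exp 0" by (rule DERIV_exp)
    then have "((\<lambda>h. (exp h - 1) / h) \<longlongrightarrow> (1::complex)) (at 0)" by (simp add: DERIV_def)
    then have "(f \<longlongrightarrow> 1) (at 0)"
      by (rule Lim_transform_eventually) (auto simp: f_def eventually_at_filter)
    then show ?thesis using True by (simp add: isCont_def f_def)
  next
    case False
    have "((\<lambda>w. (exp w - 1) / w) \<longlongrightarrow> (exp w - 1) / w) (at w)"
      using False by (intro tendsto_intros) auto
    moreover have "\<forall>\<^sub>F x in at w. x \<noteq> 0" by (rule tendsto_imp_eventually_ne[OF tendsto_ident_at False])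
    ultimately have "(f \<longlongrightarrow> (exp w - 1) / w) (at w)"
      by (elim Lim_transform_eventually) (auto elim!: eventually_mono simp: f_def)
    then show ?thesis using False by (simp add: isCont_def f_def)
  qed
  then have cont: "continuous_on K (\<lambda>w. cmod (f w))"
    by (intro continuous_on_norm continuous_at_imp_continuous_on) blast
  have "Complex 0 0 \<in> K" by (simp add: K_def in_cbox_complex_iff)
  then have ne: "K \<noteq> {}" by auto
  obtain u where u: "u \<in> K" "\<And>w. w \<in> K \<Longrightarrow> cmod (f u) \<le> cmod (f w)"
    using continuous_attains_inf[OF _ ne cont] compact_cbox unfolding K_def by metis
  have "f u \<noteq> 0"
  proof
    assume "f u = 0"
    then have u0: "u \<noteq> 0" "exp u = 1" by (auto simp: f_def split: if_splits)
    then obtain k :: int where k: "Re u = 0" "Im u = of_int (2 * k) * pi" by (auto simp: exp_eq_1)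
    have "\<bar>Im u\<bar> \<le> pi" using u(1) by (auto simp: K_def in_cbox_complex_iff)
    then have "\<bar>of_int (2 * k) :: real\<bar> \<le> 1" unfolding k by (simp add: abs_mult)
    then have "k = 0" by linarith
    then show False using k u0 by (simp add: complex_eq_iff)
  qed
  show thesis
  proof
    show "cmod (f u) > 0" using \<open>f u \<noteq> 0\<close> by simp
    fix w assume "0 \<le> Re w" "Re w \<le> 1" "\<bar>Im w\<bar> \<le> pi"
    then have "cmod (f u) \<le> cmod (f w)" by (intro u) (auto simp: K_def in_cbox_complex_iff)
    then show "cmod (f u) * cmod w \<le> cmod (exp w - 1)"
      by (cases "w = 0") (auto simp: f_def norm_divide field_simps)
  qed
qed

text \<open>The integral of exp(-s) * exp(i * \<omega> * s) over s > 0: the resolvent at 1 of the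
  generator, as a function of the frequency.\<close>

definition resolvent :: "real \<Rightarrow> complex" where
  "resolvent \<omega> = 1 / (1 - \<i> * of_real \<omega>)"

text \<open>A Riemann sum with mesh \<open>t\<close> for the Laplace integral of
  \<open>resolvent\<close>, truncated at time \<open>N * t\<close>. It uses grid times only, where
  the discrete evolution is defined.\<close>

definition laplace_sum :: "real \<Rightarrow> nat \<Rightarrow> real \<Rightarrow> complex" where
  "laplace_sum t N \<omega> = (\<Sum>m=1..N. of_real (t * exp (- (real m * t))) * exp (\<i> * of_real (\<omega> * (real m * t))))"

lemma resolvent_denominator: "1 - \<i> * of_real \<omega> \<noteq> (0::complex)"
  by (simp add: complex_eq_iff)

lemma cmod_resolvent_le: "cmod (resolvent \<omega>) \<le> 1"
proof -
  have "1 \<le> cmod (1 - \<i> * of_real \<omega>)" using abs_Re_le_cmod[of "1 - \<i> * of_real \<omega>"] by simp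
  then show ?thesis by (simp add: resolvent_def norm_divide divide_le_eq_1)
qed

lemma cmod_laplace_sum_le:
  assumes "t > 0" shows "cmod (laplace_sum t N \<omega>) \<le> real N * t"
proof -
  have "cmod (laplace_sum t N \<omega>) \<le> (\<Sum>m=1..N. t)"
    unfolding laplace_sum_def
    by (rule sum_norm_le) (use assms in \<open>simp add: norm_mult mult_le_cancel_left1\<close>)
  then show ?thesis by simp
qed

text \<open>The sum is geometric: with \<open>w = (1 - i\<omega>)t\<close> it equals \<open>t (1 - exp (-Nw)) / (exp w - 1)\<close>, and
  \<open>1 / (exp w - 1) - 1 / w\<close> is bounded on \<open>0 \<le> Re w \<le> 1\<close>, \<open>|Im w| \<le> \<pi>\<close>.\<close>

lemma laplace_sum_approx:
  obtains C where "C > 0" "\<And>t N \<omega>. 0 < t \<Longrightarrow> t \<le> 1 \<Longrightarrow> \<bar>\<omega> * t\<bar> \<le> pi \<Longrightarrow>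
    cmod (laplace_sum t N \<omega> - resolvent \<omega>) \<le> C * (t + exp (- (real N * t)))"
proof -
  obtain c where c: "c > 0" "\<And>w. 0 \<le> Re w \<Longrightarrow> Re w \<le> 1 \<Longrightarrow> \<bar>Im w\<bar> \<le> pi \<Longrightarrow> c * cmod w \<le> cmod (exp w - 1)"
    using exp_minus_one_lower_bound by blast
  \<comment> \<open>The exponential bounds the Taylor remainder on
    \<open>cmod w \<le> 1 + pi\<close>; the summand 1 pays for the truncation term.\<close>
  define C where "C = (exp (1 + pi) + 1) / c"
  have C: "exp (1 + pi) / c \<le> C" "1 / c \<le> C" "C > 0"
    using c by (auto simp: C_def divide_right_mono add_pos_pos)
  show thesis
  proof (rule that[OF C(3)])
    fix t \<omega> :: real and N :: nat
    assume t: "0 < t" "t \<le> 1" "\<bar>\<omega> * t\<bar> \<le> pi"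
    define w where "w = (1 - \<i> * of_real \<omega>) * of_real t"
    have w: "Re w = t" "Im w = - (\<omega> * t)" by (auto simp: w_def)
    have w0: "w \<noteq> 0" using w t by auto
    have wt: "t \<le> cmod w" using abs_Re_le_cmod[of w] w t by simp
    have wpi: "cmod w \<le> 1 + pi" using cmod_le[of w] w t by simp
    have ew: "c * cmod w \<le> cmod (exp w - 1)" using w t by (intro c(2)) auto
    then have ew0: "exp w - 1 \<noteq> 0" using c w0 by (auto simp: mult_le_0_iff)
    define z where "z = exp (- w)"
    have ez: "exp w * z = 1" by (simp add: z_def exp_minus)
    have "laplace_sum t N \<omega> = of_real t * (\<Sum>m=1..N. z ^ m)"
      unfolding laplace_sum_def sum_distrib_left
    proof (rule sum.cong[OF refl])
      fix m
      have "z ^ m = exp (of_real (- (real m * t)) + \<i> * of_real (\<omega> * (real m * t)))"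
        unfolding z_def exp_of_nat_mult[symmetric] w_def by (simp add: algebra_simps)
      also have "\<dots> = of_real (exp (- (real m * t))) * exp (\<i> * of_real (\<omega> * (real m * t)))"
        unfolding exp_add exp_of_real ..
      finally show "of_real (t * exp (- (real m * t))) * exp (\<i> * of_real (\<omega> * (real m * t))) = of_real t * z ^ m"
        by simp
    qed
    moreover have "(exp w - 1) * (\<Sum>m=1..N. z ^ m) = 1 - z ^ N"
    proof (induction N)
      case (Suc N)
      have "(exp w - 1) * (\<Sum>m=1..Suc N. z ^ m) = 1 - z ^ N + (exp w - 1) * z ^ Suc N"
        using Suc by (simp add: distrib_left)
      also have "(exp w - 1) * z ^ Suc N = (exp w * z) * z ^ N - z ^ Suc N" by (simp add: algebra_simps)
      finally show ?case by (simp add: ez)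
    qed simp
    ultimately have ls: "laplace_sum t N \<omega> = of_real t * (1 - z ^ N) / (exp w - 1)"
      using ew0 by (metis nonzero_mult_div_cancel_left times_divide_eq_right)
    have rs: "resolvent \<omega> = of_real t / w"
      using t by (simp add: resolvent_def w_def)
    \<comment> \<open>The first term is the discretisation error of the infinite sum, the second the
      truncation error.\<close>
    have eq: "laplace_sum t N \<omega> - resolvent \<omega> =
        - (of_real t * ((exp w - 1 - w) / (w * (exp w - 1)))) - of_real t * z ^ N / (exp w - 1)"
    proof -
      have "b * (1 - y) / u - b / s = - (b * ((u - s) / (s * u))) - b * y / u"
        if "u \<noteq> 0" "s \<noteq> 0" for b y u s :: complex
        using that by (simp add: field_simps)
      from this[OF ew0 w0] show ?thesis
        unfolding ls rs .
    qed
    have "cmod (laplace_sum t N \<omega> - resolvent \<omega>) \<le>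
        cmod (of_real t * ((exp w - 1 - w) / (w * (exp w - 1)))) + cmod (of_real t * z ^ N / (exp w - 1))"
      unfolding eq by (rule order_trans[OF norm_triangle_ineq4]) simp
    also have "cmod (of_real t * ((exp w - 1 - w) / (w * (exp w - 1)))) \<le> exp (1 + pi) / c * t"
    proof -
      have "cmod (exp w - 1 - w) \<le> exp (cmod w) * cmod w ^ 2"
        using Taylor_exp_field[of w 1] by (simp add: numeral_2_eq_2 diff_diff_eq)
      also have "\<dots> \<le> exp (1 + pi) * cmod w ^ 2" using wpi by (intro mult_right_mono) auto
      finally have num: "cmod (exp w - 1 - w) \<le> exp (1 + pi) * cmod w ^ 2" .
      have "cmod ((exp w - 1 - w) / (w * (exp w - 1))) \<le> (exp (1 + pi) * cmod w ^ 2) / (cmod w * (c * cmod w))"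
        unfolding norm_divide norm_mult using num ew w0 c by (intro frac_le mult_left_mono) auto
      also have "\<dots> = exp (1 + pi) / c" using w0 by (simp add: power2_eq_square)
      finally have "t * cmod ((exp w - 1 - w) / (w * (exp w - 1))) \<le> t * (exp (1 + pi) / c)"
        using t by (intro mult_left_mono) auto
      then show ?thesis using t unfolding norm_mult by (simp add: mult.commute)
    qed
    also have "cmod (of_real t * z ^ N / (exp w - 1)) \<le> 1 / c * exp (- (real N * t))"
    proof -
      have "cmod (z ^ N) = exp (- (real N * t))"
        by (simp add: z_def norm_power w exp_of_nat_mult[symmetric])
      then have "cmod (of_real t * z ^ N / (exp w - 1)) = t * exp (- (real N * t)) / cmod (exp w - 1)"
        using t by (simp add: norm_divide norm_mult)
      also have "\<dots> \<le> t * exp (- (real N * t)) / (c * t)"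
      proof (rule divide_left_mono)
        show "c * t \<le> cmod (exp w - 1)" using ew mult_left_mono[OF wt less_imp_le[OF c(1)]] by linarith
      qed (use t c ew0 in \<open>auto intro!: mult_pos_pos\<close>)
      also have "\<dots> = 1 / c * exp (- (real N * t))" using t by simp
      finally show ?thesis .
    qed
    also have "exp (1 + pi) / c * t + 1 / c * exp (- (real N * t)) \<le> C * t + C * exp (- (real N * t))"
      using C t by (intro add_mono mult_right_mono) auto
    finally show "cmod (laplace_sum t N \<omega> - resolvent \<omega>) \<le> C * (t + exp (- (real N * t)))"
      by (simp add: distrib_left)
  qed
qed

section \<open>Bounded symbols and the algebra of convergent functions\<close>

definition bounded_borel :: "(real \<Rightarrow> complex) \<Rightarrow> bool" where
  "bounded_borel F \<longleftrightarrow> F \<in> borel_measurable borel \<and> (\<exists>C. \<forall>\<omega>. cmod (F \<omega>) \<le> C)"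

lemma bounded_borelI: "F \<in> borel_measurable borel \<Longrightarrow> (\<And>\<omega>. cmod (F \<omega>) \<le> C) \<Longrightarrow> bounded_borel F"
  by (auto simp: bounded_borel_def)

lemma bounded_borelE:
  assumes "bounded_borel F"
  obtains C where "C \<ge> 0" "\<And>\<omega>. cmod (F \<omega>) \<le> C" "F \<in> borel_measurable borel"
proof -
  obtain C where "\<And>\<omega>. cmod (F \<omega>) \<le> C" "F \<in> borel_measurable borel"
    using assms by (auto simp: bounded_borel_def)
  moreover from this(1) have "C \<ge> 0" using order_trans[OF norm_ge_zero] by blast
  ultimately show thesis using that by blast
qed

lemma bounded_borel_mult:
  assumes "bounded_borel F" "bounded_borel G" shows "bounded_borel (\<lambda>\<omega>. F \<omega> * G \<omega>)"
proof -
  obtain C where C: "C \<ge> 0" "\<And>\<omega>. cmod (F \<omega>) \<le> C" "F \<in> borel_measurable borel" using bounded_borelE[OF assms(1)] by blast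
  obtain D where D: "D \<ge> 0" "\<And>\<omega>. cmod (G \<omega>) \<le> D" "G \<in> borel_measurable borel" using bounded_borelE[OF assms(2)] by blast
  show ?thesis
    by (rule bounded_borelI[of _ "C * D"]) (use C D in \<open>auto simp: norm_mult intro!: mult_mono\<close>)
qed

lemma bounded_borel_add_scale:
  assumes "bounded_borel F" "bounded_borel G" shows "bounded_borel (\<lambda>\<omega>. a * F \<omega> + b * G \<omega>)"
proof -
  obtain C where C: "C \<ge> 0" "\<And>\<omega>. cmod (F \<omega>) \<le> C" "F \<in> borel_measurable borel" using bounded_borelE[OF assms(1)] by blast
  obtain D where D: "D \<ge> 0" "\<And>\<omega>. cmod (G \<omega>) \<le> D" "G \<in> borel_measurable borel" using bounded_borelE[OF assms(2)] by blast
  have "cmod (a * F \<omega> + b * G \<omega>) \<le> cmod a * C + cmod b * D" for \<omega>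
    by (rule order_trans[OF norm_triangle_ineq])
       (use C D in \<open>auto simp: norm_mult intro!: add_mono mult_left_mono\<close>)
  then show ?thesis by (rule bounded_borelI[rotated]) (use C D in auto)
qed

lemma bounded_borel_cnj: "bounded_borel F \<Longrightarrow> bounded_borel (\<lambda>\<omega>. cnj (F \<omega>))"
  unfolding bounded_borel_def
  using measurable_compose[of F borel borel cnj borel] borel_measurable_continuous_onI[of cnj]
  by (auto intro: continuous_intros)

lemma bounded_borel_resolvent: "bounded_borel resolvent"
  by (rule bounded_borelI[OF borel_measurable_continuous_onI cmod_resolvent_le])
     (use resolvent_denominator in \<open>auto intro!: continuous_intros simp: resolvent_def[abs_def]\<close>)

context periodic_approximation
begin

abbreviation Op :: "nat \<Rightarrow> (real \<Rightarrow> complex) \<Rightarrow> ('a \<Rightarrow> complex) \<Rightarrow> 'a \<Rightarrow> complex" where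
  "Op i \<equiv> eigen_calculus \<mu> (card (P i)) (v i) (\<lambda>k. \<theta> i k / \<tau> i)"

lemma orthonormal: "i \<ge> 1 \<Longrightarrow> orthonormal_family \<mu> (card (P i)) (v i)"
proof -
  assume "i \<ge> 1"
  then interpret D: cell_flow nrm X S \<mu> "P i" "T i" "v i" "\<theta> i" "\<tau> i" "l i" by (rule cell_flow)
  show ?thesis by (rule D.orthonormal_family_axioms)
qed

lemma HS_ex: assumes "bounded_borel F" "g \<in> L2 \<mu>" obtains h where "HS F g h"
  using HS_exists[OF assms(2)] bounded_borelE[OF assms(1)] by metis

text \<open>Strong convergence of \<open>F\<close> of the discrete generators to \<open>F\<close> of
  the flow generator. Quantifying over all values \<open>h\<close> avoids committing to a choice of
  spectral integral, which is unique only almost everywhere.\<close>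

definition converges :: "(real \<Rightarrow> complex) \<Rightarrow> bool" where
  "converges F \<longleftrightarrow> bounded_borel F \<and>
     (\<forall>g\<in>L2 \<mu>. \<forall>h. HS F g h \<longrightarrow> (\<lambda>i. L2_dist \<mu> h (Op i F g)) \<longlonglongrightarrow> 0)"

lemma convergesD: "converges F \<Longrightarrow> g \<in> L2 \<mu> \<Longrightarrow> HS F g h \<Longrightarrow> (\<lambda>i. L2_dist \<mu> h (Op i F g)) \<longlonglongrightarrow> 0"
  by (simp add: converges_def)

lemma converges_bounded_borel: "converges F \<Longrightarrow> bounded_borel F"
  by (simp add: converges_def)

lemma Op_L2: "i \<ge> 1 \<Longrightarrow> Op i F g \<in> L2 \<mu>"
  by (rule orthonormal_family.Op_L2[OF orthonormal])

lemma converges_add_scale: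
  assumes F: "converges F" and G: "converges G"
  shows "converges (\<lambda>\<omega>. a * F \<omega> + b * G \<omega>)"
  unfolding converges_def
proof (intro conjI ballI allI impI)
  show "bounded_borel (\<lambda>\<omega>. a * F \<omega> + b * G \<omega>)"
    using F G by (intro bounded_borel_add_scale converges_bounded_borel)
  fix g h assume g: "g \<in> L2 \<mu>" and h: "HS (\<lambda>\<omega>. a * F \<omega> + b * G \<omega>) g h"
  obtain f1 where f1: "HS F g f1" using HS_ex[OF converges_bounded_borel[OF F] g] .
  obtain f2 where f2: "HS G g f2" using HS_ex[OF converges_bounded_borel[OF G] g] .
  note L = HS_L2[OF f1] HS_L2[OF f2] HS_L2[OF h]
  note ae = HS_unique(2)[OF h HS_linear[OF f1 f2 g] g]
  show "(\<lambda>i. L2_dist \<mu> h (Op i (\<lambda>\<omega>. a * F \<omega> + b * G \<omega>) g)) \<longlonglongrightarrow> 0"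
  proof (rule Lim_null_comparison)
    show "(\<lambda>i. cmod a * L2_dist \<mu> f1 (Op i F g) + cmod b * L2_dist \<mu> f2 (Op i G g)) \<longlonglongrightarrow> 0"
      using tendsto_add[OF tendsto_mult_left[OF convergesD[OF F g f1], of "cmod a"]
        tendsto_mult_left[OF convergesD[OF G g f2], of "cmod b"]] by simp
    show "\<forall>\<^sub>F i in sequentially. norm (L2_dist \<mu> h (Op i (\<lambda>\<omega>. a * F \<omega> + b * G \<omega>) g))
      \<le> cmod a * L2_dist \<mu> f1 (Op i F g) + cmod b * L2_dist \<mu> f2 (Op i G g)"
      using eventually_ge_at_top[of 1]
    proof eventually_elim
      case (elim i)
      have "L2_dist \<mu> h (Op i (\<lambda>\<omega>. a * F \<omega> + b * G \<omega>) g) =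
        L2_norm \<mu> (\<lambda>x. a * (f1 x - Op i F g x) + b * (f2 x - Op i G g x))"
      proof (rule L2_norm_cong_AE)
        show "AE x in \<mu>. h x - Op i (\<lambda>\<omega>. a * F \<omega> + b * G \<omega>) g x = a * (f1 x - Op i F g x) + b * (f2 x - Op i G g x)"
          using ae by eventually_elim (simp add: orthonormal_family.Op_add[OF orthonormal[OF elim]] algebra_simps)
      qed (intro L2_diff L2_add L2_scale L Op_L2 elim)+
      also have "\<dots> \<le> L2_norm \<mu> (\<lambda>x. a * (f1 x - Op i F g x)) + L2_norm \<mu> (\<lambda>x. b * (f2 x - Op i G g x))"
        by (intro L2_norm_triangle L2_diff L2_scale L Op_L2 elim)
      finally show ?case by (simp add: L2_norm_scale)
    qed
  qed
qed

text \<open>Pass through \<open>Op i F k\<close> with \<open>k\<close> the limit for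
  \<open>G\<close>: one part is convergence of \<open>F\<close> at the fixed vector
  \<open>k\<close>, the other is the error for \<open>G\<close>, amplified by at most the bound of
  \<open>F\<close> uniformly in \<open>i\<close>.\<close>

lemma converges_mult:
  assumes F: "converges F" and G: "converges G"
  shows "converges (\<lambda>\<omega>. F \<omega> * G \<omega>)"
  unfolding converges_def
proof (intro conjI ballI allI impI)
  show "bounded_borel (\<lambda>\<omega>. F \<omega> * G \<omega>)"
    using F G by (intro bounded_borel_mult converges_bounded_borel)
  fix g h assume g: "g \<in> L2 \<mu>" and h: "HS (\<lambda>\<omega>. F \<omega> * G \<omega>) g h"
  obtain C where C: "C \<ge> 0" "\<And>\<omega>. cmod (F \<omega>) \<le> C" using bounded_borelE[OF converges_bounded_borel[OF F]] by metis
  obtain D where D: "\<And>\<omega>. cmod (G \<omega>) \<le> D" using bounded_borelE[OF converges_bounded_borel[OF G]] by metis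
  obtain k where k: "HS G g k" using HS_ex[OF converges_bounded_borel[OF G] g] .
  have kL: "k \<in> L2 \<mu>" by (rule HS_L2[OF k])
  obtain h' where h': "HS F k h'" using HS_ex[OF converges_bounded_borel[OF F] kL] .
  note L = HS_L2[OF h] HS_L2[OF h']
  note ae = HS_unique(2)[OF h HS_mult[OF k h' g D C(2)] g]
  show "(\<lambda>i. L2_dist \<mu> h (Op i (\<lambda>\<omega>. F \<omega> * G \<omega>) g)) \<longlonglongrightarrow> 0"
  proof (rule Lim_null_comparison)
    show "(\<lambda>i. L2_dist \<mu> h' (Op i F k) + C * L2_dist \<mu> k (Op i G g)) \<longlonglongrightarrow> 0"
      using tendsto_add[OF convergesD[OF F kL h'] tendsto_mult_left[OF convergesD[OF G g k], of C]] by simp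
    show "\<forall>\<^sub>F i in sequentially. norm (L2_dist \<mu> h (Op i (\<lambda>\<omega>. F \<omega> * G \<omega>) g))
      \<le> L2_dist \<mu> h' (Op i F k) + C * L2_dist \<mu> k (Op i G g)"
      using eventually_ge_at_top[of 1]
    proof eventually_elim
      case (elim i)
      interpret D: orthonormal_family \<mu> "card (P i)" "v i" "\<lambda>k. \<theta> i k / \<tau> i" by (rule orthonormal[OF elim])
      have "L2_dist \<mu> h (Op i (\<lambda>\<omega>. F \<omega> * G \<omega>) g) =
        L2_dist \<mu> h' (Op i F (Op i G g))"
        unfolding D.Op_mult by (rule L2_norm_cong_AE) (use ae in \<open>auto intro!: L2_diff L\<close>)
      also have "\<dots> \<le> L2_dist \<mu> h' (Op i F k) + L2_dist \<mu> (Op i F k) (Op i F (Op i G g))"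
        by (intro L2_norm_triangle_diff L D.Op_L2)
      also have "L2_dist \<mu> (Op i F k) (Op i F (Op i G g)) = L2_norm \<mu> (Op i F (\<lambda>x. k x - Op i G g x))"
        unfolding D.Op_diff_right[OF kL D.Op_L2, symmetric] ..
      also have "\<dots> \<le> C * L2_dist \<mu> k (Op i G g)"
        by (intro D.Op_norm_le L2_diff kL D.Op_L2 C)
      finally show ?case by simp
    qed
  qed
qed

lemma converges_uniform_limit:
  assumes F: "bounded_borel F"
    and lim: "\<And>e. e > 0 \<Longrightarrow> \<exists>G. converges G \<and> (\<forall>\<omega>. cmod (F \<omega> - G \<omega>) \<le> e)"
  shows "converges F"
  unfolding converges_def
proof (intro conjI ballI allI impI F)
  fix g h assume g: "g \<in> L2 \<mu>" and h: "HS F g h"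
  show "(\<lambda>i. L2_dist \<mu> h (Op i F g)) \<longlonglongrightarrow> 0"
  proof (rule LIMSEQ_I)
    fix e :: real assume e: "e > 0"
    then have "e / 3 > 0" by simp
    then obtain d where d: "d > 0" "d * L2_norm \<mu> g < e / 3" using small_factor[OF _ L2_norm_nonneg] by blast
    obtain G where G: "converges G" "\<And>\<omega>. cmod (F \<omega> - G \<omega>) \<le> d" using lim[OF d(1)] by blast
    obtain k where k: "HS G g k" using HS_ex[OF converges_bounded_borel[OF G(1)] g] .
    have hk: "L2_dist \<mu> h k \<le> d * L2_norm \<mu> g" by (rule HS_diff_norm_le[OF h k g G(2)])
    have "\<forall>\<^sub>F i in sequentially. L2_dist \<mu> k (Op i G g) < e / 3"
      by (rule order_tendstoD(2)[OF convergesD[OF G(1) g k]]) (use e in simp)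
    then have "\<forall>\<^sub>F i in sequentially. norm (L2_dist \<mu> h (Op i F g) - 0) < e"
      using eventually_ge_at_top[of 1]
    proof eventually_elim
      case (elim i)
      interpret D: orthonormal_family \<mu> "card (P i)" "v i" "\<lambda>k. \<theta> i k / \<tau> i" by (rule orthonormal[OF elim(2)])
      have "L2_dist \<mu> (Op i G g) (Op i F g) = L2_norm \<mu> (Op i (\<lambda>\<omega>. (-1) * F \<omega> + 1 * G \<omega>) g)"
        unfolding D.Op_add by simp
      also have "\<dots> \<le> d * L2_norm \<mu> g"
        by (rule D.Op_norm_le[OF g]) (use G d in \<open>auto simp: norm_minus_commute\<close>)
      finally have "L2_dist \<mu> (Op i G g) (Op i F g) \<le> d * L2_norm \<mu> g" .
      moreover have "L2_dist \<mu> h (Op i F g) \<le> L2_dist \<mu> h k + L2_dist \<mu> k (Op i F g)"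
        by (intro L2_norm_triangle_diff HS_L2[OF h] HS_L2[OF k] D.Op_L2)
      moreover have "L2_dist \<mu> k (Op i F g) \<le> L2_dist \<mu> k (Op i G g) + L2_dist \<mu> (Op i G g) (Op i F g)"
        by (intro L2_norm_triangle_diff HS_L2[OF k] D.Op_L2)
      ultimately show ?case using elim(1) hk d(2) by simp
    qed
    then show "\<exists>N. \<forall>i\<ge>N. norm (L2_dist \<mu> h (Op i F g) - 0) < e" by (simp add: eventually_sequentially)
  qed
qed

text \<open>The operators are normal: weak convergence follows by taking adjoints, and the norms of
  \<open>F\<close> and of its conjugate applied to \<open>g\<close> agree, which upgrades it to strong convergence.\<close>

lemma converges_cnj:
  assumes F: "converges F"
  shows "converges (\<lambda>\<omega>. cnj (F \<omega>))"
  unfolding converges_def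
proof (intro conjI ballI allI impI bounded_borel_cnj converges_bounded_borel F)
  fix g h assume g: "g \<in> L2 \<mu>" and h: "HS (\<lambda>\<omega>. cnj (F \<omega>)) g h"
  note bF = converges_bounded_borel[OF F]
  note bF' = bounded_borel_cnj[OF bF]
  obtain C where C: "\<And>\<omega>. cmod (F \<omega>) \<le> C" using bounded_borelE[OF bF] by metis
  then have C': "\<And>\<omega>. cmod (cnj (F \<omega>)) \<le> C" by simp
  obtain f where f: "HS F g f" using HS_ex[OF bF g] .
  have L: "h \<in> L2 \<mu>" "f \<in> L2 \<mu>" using HS_L2 h f by auto
  obtain k where k: "HS F h k" using HS_ex[OF bF L(1)] .
  obtain k' where k': "HS (\<lambda>\<omega>. cnj (F \<omega>)) f k'" using HS_ex[OF bF' L(2)] .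
  note L' = HS_L2[OF k] HS_L2[OF k']
  \<comment> \<open>Both orders of applying \<open>F\<close> and its conjugate integrate the squared
    modulus of \<open>F\<close>. Pairing the results with \<open>g\<close> yields the squared norms
    of \<open>h\<close> and \<open>f\<close>, which therefore agree.\<close>
  have "HS (\<lambda>\<omega>. F \<omega> * cnj (F \<omega>)) g k" by (rule HS_mult[OF h k g C' C])
  moreover have "HS (\<lambda>\<omega>. F \<omega> * cnj (F \<omega>)) g k'"
    using HS_mult[OF f k' g C C'] by (simp add: mult.commute)
  ultimately have kk: "AE x in \<mu>. k x = k' x" using HS_unique(2) g by blast
  have kg: "L2_inner \<mu> k g = of_real ((L2_norm \<mu> h)\<^sup>2)"
    using HS_adjoint[OF h _ g L(1), of k] k by (simp add: L2_inner_self)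
  have k'g: "L2_inner \<mu> k' g = of_real ((L2_norm \<mu> f)\<^sup>2)"
    using HS_adjoint[OF f k' g L(2)] by (simp add: L2_inner_self)
  have "L2_inner \<mu> k g = L2_inner \<mu> k' g" by (rule L2_inner_cong_AE[OF L' g g kk]) simp
  then have "(of_real ((L2_norm \<mu> h)\<^sup>2) :: complex) = of_real ((L2_norm \<mu> f)\<^sup>2)" using kg k'g by simp
  then have nn: "(L2_norm \<mu> h)\<^sup>2 = (L2_norm \<mu> f)\<^sup>2" by (simp only: of_real_eq_iff)
  have n: "(\<lambda>i. L2_norm \<mu> (Op i F g)) \<longlonglongrightarrow> L2_norm \<mu> f"
  proof (rule Lim_transform2[OF tendsto_const], rule Lim_null_comparison[OF _ convergesD[OF F g f]])
    show "\<forall>\<^sub>F i in sequentially. norm (L2_norm \<mu> f - L2_norm \<mu> (Op i F g)) \<le> L2_dist \<mu> f (Op i F g)"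
      using eventually_ge_at_top[of 1]
      by eventually_elim (use L2_norm_triangle_rev[OF L(2) Op_L2] in simp)
  qed
  have ip: "(\<lambda>i. L2_inner \<mu> (Op i F h) g) \<longlonglongrightarrow> L2_inner \<mu> k g"
  proof (rule Lim_transform2[OF tendsto_const], rule Lim_null_comparison)
    show "(\<lambda>i. L2_norm \<mu> g * L2_dist \<mu> k (Op i F h)) \<longlonglongrightarrow> 0"
      using tendsto_mult_left[OF convergesD[OF F L(1) k], of "L2_norm \<mu> g"] by simp
    show "\<forall>\<^sub>F i in sequentially. norm (L2_inner \<mu> k g - L2_inner \<mu> (Op i F h) g) \<le> L2_norm \<mu> g * L2_dist \<mu> k (Op i F h)"
      using eventually_ge_at_top[of 1]
    proof eventually_elim
      case (elim i)
      have "L2_inner \<mu> k g - L2_inner \<mu> (Op i F h) g = cnj (L2_inner \<mu> g (\<lambda>x. k x - Op i F h x))"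
        by (simp add: L2_inner_diff_right[OF g L'(1) Op_L2[OF elim]] L2_inner_cnj[symmetric])
      then show ?case using L2_Cauchy_Schwarz[OF g L2_diff[OF L'(1) Op_L2[OF elim]]] by simp
    qed
  qed
  \<comment> \<open>This is the expansion of the squared distance to be estimated: the inner product
    is moved by the adjoint to \<open>Op i F h\<close>, and the last norm is unchanged by
    conjugation, so both limits are known.\<close>
  have "(\<lambda>i. (L2_norm \<mu> h)\<^sup>2 - 2 * Re (L2_inner \<mu> (Op i F h) g) + (L2_norm \<mu> (Op i F g))\<^sup>2) \<longlonglongrightarrow>
      (L2_norm \<mu> h)\<^sup>2 - 2 * Re (L2_inner \<mu> k g) + (L2_norm \<mu> f)\<^sup>2"
    by (intro tendsto_intros tendsto_Re ip n)
  also have "(L2_norm \<mu> h)\<^sup>2 - 2 * Re (L2_inner \<mu> k g) + (L2_norm \<mu> f)\<^sup>2 = 0"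
    unfolding kg Re_complex_of_real using nn by simp
  finally have lim: "(\<lambda>i. (L2_norm \<mu> h)\<^sup>2 - 2 * Re (L2_inner \<mu> (Op i F h) g) + (L2_norm \<mu> (Op i F g))\<^sup>2) \<longlonglongrightarrow> 0" .
  have "\<forall>\<^sub>F i in sequentially. (L2_norm \<mu> h)\<^sup>2 - 2 * Re (L2_inner \<mu> (Op i F h) g) + (L2_norm \<mu> (Op i F g))\<^sup>2
      = (L2_dist \<mu> h (Op i (\<lambda>\<omega>. cnj (F \<omega>)) g))\<^sup>2"
    using eventually_ge_at_top[of 1]
  proof eventually_elim
    case (elim i)
    interpret D: orthonormal_family \<mu> "card (P i)" "v i" "\<lambda>k. \<theta> i k / \<tau> i" by (rule orthonormal[OF elim])
    have "(L2_norm \<mu> (Op i (\<lambda>\<omega>. cnj (F \<omega>)) g))\<^sup>2 = (L2_norm \<mu> (Op i F g))\<^sup>2"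
      unfolding D.Op_norm_square by simp
    then show ?case
      unfolding L2_norm_square_diff[OF L(1) D.Op_L2] D.Op_adjoint[OF g L(1)] by simp
  qed
  from Lim_transform_eventually[OF lim this]
  have "(\<lambda>i. sqrt ((L2_dist \<mu> h (Op i (\<lambda>\<omega>. cnj (F \<omega>)) g))\<^sup>2)) \<longlonglongrightarrow> sqrt 0"
    by (rule tendsto_real_sqrt)
  then show "(\<lambda>i. L2_dist \<mu> h (Op i (\<lambda>\<omega>. cnj (F \<omega>)) g)) \<longlonglongrightarrow> 0" by simp
qed

text \<open>On both sides the Laplace sum is the same combination of evolutions at grid times. Its
  weights are at most \<open>\<tau> i\<close>, which turns the sum of the errors into
  \<open>mean_error\<close>.\<close>

lemma laplace_sum_koopman_error:
  fixes t :: real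
  assumes i: "i \<ge> 1" and g: "g \<in> L2 \<mu>"
  defines "N \<equiv> nat \<lfloor>t / \<tau> i\<rfloor>"
  obtains k where "HS (laplace_sum (\<tau> i) N) g k"
    "L2_dist \<mu> k (Op i (laplace_sum (\<tau> i) N) g) \<le> mean_error t i g"
proof -
  interpret D: cell_flow nrm X S \<mu> "P i" "T i" "v i" "\<theta> i" "\<tau> i" "l i" by (rule cell_flow[OF i])
  define c where "c m = complex_of_real (\<tau> i * exp (- (real m * \<tau> i)))" for m
  define k where "k x = (\<Sum>m=1..N. c m * g (S (real m * \<tau> i) x))" for x
  have c: "cmod (c m) \<le> \<tau> i" for m
    using \<tau>_pos[OF i] by (simp add: c_def norm_mult mult_le_cancel_left1)
  have k: "HS (laplace_sum (\<tau> i) N) g k"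
    unfolding laplace_sum_def[abs_def] k_def[abs_def] c_def
    by (intro HS_sum[OF g] koopman_HS g) auto
  have Ops: "Op i (laplace_sum (\<tau> i) N) g x =
      (\<Sum>m=1..N. c m * Op i (\<lambda>\<omega>. exp (\<i> * of_real (\<omega> * (real m * \<tau> i)))) g x)" for x
    unfolding eigen_calculus_def laplace_sum_def c_def[symmetric] sum_distrib_left sum_distrib_right
    by (subst sum.swap) (simp add: mult.assoc)
  have "AE x in \<mu>. \<forall>m\<in>{1..N}. D.U m g x = Op i (\<lambda>\<omega>. exp (\<i> * of_real (\<omega> * (real m * \<tau> i)))) g x"
    by (intro AE_finite_allI D.U_eq_Op[OF g]) auto
  then have "AE x in \<mu>. k x - Op i (laplace_sum (\<tau> i) N) g x =
      (\<Sum>m=1..N. c m * (g (S (real m * \<tau> i) x) - D.U m g x))"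
    by eventually_elim (simp add: Ops k_def sum_subtractf[symmetric] right_diff_distrib)
  then have "L2_dist \<mu> k (Op i (laplace_sum (\<tau> i) N) g) =
      L2_norm \<mu> (\<lambda>x. \<Sum>m=1..N. c m * (g (S (real m * \<tau> i) x) - D.U m g x))"
    by (intro L2_norm_cong_AE L2_diff L2_sum L2_scale D.Op_L2 D.U_L2 koopman_L2 g HS_L2[OF k])
  also have "\<dots> \<le> (\<Sum>m=1..N. L2_norm \<mu> (\<lambda>x. c m * (g (S (real m * \<tau> i) x) - D.U m g x)))"
    by (intro L2_norm_sum_le L2_diff L2_scale D.U_L2 koopman_L2 g)
  also have "\<dots> \<le> (\<Sum>m=1..N. \<tau> i * error i m g)"
    unfolding L2_norm_scale error_def D.U_def[symmetric]
    by (intro sum_mono mult_right_mono c) auto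
  also have "\<dots> = mean_error t i g"
    by (simp add: mean_error_def N_def sum_distrib_left)
  finally show thesis using that k by blast
qed

text \<open>The Laplace sum mediates between the two resolvents. It is close to the discrete one on
  the entire discrete spectrum. For the flow it is close only on frequencies resolved by the mesh;
  outside a window the bound \<open>t + 1\<close> (at most \<open>t\<close> for the sum, 1 for the
  resolvent) multiplies the small mass of \<open>g\<close> there. Hence \<open>t\<close> is fixed
  first, then the window, then \<open>i\<close>.\<close>

lemma converges_resolvent: "converges resolvent"
  unfolding converges_def
proof (intro conjI ballI allI impI bounded_borel_resolvent)
  fix g h assume g: "g \<in> L2 \<mu>" and h: "HS resolvent g h"
  obtain C where C: "C > 0" "\<And>t N \<omega>. 0 < t \<Longrightarrow> t \<le> 1 \<Longrightarrow> \<bar>\<omega> * t\<bar> \<le> pi \<Longrightarrow>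
    cmod (laplace_sum t N \<omega> - resolvent \<omega>) \<le> C * (t + exp (- (real N * t)))"
    using laplace_sum_approx by blast
  define a where "a = L2_norm \<mu> g"
  have a: "a \<ge> 0" by (simp add: a_def)
  show "(\<lambda>i. L2_dist \<mu> h (Op i resolvent g)) \<longlonglongrightarrow> 0"
  proof (rule LIMSEQ_I)
    fix e :: real assume e: "e > 0"
    \<comment> \<open>The Laplace error \<open>C * d * a\<close> occurs twice, for the flow and for
      the discrete operators, with total below e / 4; the window and the mean error take e / 4
      each.\<close>
    obtain d where d: "d > 0" "d * (2 * C * a) < e / 4"
      using small_factor[of "e / 4" "2 * C * a"] e C a by auto
    \<comment> \<open>The truncation time is at least \<open>t - \<tau> i\<close>, hence at least
      \<open>t - 1\<close>: this is the 1 in the exponent.\<close>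
    obtain t where t: "t > 0" "exp (1 - t) < d / 2"
    proof
      have "exp (1 - (2 + \<bar>ln (d / 2)\<bar>)) < exp (ln (d / 2))" by simp
      then show "exp (1 - (2 + \<bar>ln (d / 2)\<bar>)) < d / 2" using d by simp
    qed simp
    have "(\<lambda>j. (t + 1) * L2_dist \<mu> g (E {\<omega>. \<bar>\<omega>\<bar> < real j} g)) \<longlonglongrightarrow> (t + 1) * 0"
      by (intro tendsto_intros E_exhausts g)
    then have "\<forall>\<^sub>F j in sequentially. (t + 1) * L2_dist \<mu> g (E {\<omega>. \<bar>\<omega>\<bar> < real j} g) < e / 4"
      by (rule order_tendstoD(2)) (use e in simp)
    then obtain j where j: "(t + 1) * L2_dist \<mu> g (E {\<omega>. \<bar>\<omega>\<bar> < real j} g) < e / 4"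
      by (auto simp: eventually_sequentially)
    have "\<forall>\<^sub>F i in sequentially. \<tau> i < min (min 1 (d / 2)) (pi / (real j + 1))"
      by (rule order_tendstoD(2)[OF \<tau>_0]) (use d in simp)
    moreover have "\<forall>\<^sub>F i in sequentially. mean_error t i g < e / 4"
      by (rule order_tendstoD(2)[OF mean_error_tendsto_0[OF g t(1)]]) (use e in simp)
    ultimately have "\<forall>\<^sub>F i in sequentially. norm (L2_dist \<mu> h (Op i resolvent g) - 0) < e"
      using eventually_ge_at_top[of 1]
    proof eventually_elim
      case (elim i)
      interpret D: cell_flow nrm X S \<mu> "P i" "T i" "v i" "\<theta> i" "\<tau> i" "l i" by (rule cell_flow[OF elim(3)])
      define N where "N = nat \<lfloor>t / \<tau> i\<rfloor>"
      define F where "F = laplace_sum (\<tau> i) N"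
      have \<tau>: "0 < \<tau> i" "\<tau> i \<le> 1" "\<tau> i < d / 2" "\<tau> i < pi / (real j + 1)"
        using elim \<tau>_pos by auto
      obtain k where k: "HS F g k" "L2_dist \<mu> k (Op i F g) \<le> mean_error t i g"
        using laplace_sum_koopman_error[OF elim(3) g] unfolding F_def N_def by blast
      have Nt: "real N * \<tau> i \<le> t" unfolding N_def by (rule steps_le[OF elim(3) t(1)])
      have "t / \<tau> i - 1 \<le> real N" using t \<tau> unfolding N_def by linarith
      then have "t - \<tau> i \<le> real N * \<tau> i" using \<tau>(1) by (simp add: field_simps)
      then have "- (real N * \<tau> i) \<le> 1 - t" using \<tau>(2) by linarith
      then have "exp (- (real N * \<tau> i)) \<le> exp (1 - t)" unfolding exp_le_cancel_iff .
      then have "\<tau> i + exp (- (real N * \<tau> i)) \<le> d" using t(2) \<tau>(3) by linarith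
      then have near: "cmod (F \<omega> - resolvent \<omega>) \<le> C * d" if "\<bar>\<omega> * \<tau> i\<bar> \<le> pi" for \<omega>
        unfolding F_def using C(1) by (intro order_trans[OF C(2)[OF \<tau>(1,2) that]] mult_left_mono) auto
      have bF: "cmod (F \<omega>) \<le> t" for \<omega>
        using cmod_laplace_sum_le[OF \<tau>(1), of N \<omega>] Nt by (simp add: F_def)
      have mF: "F \<in> borel_measurable borel"
        unfolding F_def laplace_sum_def[abs_def] by (intro borel_measurable_continuous_onI continuous_intros)
      have mR: "resolvent \<in> borel_measurable borel" using bounded_borel_resolvent by (simp add: bounded_borel_def)
      have "L2_norm \<mu> (\<lambda>x. 1 * h x + (-1) * k x) \<le> C * d * L2_norm \<mu> g + (t + 1) * L2_dist \<mu> g (E {\<omega>. \<bar>\<omega>\<bar> < real j} g)"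
      proof (rule HS_norm_le_split[OF HS_linear[OF h k(1) g] g])
        show "cmod (1 * resolvent \<omega> + (-1) * F \<omega>) \<le> t + 1" for \<omega>
          using norm_triangle_ineq4[of "resolvent \<omega>" "F \<omega>"] bF[of \<omega>] cmod_resolvent_le[of \<omega>] by simp
        fix \<omega> assume "\<omega> \<in> {\<omega>. \<bar>\<omega>\<bar> < real j}"
        \<comment> \<open>The bound pi / (real j + 1) on \<open>\<tau> i\<close> makes the mesh
          resolve the whole window; the added 1 covers \<open>j = 0\<close>.\<close>
        then have "\<bar>\<omega>\<bar> * \<tau> i \<le> (real j + 1) * (pi / (real j + 1))"
          using \<tau> by (intro mult_mono) auto
        then have "\<bar>\<omega> * \<tau> i\<bar> \<le> pi" using \<tau> by (simp add: abs_mult)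
        then show "cmod (1 * resolvent \<omega> + (-1) * F \<omega>) \<le> C * d" using near by (simp add: norm_minus_commute)
      qed (use C d mF mR in auto)
      then have hk: "L2_dist \<mu> h k \<le> C * d * a + (t + 1) * L2_dist \<mu> g (E {\<omega>. \<bar>\<omega>\<bar> < real j} g)"
        by (simp add: a_def)
      have "L2_dist \<mu> (Op i F g) (Op i resolvent g) = L2_norm \<mu> (Op i (\<lambda>\<omega>. 1 * F \<omega> + (-1) * resolvent \<omega>) g)"
        unfolding D.Op_add by simp
      also have "\<dots> \<le> C * d * L2_norm \<mu> g"
        by (rule D.Op_norm_le[OF g]) (use C d near D.frequency_bound in auto)
      finally have FR: "L2_dist \<mu> (Op i F g) (Op i resolvent g) \<le> C * d * a" by (simp add: a_def)
      have "L2_dist \<mu> h (Op i resolvent g) \<le> L2_dist \<mu> h k + L2_dist \<mu> k (Op i resolvent g)"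
        by (intro L2_norm_triangle_diff HS_L2[OF h] HS_L2[OF k(1)] D.Op_L2)
      moreover have "L2_dist \<mu> k (Op i resolvent g) \<le> L2_dist \<mu> k (Op i F g) + L2_dist \<mu> (Op i F g) (Op i resolvent g)"
        by (intro L2_norm_triangle_diff HS_L2[OF k(1)] D.Op_L2)
      moreover have "d * (2 * C * a) = C * d * a + C * d * a" by (simp add: algebra_simps)
      ultimately have "L2_dist \<mu> h (Op i resolvent g) < e"
        using hk FR k(2) elim(2) j d(2) e by linarith
      then show ?case by simp
    qed
    then show "\<exists>n0. \<forall>i\<ge>n0. norm (L2_dist \<mu> h (Op i resolvent g) - 0) < e" by (simp add: eventually_sequentially)
  qed
qed

end

section \<open>Continuous functions of the generator\<close>

context periodic_approximation
begin

lemma converges_polynomial: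
  assumes "real_polynomial_function p"
  shows "converges (\<lambda>\<omega>. of_real (p (resolvent \<omega>) - p 0))"
  using assms
proof induction
  case (linear f)
  interpret bounded_linear f by fact
  \<comment> \<open>A real polynomial on the complex plane is one in Re z and Im z. These
    coefficients rewrite a real-linear form through z and its conjugate, which is why adjoints are
    needed.\<close>
  let ?a = "of_real (f 1) / 2 :: complex" and ?b = "\<i> * of_real (- f \<i> / 2) :: complex"
  have f: "f z = Re z * f 1 + Im z * f \<i>" for z
  proof -
    have "f z = f (Re z *\<^sub>R 1 + Im z *\<^sub>R \<i>)" by (rule arg_cong[where f=f]) (simp add: complex_eq_iff)
    then show ?thesis by (simp only: add scale real_scaleR_def)
  qed
  have "(\<lambda>\<omega>. of_real (f (resolvent \<omega>) - f 0)) =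
      (\<lambda>\<omega>. (?a + ?b) * resolvent \<omega> + (?a - ?b) * cnj (resolvent \<omega>))"
  proof
    fix \<omega>
    show "of_real (f (resolvent \<omega>) - f 0) = (?a + ?b) * resolvent \<omega> + (?a - ?b) * cnj (resolvent \<omega>)"
      unfolding zero f[of "resolvent \<omega>"] by (simp add: complex_eq_iff algebra_simps)
  qed
  then show ?case
    using converges_add_scale[OF converges_resolvent converges_cnj[OF converges_resolvent]] by simp
next
  case (const c)
  show ?case using converges_add_scale[OF converges_resolvent converges_resolvent, of 0 0] by simp
next
  case (add f g)
  show ?case using converges_add_scale[OF add.IH, of 1 1] by (simp add: algebra_simps)
next
  case (mult f g)
  \<comment> \<open>f * g - f 0 * g 0 is rearranged so that every factor depending on \<omega>
    vanishes at 0.\<close>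
  have "converges (\<lambda>\<omega>. 1 * ((of_real (f (resolvent \<omega>) - f 0)) * of_real (g (resolvent \<omega>) - g 0)) +
      1 * (of_real (f 0) * of_real (g (resolvent \<omega>) - g 0) + of_real (g 0) * of_real (f (resolvent \<omega>) - f 0)))"
    by (intro converges_add_scale converges_mult mult.IH)
  then show ?case by (simp add: algebra_simps)
qed

text \<open>Stone-Weierstrass on the circle traced by \<^const>\<open>resolvent\<close>, closed up by the point \<open>0\<close> that
  represents infinity; \<open>\<omega> = - Im (1 / z)\<close> inverts \<open>z = resolvent \<omega>\<close>.\<close>

lemma converges_compact_support:
  fixes f :: "real \<Rightarrow> real"
  assumes cont: "continuous_on UNIV f" and supp: "\<And>\<omega>. \<bar>\<omega>\<bar> \<ge> R \<Longrightarrow> f \<omega> = 0"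
  shows "converges (\<lambda>\<omega>. of_real (f \<omega>))"
proof (rule converges_uniform_limit)
  \<comment> \<open>The circle of points with squared modulus equal to the real part, that is, with
    Re (1 / z) = 1 away from 0.\<close>
  define K where "K = sphere (1/2::complex) (1/2)"
  define G where "G z = (if z = 0 then 0 else f (- Im (1 / z)))" for z :: complex
  have K_eq: "K = {z. (cmod z)\<^sup>2 = Re z}"
  proof -
    have "z \<in> K \<longleftrightarrow> (cmod z)\<^sup>2 = Re z" for z
    proof -
      have "z \<in> K \<longleftrightarrow> (cmod (1/2 - z))\<^sup>2 = (1/2)\<^sup>2"
        by (simp add: K_def dist_norm power2_eq_iff_nonneg)
      also have "\<dots> \<longleftrightarrow> (cmod z)\<^sup>2 = Re z"
      proof -
        have "(cmod (1/2 - z))\<^sup>2 - (1/2)\<^sup>2 = (cmod z)\<^sup>2 - Re z"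
          unfolding cmod_power2 by (simp add: power2_eq_square algebra_simps)
        then show ?thesis by linarith
      qed
      finally show ?thesis .
    qed
    then show ?thesis by auto
  qed
  have res: "1 / resolvent \<omega> = 1 - \<i> * of_real \<omega>" "resolvent \<omega> \<noteq> 0" for \<omega>
    using resolvent_denominator[of \<omega>] by (simp_all add: resolvent_def)
  have G_res: "G (resolvent \<omega>) = f \<omega>" for \<omega> using res[of \<omega>] by (simp add: G_def)
  have "(cmod (resolvent \<omega>))\<^sup>2 = Re (resolvent \<omega>)" for \<omega>
    by (simp add: resolvent_def norm_divide cmod_power2 power_divide Re_divide)
  then have K_res: "resolvent \<omega> \<in> K" "0 \<in> K" for \<omega> by (auto simp: K_eq)
  \<comment> \<open>If z on the circle is closer to 0 than \<open>d\<close>, the modulus of 1 / z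
    exceeds 1 + |R| while its real part is 1, so the frequency lies where \<open>f\<close> vanishes.
    Thus \<open>G\<close> is 0 near 0, which gives its continuity there.\<close>
  define d where "d = 1 / (1 + \<bar>R\<bar>)"
  have d: "d > 0" by (simp add: d_def add_pos_nonneg)
  have near: "G z = 0" if z: "z \<in> K" "cmod z < d" for z
  proof (cases "z = 0")
    case False
    have "Re (1 / z) = Re z / (cmod z)\<^sup>2" by (simp add: Re_divide cmod_power2)
    moreover have "(cmod z)\<^sup>2 = Re z" "(cmod z)\<^sup>2 \<noteq> 0" using z(1) False by (auto simp: K_eq)
    ultimately have "Re (1 / z) = 1" by simp
    then have "cmod (1 / z) \<le> 1 + \<bar>Im (1 / z)\<bar>" using cmod_le[of "1 / z"] by simp
    moreover have "1 + \<bar>R\<bar> < cmod (1 / z)" using z(2) False d by (simp add: d_def norm_divide field_simps)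
    ultimately have "R \<le> \<bar>- Im (1 / z)\<bar>" by simp
    then show ?thesis using False supp by (simp add: G_def)
  qed (simp add: G_def)
  have "K = (K - {0}) \<union> (K \<inter> ball 0 d)" using d by auto
  moreover have "continuous_on ((K - {0}) \<union> (K \<inter> ball 0 d)) G"
  proof (rule continuous_on_Un_local_open)
    note eq = \<open>K = (K - {0}) \<union> (K \<inter> ball 0 d)\<close>[symmetric]
    show "openin (top_of_set (K - {0} \<union> K \<inter> ball 0 d)) (K - {0})" unfolding eq
      by (auto simp: openin_open intro!: exI[of _ "- {0}"])
    show "openin (top_of_set (K - {0} \<union> K \<inter> ball 0 d)) (K \<inter> ball 0 d)" unfolding eq
      by (auto simp: openin_open)
    have "continuous_on (K - {0}) (\<lambda>z. f (- Im (1 / z)))"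
      by (intro continuous_on_compose2[OF cont] continuous_intros) auto
    then show "continuous_on (K - {0}) G"
      by (rule continuous_on_eq) (simp add: G_def)
    show "continuous_on (K \<inter> ball 0 d) G"
      by (rule continuous_on_eq[OF continuous_on_const[of _ 0]]) (simp add: near)
  qed
  ultimately have contG: "continuous_on K G" by simp
  show "\<exists>H. converges H \<and> (\<forall>\<omega>. cmod (of_real (f \<omega>) - H \<omega>) \<le> e)" if e: "e > 0" for e
  proof -
    \<comment> \<open>Half of \<open>e\<close> is spent on the circle and half on dropping
      \<open>p 0\<close>, which is small because \<open>G\<close> vanishes at 0.\<close>
    obtain p where p: "real_polynomial_function p" "\<And>z. z \<in> K \<Longrightarrow> \<bar>G z - p z\<bar> < e / 2"
      using Stone_Weierstrass_real_polynomial_function[OF _ contG, of "e / 2"] e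
      unfolding K_def by (metis compact_sphere half_gt_zero)
    have "cmod (of_real (f \<omega>) - of_real (p (resolvent \<omega>) - p 0)) \<le> e" for \<omega>
    proof -
      have "\<bar>f \<omega> - (p (resolvent \<omega>) - p 0)\<bar> \<le> e"
      proof -
        have "\<bar>f \<omega> - p (resolvent \<omega>)\<bar> < e / 2" using p(2)[OF K_res(1)[of \<omega>]] unfolding G_res .
        moreover have "\<bar>p 0\<bar> < e / 2" using p(2)[OF K_res(2)] by (simp add: G_def)
        ultimately show ?thesis by linarith
      qed
      then show ?thesis unfolding of_real_diff[symmetric] norm_of_real .
    qed
    then show ?thesis using converges_polynomial[OF p(1)] by blast
  qed
  have "compact (f ` {-\<bar>R\<bar>..\<bar>R\<bar>})"
    by (intro compact_continuous_image continuous_on_subset[OF cont]) auto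
  then obtain C where C: "\<And>y. y \<in> f ` {-\<bar>R\<bar>..\<bar>R\<bar>} \<Longrightarrow> norm y \<le> C"
    using compact_imp_bounded bounded_iff by metis
  have "\<bar>f \<omega>\<bar> \<le> \<bar>C\<bar>" for \<omega>
  proof (cases "\<bar>\<omega>\<bar> \<ge> R")
    case True then show ?thesis using supp by simp
  next
    case False
    then have "\<omega> \<in> {-\<bar>R\<bar>..\<bar>R\<bar>}" by auto
    then show ?thesis using C[of "f \<omega>"] by auto
  qed
  then show "bounded_borel (\<lambda>\<omega>. of_real (f \<omega>))"
    by (intro bounded_borelI[of _ "\<bar>C\<bar>"] borel_measurable_continuous_onI continuous_on_of_real cont) auto
qed

text \<open>A cutoff \<open>\<phi>\<close> in frequency reduces the claim to compact support. No mass of \<open>g\<close> escapes to high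
  discrete frequencies, since \<open>(1 - \<phi>)\<^sup>2 \<le> 1 - \<phi>\<^sup>2\<close> and the norms of the truncations converge.\<close>

lemma converges_bounded_continuous:
  fixes f :: "real \<Rightarrow> real"
  assumes cont: "continuous_on UNIV f" and bd: "\<And>\<omega>. \<bar>f \<omega>\<bar> \<le> C"
  shows "converges (\<lambda>\<omega>. of_real (f \<omega>))"
  unfolding converges_def
proof (intro conjI ballI allI impI)
  let ?f = "\<lambda>\<omega>. complex_of_real (f \<omega>)"
  have mf: "?f \<in> borel_measurable borel"
    by (intro borel_measurable_continuous_onI continuous_on_of_real cont)
  show "bounded_borel ?f" by (rule bounded_borelI[OF mf, of C]) (use bd in simp)
  have C: "C \<ge> 0" using order_trans[OF abs_ge_zero bd] .
  fix g h assume g: "g \<in> L2 \<mu>" and h: "HS ?f g h"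
  define a where "a = L2_norm \<mu> g"
  have a: "a \<ge> 0" by (simp add: a_def)
  show "(\<lambda>i. L2_dist \<mu> h (Op i ?f g)) \<longlonglongrightarrow> 0"
  proof (rule LIMSEQ_I)
    fix e :: real assume e: "e > 0"
    \<comment> \<open>\<open>C * d\<close> bounds the part of \<open>h\<close> cut off by \<phi>,
      and \<open>C * sqrt (4 * a * d)\<close> the discrete part cut off; the remaining e / 2 is for
      the truncated symbol.\<close>
    have "((\<lambda>d. C * d + C * sqrt (4 * a * d)) \<longlongrightarrow> C * 0 + C * sqrt (4 * a * 0)) (at_right 0)"
      by (intro tendsto_intros)
    then have "\<forall>\<^sub>F d in at_right 0. C * d + C * sqrt (4 * a * d) < e / 2"
      by (rule order_tendstoD(2)) (use e in simp)
    then obtain d where d: "d > 0" "C * d + C * sqrt (4 * a * d) < e / 2"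
      unfolding eventually_at_right_field by (metis dense)
    have "\<forall>\<^sub>F j in sequentially. L2_dist \<mu> g (E {\<omega>. \<bar>\<omega>\<bar> < real j} g) < d"
      by (rule order_tendstoD(2)[OF E_exhausts[OF g] d(1)])
    then obtain j where j: "L2_dist \<mu> g (E {\<omega>. \<bar>\<omega>\<bar> < real j} g) < d"
      by (auto simp: eventually_sequentially)
    define \<phi> where "\<phi> \<omega> = max 0 (min 1 (real j + 1 - \<bar>\<omega>\<bar>))" for \<omega> :: real
    have \<phi>: "0 \<le> \<phi> \<omega>" "\<phi> \<omega> \<le> 1" "\<bar>\<omega>\<bar> < real j \<Longrightarrow> \<phi> \<omega> = 1" "\<bar>\<omega>\<bar> \<ge> real j + 1 \<Longrightarrow> \<phi> \<omega> = 0" for \<omega>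
      by (auto simp: \<phi>_def)
    have c\<phi>: "continuous_on UNIV \<phi>" unfolding \<phi>_def by (intro continuous_intros)
    have conv\<phi>: "converges (\<lambda>\<omega>. of_real (\<phi> \<omega>))"
      by (rule converges_compact_support[OF c\<phi>, of "real j + 1"]) (rule \<phi>(4))
    have convf\<phi>: "converges (\<lambda>\<omega>. of_real (f \<omega> * \<phi> \<omega>))"
      by (rule converges_compact_support[of _ "real j + 1"]) (auto intro!: continuous_intros cont c\<phi> simp: \<phi>)
    have m\<phi>: "(\<lambda>\<omega>. complex_of_real (\<phi> \<omega>)) \<in> borel_measurable borel"
      by (intro borel_measurable_continuous_onI continuous_on_of_real c\<phi>)
    have mf\<phi>: "(\<lambda>\<omega>. complex_of_real (f \<omega> * \<phi> \<omega>)) \<in> borel_measurable borel"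
      using mf m\<phi> by simp
    obtain k where k: "HS (\<lambda>\<omega>. of_real (\<phi> \<omega>)) g k" using HS_ex[OF converges_bounded_borel[OF conv\<phi>] g] .
    obtain h' where h': "HS (\<lambda>\<omega>. of_real (f \<omega> * \<phi> \<omega>)) g h'" using HS_ex[OF converges_bounded_borel[OF convf\<phi>] g] .
    note L = HS_L2[OF h] HS_L2[OF k] HS_L2[OF h']
    have "L2_norm \<mu> (\<lambda>x. 1 * h x + (-1) * h' x) \<le> 0 * L2_norm \<mu> g + C * L2_dist \<mu> g (E {\<omega>. \<bar>\<omega>\<bar> < real j} g)"
    proof (rule HS_norm_le_split[OF HS_linear[OF h h' g] g])
      show "cmod (1 * ?f \<omega> + (-1) * of_real (f \<omega> * \<phi> \<omega>)) \<le> C" for \<omega>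
      proof -
        have "1 * ?f \<omega> + (-1) * of_real (f \<omega> * \<phi> \<omega>) = of_real (f \<omega> * (1 - \<phi> \<omega>))" by (simp add: algebra_simps)
        moreover have "\<bar>f \<omega> * (1 - \<phi> \<omega>)\<bar> \<le> C * 1"
          unfolding abs_mult using bd \<phi>[of \<omega>] C by (intro mult_mono) auto
        ultimately show ?thesis by (simp del: of_real_mult)
      qed
    qed (use mf m\<phi> \<phi> in auto)
    then have hh': "L2_dist \<mu> h h' \<le> C * d"
      using mult_left_mono[OF less_imp_le[OF j] C] by simp
    have "L2_norm \<mu> (\<lambda>x. 1 * (1 * g x) + (-1) * k x) \<le> 0 * L2_norm \<mu> g + 1 * L2_dist \<mu> g (E {\<omega>. \<bar>\<omega>\<bar> < real j} g)"
    proof (rule HS_norm_le_split[OF HS_linear[OF HS_const[OF g] k g] g])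
      show "cmod (1 * 1 + (-1) * of_real (\<phi> \<omega>)) \<le> 1" for \<omega>
      proof -
        have "1 * 1 + (-1) * of_real (\<phi> \<omega>) = complex_of_real (1 - \<phi> \<omega>)" by simp
        then show ?thesis using \<phi>[of \<omega>] by (simp only: norm_of_real)
      qed
    qed (use m\<phi> \<phi> in auto)
    then have gk: "L2_dist \<mu> g k < d" using j by simp
    have nk: "(\<lambda>i. L2_dist \<mu> k (Op i (\<lambda>\<omega>. of_real (\<phi> \<omega>)) g)) \<longlonglongrightarrow> 0"
      by (rule convergesD[OF conv\<phi> g k])
    have "\<forall>\<^sub>F i in sequentially. L2_dist \<mu> k (Op i (\<lambda>\<omega>. of_real (\<phi> \<omega>)) g) < d"
      by (rule order_tendstoD(2)[OF nk d(1)])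
    moreover have "\<forall>\<^sub>F i in sequentially. L2_dist \<mu> h' (Op i (\<lambda>\<omega>. of_real (f \<omega> * \<phi> \<omega>)) g) < e / 2"
      by (rule order_tendstoD(2)[OF convergesD[OF convf\<phi> g h']]) (use e in simp)
    ultimately have "\<forall>\<^sub>F i in sequentially. norm (L2_dist \<mu> h (Op i ?f g) - 0) < e"
      using eventually_ge_at_top[of 1]
    proof eventually_elim
      case (elim i)
      interpret D: orthonormal_family \<mu> "card (P i)" "v i" "\<lambda>k. \<theta> i k / \<tau> i" by (rule orthonormal[OF elim(3)])
      define w where "w k = \<theta> i k / \<tau> i" for k
      define b where "b = L2_norm \<mu> (Op i (\<lambda>\<omega>. of_real (\<phi> \<omega>)) g)"
      have b: "b \<ge> 0" by (simp add: b_def)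
      have "b \<le> 1 * a"
        unfolding a_def b_def by (rule D.Op_norm_le[OF g]) (use \<phi> in auto)
      then have ba: "b \<le> a" by simp
      \<comment> \<open>The truncated vector for the flow is within \<open>d\<close> of
        \<open>g\<close>, and the discrete truncations converge to it; so the latter lose at most
        \<open>2 * d\<close> of the norm of \<open>g\<close>.\<close>
      have "a - b \<le> L2_dist \<mu> g (Op i (\<lambda>\<omega>. of_real (\<phi> \<omega>)) g)"
        using L2_norm_triangle_rev[OF g D.Op_L2, of "\<lambda>\<omega>. of_real (\<phi> \<omega>)" g] by (simp add: a_def b_def)
      also have "\<dots> \<le> L2_dist \<mu> g k + L2_dist \<mu> k (Op i (\<lambda>\<omega>. of_real (\<phi> \<omega>)) g)"
        by (intro L2_norm_triangle_diff g L D.Op_L2)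
      also have "\<dots> \<le> 2 * d" using gk elim(1) by simp
      finally have ab: "a - b \<le> 2 * d" .
      have "(L2_norm \<mu> (Op i (\<lambda>\<omega>. of_real (1 - \<phi> \<omega>)) g))\<^sup>2 + b\<^sup>2 \<le> a\<^sup>2"
      proof -
        have "(L2_norm \<mu> (Op i (\<lambda>\<omega>. of_real (1 - \<phi> \<omega>)) g))\<^sup>2 + b\<^sup>2 =
          (\<Sum>k=1..card (P i). ((1 - \<phi> (w k))\<^sup>2 + (\<phi> (w k))\<^sup>2) * (cmod (L2_inner \<mu> (v i k) g))\<^sup>2)"
          unfolding b_def D.Op_norm_square w_def norm_of_real power_mult_distrib power2_abs
          by (simp add: sum.distrib distrib_right)
        also have "\<dots> \<le> (\<Sum>k=1..card (P i). 1 * (cmod (L2_inner \<mu> (v i k) g))\<^sup>2)"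
        proof (intro sum_mono mult_right_mono)
          fix k
          have "0 \<le> 2 * \<phi> (w k) * (1 - \<phi> (w k))" using \<phi>[of "w k"] by simp
          then show "(1 - \<phi> (w k))\<^sup>2 + (\<phi> (w k))\<^sup>2 \<le> 1" by (simp add: power2_eq_square algebra_simps)
        qed simp
        also have "\<dots> \<le> a\<^sup>2" using D.Bessel[OF g] by (simp add: a_def)
        finally show ?thesis .
      qed
      then have "(L2_norm \<mu> (Op i (\<lambda>\<omega>. of_real (1 - \<phi> \<omega>)) g))\<^sup>2 \<le> a\<^sup>2 - b\<^sup>2" by simp
      also have "\<dots> = (a + b) * (a - b)" by (simp add: power2_eq_square algebra_simps)
      also have "\<dots> \<le> (2 * a) * (2 * d)" using ba ab a b d by (intro mult_mono) auto
      finally have "sqrt ((L2_norm \<mu> (Op i (\<lambda>\<omega>. of_real (1 - \<phi> \<omega>)) g))\<^sup>2) \<le> sqrt (4 * a * d)"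
        by (intro real_sqrt_le_mono) simp
      then have tail: "L2_norm \<mu> (Op i (\<lambda>\<omega>. of_real (1 - \<phi> \<omega>)) g) \<le> sqrt (4 * a * d)" by simp
      \<comment> \<open>The two symbols differ by -f * (1 - \<phi>), so multiplicativity reduces
        their distance to the tail estimate.\<close>
      have "L2_dist \<mu> (Op i (\<lambda>\<omega>. of_real (f \<omega> * \<phi> \<omega>)) g) (Op i ?f g) =
          L2_norm \<mu> (Op i (\<lambda>\<omega>. (1) * of_real (f \<omega> * \<phi> \<omega>) + (-1) * ?f \<omega>) g)"
        unfolding D.Op_add by simp
      also have "\<dots> = L2_norm \<mu> (Op i (\<lambda>\<omega>. (- ?f \<omega>) * of_real (1 - \<phi> \<omega>)) g)"
        by (simp add: algebra_simps)
      also have "\<dots> = L2_norm \<mu> (Op i (\<lambda>\<omega>. - ?f \<omega>) (Op i (\<lambda>\<omega>. of_real (1 - \<phi> \<omega>)) g))"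
        unfolding D.Op_mult ..
      also have "\<dots> \<le> C * L2_norm \<mu> (Op i (\<lambda>\<omega>. of_real (1 - \<phi> \<omega>)) g)"
        by (rule D.Op_norm_le[OF D.Op_L2]) (use bd C in auto)
      also have "\<dots> \<le> C * sqrt (4 * a * d)" by (rule mult_left_mono[OF tail C])
      finally have 1: "L2_dist \<mu> (Op i (\<lambda>\<omega>. of_real (f \<omega> * \<phi> \<omega>)) g) (Op i ?f g) \<le> C * sqrt (4 * a * d)" .
      have 2: "L2_dist \<mu> h (Op i ?f g) \<le> L2_dist \<mu> h h' + L2_dist \<mu> h' (Op i ?f g)"
        by (intro L2_norm_triangle_diff L D.Op_L2)
      have 3: "L2_dist \<mu> h' (Op i ?f g) \<le> L2_dist \<mu> h' (Op i (\<lambda>\<omega>. of_real (f \<omega> * \<phi> \<omega>)) g)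
          + L2_dist \<mu> (Op i (\<lambda>\<omega>. of_real (f \<omega> * \<phi> \<omega>)) g) (Op i ?f g)"
        by (intro L2_norm_triangle_diff L D.Op_L2)
      have "L2_dist \<mu> h (Op i ?f g) < e"
        using 1 2 3 hh' elim(2) d(2) by linarith
      then show ?case by simp
    qed
    then show "\<exists>N. \<forall>i\<ge>N. norm (L2_dist \<mu> h (Op i ?f g) - 0) < e" by (simp add: eventually_sequentially)
  qed
qed

text \<open>The eigenfunctions are cell functions, and averaging does not change inner products with
  these.\<close>

lemma Op_averaging:
  assumes "i \<ge> 1" and g: "g \<in> L2 \<mu>"
  shows "Op i F (averaging \<mu> (P i) g) = Op i F g"
proof -
  interpret D: cell_flow nrm X S \<mu> "P i" "T i" "v i" "\<theta> i" "\<tau> i" "l i" by (rule cell_flow[OF assms(1)])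
  show ?thesis
    unfolding D.Op_eq
    by (intro ext sum.cong refl) (simp add: D.inner_cell_space_averaging[OF D.v_cell_space g])
qed

end

section \<open>Regularity of the smoothed indicator\<close>

lemma isCont_bump: "isCont (\<lambda>s::real. if s > 0 then exp (- 1 / s) else 0) x"
proof -
  let ?\<eta> = "\<lambda>s::real. if s > 0 then exp (- 1 / s) else 0"
  consider "x > 0" | "x < 0" | "x = 0" by linarith
  then show ?thesis
  proof cases
    case 1
    have "isCont (\<lambda>s. exp (- 1 / s)) x" using 1 by (intro continuous_intros) auto
    moreover have "\<forall>\<^sub>F s in nhds x. ?\<eta> s = exp (- 1 / s)"
      using eventually_nhds_in_open[of "{0<..}" x] 1 by (auto elim: eventually_mono)
    ultimately show ?thesis by (simp add: isCont_cong)
  next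
    case 2
    have "\<forall>\<^sub>F s in nhds x. ?\<eta> s = 0"
      using eventually_nhds_in_open[of "{..<0}" x] 2 by (auto elim!: eventually_mono)
    then show ?thesis by (simp add: isCont_cong)
  next
    case 3
    \<comment> \<open>Inverting 1 / s \<le> exp (1 / s) shows that the bump is at most s for s > 0,
      which settles continuity at 0.\<close>
    have "norm (?\<eta> s) \<le> \<bar>s\<bar>" for s
    proof (cases "s > 0")
      case True
      have "1 / s \<le> exp (1 / s)" using exp_ge_add_one_self[of "1 / s"] by linarith
      then have "inverse (exp (1 / s)) \<le> inverse (1 / s)" using True by (intro le_imp_inverse_le) auto
      then show ?thesis using True by (simp add: exp_minus)
    qed simp
    then have "((\<lambda>s. ?\<eta> s) \<longlongrightarrow> 0) (at 0)"
      by (intro Lim_null_comparison[OF always_eventually tendsto_rabs_zero[OF tendsto_ident_at]]) auto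
    then show ?thesis using 3 by (simp add: isCont_def)
  qed
qed

text \<open>The kernel is a multiple of the bump at \<open>1 - (u / \<alpha>)\<^sup>2\<close>.
  Taking the modulus of the multiple as \<open>c\<close> gives the bound without evaluating the
  normalising integral.\<close>

lemma mollifier_facts:
  assumes "\<alpha> > 0"
  obtains \<psi> c where "\<And>x y. mollifier \<alpha> x y = \<psi> (x - y)" "continuous_on UNIV \<psi>" "c \<ge> 0"
    "\<And>u. \<bar>\<psi> u\<bar> \<le> c * indicator {-\<alpha>..\<alpha>} u"
proof -
  define k where "k = inverse (LBINT u=-1..1. exp (- 1 / (1 - u\<^sup>2))) / \<alpha>"
  define \<psi> where "\<psi> u = k * (if 1 - (u / \<alpha>)\<^sup>2 > 0 then exp (- 1 / (1 - (u / \<alpha>)\<^sup>2)) else 0)" for u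
  have pos: "1 - (u / \<alpha>)\<^sup>2 > 0 \<longleftrightarrow> \<bar>u\<bar> < \<alpha>" for u
  proof -
    have "(u / \<alpha>)\<^sup>2 < 1 \<longleftrightarrow> \<bar>u / \<alpha>\<bar> < 1" by (rule abs_square_less_1)
    then show ?thesis using assms by (simp add: abs_divide)
  qed
  show thesis
  proof
    show "mollifier \<alpha> x y = \<psi> (x - y)" for x y
      unfolding mollifier_def \<psi>_def pos k_def by (simp add: power_divide)
    show "continuous_on UNIV \<psi>"
      unfolding \<psi>_def continuous_on_eq_continuous_at[OF open_UNIV]
      by (intro ballI continuous_mult continuous_const isCont_o2[OF _ isCont_bump] continuous_intros) (use assms in auto)
    show "\<bar>k\<bar> \<ge> 0" by simp
    show "\<bar>\<psi> u\<bar> \<le> \<bar>k\<bar> * indicator {-\<alpha>..\<alpha>} u" for u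
    proof (cases "1 - (u / \<alpha>)\<^sup>2 > 0")
      case True
      then have "u \<in> {-\<alpha>..\<alpha>}" unfolding pos by auto
      moreover have "\<bar>k\<bar> * exp (- 1 / (1 - (u / \<alpha>)\<^sup>2)) \<le> \<bar>k\<bar> * 1"
        using True by (intro mult_left_mono) auto
      ultimately show ?thesis using True by (simp add: \<psi>_def abs_mult)
    qed (simp add: \<psi>_def)
  qed
qed

text \<open>The kernel is bounded with support in an interval of length \<open>2 * \<alpha>\<close>,
  so the integral is bounded even for unbounded \<open>D\<close>; continuity follows by dominated
  convergence along sequences.\<close>

lemma smoothed_indicator_continuous_bounded:
  assumes "\<alpha> > 0" and D: "is_interval D"
  obtains C where "continuous_on UNIV (smoothed_indicator \<alpha> D)" "\<And>\<omega>. \<bar>smoothed_indicator \<alpha> D \<omega>\<bar> \<le> C"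
proof -
  obtain \<psi> c where \<psi>: "\<And>x y. mollifier \<alpha> x y = \<psi> (x - y)" "continuous_on UNIV \<psi>" "c \<ge> 0"
    "\<And>u. \<bar>\<psi> u\<bar> \<le> c * indicator {-\<alpha>..\<alpha>} u"
    using mollifier_facts[OF assms(1)] by blast
  have [measurable]: "D \<in> sets borel" by (rule real_interval_borel_measurable[OF D])
  have [measurable]: "(\<lambda>y. \<psi> (\<omega> - y)) \<in> borel_measurable borel" for \<omega>
    by (intro borel_measurable_continuous_onI continuous_on_compose2[OF \<psi>(2)] continuous_intros) auto
  have bd: "norm (\<psi> (\<omega> - y) * indicator D y) \<le> c * indicator {\<omega> - \<alpha>..\<omega> + \<alpha>} y" for \<omega> y
  proof -
    have "norm (\<psi> (\<omega> - y) * indicator D y) \<le> \<bar>\<psi> (\<omega> - y)\<bar>" by (simp add: indicator_def)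
    also have "\<dots> \<le> c * indicator {\<omega> - \<alpha>..\<omega> + \<alpha>} y"
      using \<psi>(4)[of "\<omega> - y"] by (auto simp: indicator_def split: if_splits)
    finally show ?thesis .
  qed
  have intg: "integrable lborel (\<lambda>y. c * indicator {a..b} y)" for a b :: real
    by (intro integrable_mult_right integrable_real_indicator) (auto simp: emeasure_lborel_Icc_eq)
  show thesis
  proof
    show "\<bar>smoothed_indicator \<alpha> D \<omega>\<bar> \<le> c * (2 * \<alpha>)" for \<omega>
    proof -
      have "norm (smoothed_indicator \<alpha> D \<omega>) \<le> (LINT y|lborel. norm (\<psi> (\<omega> - y) * indicator D y))"
        unfolding smoothed_indicator_def \<psi>(1) by (rule integral_norm_bound)
      also have "\<dots> \<le> (LINT y|lborel. c * indicator {\<omega> - \<alpha>..\<omega> + \<alpha>} y)"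
      proof (rule integral_mono[OF integrable_norm intg bd])
        show "integrable lborel (\<lambda>y. \<psi> (\<omega> - y) * indicator D y)"
          by (rule Bochner_Integration.integrable_bound[OF intg[of "\<omega> - \<alpha>" "\<omega> + \<alpha>"]])
             (use order_trans[OF bd abs_ge_self] in \<open>auto simp del: norm_mult abs_mult\<close>)
      qed
      also have "\<dots> = c * (2 * \<alpha>)" using assms(1) by simp
      finally show ?thesis by simp
    qed
    show "continuous_on UNIV (smoothed_indicator \<alpha> D)"
      unfolding continuous_on_eq_continuous_at[OF open_UNIV] continuous_at_sequentially
    proof (intro ballI allI impI)
      fix \<omega> :: real and u assume u: "u \<longlonglongrightarrow> \<omega>"
      \<comment> \<open>A convergent sequence stays within some \<open>R\<close> of its limit, so
        all shifted kernels are dominated on one compact interval.\<close>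
      then obtain R where R: "\<And>i. \<bar>u i - \<omega>\<bar> \<le> R"
        using convergent_imp_Bseq[of "\<lambda>i. u i - \<omega>"] tendsto_diff[OF u tendsto_const[of \<omega>]]
        by (auto simp: convergent_def Bseq_def)
      have "(\<lambda>i. LINT y|lborel. \<psi> (u i - y) * indicator D y) \<longlonglongrightarrow> (LINT y|lborel. \<psi> (\<omega> - y) * indicator D y)"
      proof (rule integral_dominated_convergence)
        show "integrable lborel (\<lambda>y. c * indicator {\<omega> - R - \<alpha>..\<omega> + R + \<alpha>} y)" by (rule intg)
        show "AE y in lborel. (\<lambda>i. \<psi> (u i - y) * indicator D y) \<longlonglongrightarrow> \<psi> (\<omega> - y) * indicator D y"
          by (intro AE_I2 tendsto_mult tendsto_const continuous_on_tendsto_compose[OF \<psi>(2)] tendsto_diff u) auto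
        show "AE y in lborel. norm (\<psi> (u i - y) * indicator D y) \<le> c * indicator {\<omega> - R - \<alpha>..\<omega> + R + \<alpha>} y" for i
        proof (rule AE_I2)
          fix y
          have "{u i - \<alpha>..u i + \<alpha>} \<subseteq> {\<omega> - R - \<alpha>..\<omega> + R + \<alpha>}"
            using R[of i] by (auto simp: abs_le_iff)
          then have "c * indicator {u i - \<alpha>..u i + \<alpha>} y \<le> c * indicator {\<omega> - R - \<alpha>..\<omega> + R + \<alpha>} y"
            using \<psi>(3) by (intro mult_left_mono) (auto simp: indicator_def)
          then show "norm (\<psi> (u i - y) * indicator D y) \<le> c * indicator {\<omega> - R - \<alpha>..\<omega> + R + \<alpha>} y"
            using bd[of "u i" y] by simp
        qed
      qed auto
      then show "(smoothed_indicator \<alpha> D \<circ> u) \<longlonglongrightarrow> smoothed_indicator \<alpha> D \<omega>"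
        by (simp add: smoothed_indicator_def \<psi>(1) comp_def)
    qed
  qed
qed

theorem corollary5p2:
  fixes nrm :: "real ^ 'N \<Rightarrow> real"
    and X :: "(real ^ 'N) set"
    and S :: "real \<Rightarrow> real ^ 'N \<Rightarrow> real ^ 'N"
    and \<mu> :: "(real ^ 'N) measure"
    and E :: "real set \<Rightarrow> (real ^ 'N \<Rightarrow> complex) \<Rightarrow> (real ^ 'N \<Rightarrow> complex)"
    and \<tau> :: "nat \<Rightarrow> real"
    and q :: "nat \<Rightarrow> nat"
    and l :: "nat \<Rightarrow> real"
    and P :: "nat \<Rightarrow> (real ^ 'N) set set"
    and T :: "nat \<Rightarrow> (real ^ 'N) set \<Rightarrow> (real ^ 'N) set"
    and v :: "nat \<Rightarrow> nat \<Rightarrow> real ^ 'N \<Rightarrow> complex"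
    and \<theta> :: "nat \<Rightarrow> nat \<Rightarrow> real"
    and \<alpha> :: real
    and D :: "real set"
    and g :: "real ^ 'N \<Rightarrow> complex"
  assumes "is_norm nrm"
    and "compact X"
    and "lipschitz_flow nrm X S"
    and "admissible_measure X S \<mu>"
    and "koopman_spectral_measure S \<mu> E"
    and "time_steps \<tau>"
    and "partition_sequence nrm X \<mu> q l P"
    and "\<And>n. n \<ge> 1 \<Longrightarrow> bij_betw (T n) (P n) (P n)"
    and "periodically_approximates nrm X S \<tau> P T"
    and "\<And>n. n \<ge> 1 \<Longrightarrow> discrete_eigenbasis \<mu> (P n) (T n) (q n) (v n) (\<theta> n)"
    and "\<alpha> > 0"
    and "is_interval D"
    and "g \<in> L2 \<mu>"
  shows "(\<lambda>n. L2_dist \<mu> (smoothed_projection \<mu> E \<alpha> D g) (discrete_smoothed_projection \<mu> (q n) (v n) (\<lambda>k. \<theta> n k / \<tau> n) \<alpha> D (averaging \<mu> (P n) g))) \<longlonglongrightarrow> 0"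
proof -
  interpret periodic_approximation nrm X S \<mu> E \<tau> q l P T v \<theta>
    by unfold_locales (use assms in auto)
  obtain C where f: "continuous_on UNIV (smoothed_indicator \<alpha> D)"
    "\<And>\<omega>. \<bar>smoothed_indicator \<alpha> D \<omega>\<bar> \<le> C"
    using smoothed_indicator_continuous_bounded[OF assms(11,12)] by blast
  let ?F = "\<lambda>\<omega>. complex_of_real (smoothed_indicator \<alpha> D \<omega>)"
  have conv: "converges ?F" by (rule converges_bounded_continuous[OF f])
  obtain h where "HS ?F g h" using HS_ex[OF converges_bounded_borel[OF conv] assms(13)] .
  \<comment> \<open>\<open>spectral_integral\<close> is a choice; the existence of \<open>h\<close>
    ensures that the chosen function is a spectral integral.\<close>
  then have "HS ?F g (smoothed_projection \<mu> E \<alpha> D g)"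
    using someI[of "HS ?F g" h] by (simp add: smoothed_projection_def spectral_integral_def)
  from convergesD[OF conv assms(13) this] show ?thesis
  proof (rule Lim_transform_eventually)
    show "\<forall>\<^sub>F n in sequentially. L2_dist \<mu> (smoothed_projection \<mu> E \<alpha> D g) (Op n ?F g) =
      L2_dist \<mu> (smoothed_projection \<mu> E \<alpha> D g) (discrete_smoothed_projection \<mu> (q n) (v n) (\<lambda>k. \<theta> n k / \<tau> n) \<alpha> D (averaging \<mu> (P n) g))"
      \<comment> \<open>The sequences are unconstrained at index 0, so the two expressions are
        identified only from 1 on.\<close>
      using eventually_ge_at_top[of 1]
    proof eventually_elim
      case (elim n)
      have "discrete_smoothed_projection \<mu> (q n) (v n) (\<lambda>k. \<theta> n k / \<tau> n) \<alpha> D (averaging \<mu> (P n) g) =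
          Op n ?F (averaging \<mu> (P n) g)"
        unfolding discrete_smoothed_projection_def eigen_calculus_def card_P[OF elim] ..
      then show ?case by (simp only: Op_averaging[OF elim assms(13)])
    qed
  qed
qed

end
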